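(* Let $f(z)=z^d+c$ with $d\ge 2$ and $c\in\mathbb{C}$, and assume that the Julia set $J(f)$ has positive Lebesgue (area) measure. Then for Lebesgue almost every $z\in J(f)$ the limit $$\chi(f,z)=\lim_{n\to\infty}\frac1n\log|Df^n(z)|$$ exists and equals $0$. *)

theory Defs
  imports "HOL-Analysis.Analysis"
begin

definition unicrit :: "nat \<Rightarrow> complex \<Rightarrow> complex \<Rightarrow> complex" where
  "unicrit d c z = z ^ d + c"

definition filled_julia :: "(complex \<Rightarrow> complex) \<Rightarrow> complex set" where
  "filled_julia f = {z. bounded (range (\<lambda>n. (f ^^ n) z))}"

definition julia :: "(complex \<Rightarrow> complex) \<Rightarrow> complex set" where
  "julia f = frontier (filled_julia f)"

end

theory Submission
  imports Defs "HOL-Analysis.Analysis" "HOL-Computational_Algebra.Fundamental_Theorem_Algebra"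
begin

text \<open>No iterate maps a disc about a point of the orbit of \<open>z \<in> J\<close> into itself, because such a disc
  would lie in the interior of the filled Julia set. This alone bounds derivatives along the orbit
  from below: as long as the image of a small disc stays away from the critical point it evolves almost
  linearly, and by pigeonhole it cannot shrink exponentially at more than boundedly many starting times;
  when it meets the critical point it has to grow back before the next visit. The outcome is
  \<open>\<bar>Df\<^sup>n(z)\<bar> \<ge> C exp (- \<epsilon> n) (min\<^sub>j \<bar>f\<^sup>j(z)\<bar>)\<^sup>d\<close>. The same fact forces
  the close visits to be sparse, so that a small disc about \<open>z\<close> is mapped with bounded degree, and a
  Borel-Cantelli argument shows that almost every \<open>z \<in> J\<close> is slowly recurrent, that is,
  \<open>\<bar>f\<^sup>j(z)\<bar> \<ge> exp (- \<epsilon> j)\<close> eventually. Hence the lower exponent is nonnegative. If the upper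
  exponent were positive, discs of definite size would be reached with bounded degree from
  arbitrarily small discs about \<open>z\<close>; since \<open>J\<close> is nowhere dense it would be porous at \<open>z\<close>, which happens
  only on a null set.\<close>


text \<open>No hypothesis on \<open>c\<close> excludes deep returns to the critical point; they can
  only be priced. Inverse branches and distortion theorems are replaced by a recursion in the moduli
  of the orbit points (\<open>spread\<close>), which majorizes images of discs, and bounded degree
  enters as a number of pieces or as a bounded exponent. Slow recurrence has to be proved for points
  not yet known to be slowly recurrent, where the minimum in the derivative bound may be as small as
  one likes. The bound is therefore applied to radii truncated from below at \<theta> = exp (- \<xi>
  k). This is legitimate because larger radii give a larger \<open>spread\<close>, so that
  \<open>noncontracting\<close> persists. The number N of visits below \<theta> does not depend on
  k, and N visits turn an exponential loss into at most its d^N-th power. Hence the order of choice: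
  \<xi>, then N, then the rate \<eta>, then the constants of the derivative bound.\<close>

section \<open>Discs under the power map\<close>

text \<open>The map \<open>z ^ d + c\<close> sends the disc of radius \<open>r\<close> about \<open>y\<close> into the disc of radius
  \<open>incr d \<bar>y\<bar> r\<close> about the image of \<open>y\<close>.\<close>

definition incr :: "nat \<Rightarrow> real \<Rightarrow> real \<Rightarrow> real" where
  "incr d a r = (a + r) ^ d - a ^ d"

lemma incr_eq_sum: "incr d a r = r * (\<Sum>i<d. a ^ (d - Suc i) * (a + r) ^ i)"
  unfolding incr_def by (subst power_diff_sumr2) (simp add: mult.commute)

lemma incr_nonneg: "0 \<le> a \<Longrightarrow> 0 \<le> r \<Longrightarrow> 0 \<le> incr d a r"
  by (simp add: incr_def power_mono)

lemma incr_mono: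
  assumes "0 \<le> a" "a \<le> a'" "0 \<le> r" "r \<le> r'"
  shows "incr d a r \<le> incr d a' r'"
  unfolding incr_eq_sum using assms
  by (intro mult_mono sum_mono power_mono sum_nonneg mult_nonneg_nonneg) auto

lemma incr_ge_linear:
  assumes "0 \<le> a" "0 \<le> r"
  shows "real d * a ^ (d - 1) * r \<le> incr d a r"
proof -
  have "a ^ (d - 1) \<le> a ^ (d - Suc i) * (a + r) ^ i" if "i < d" for i
  proof -
    have "a ^ (d - 1) = a ^ (d - Suc i) * a ^ i"
      using that by (simp flip: power_add)
    also have "\<dots> \<le> a ^ (d - Suc i) * (a + r) ^ i"
      using assms by (intro mult_left_mono power_mono) auto
    finally show ?thesis .
  qed
  then have "(\<Sum>i<d. a ^ (d - 1)) \<le> (\<Sum>i<d. a ^ (d - Suc i) * (a + r) ^ i)"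
    by (intro sum_mono) auto
  then have "real d * a ^ (d - 1) \<le> (\<Sum>i<d. a ^ (d - Suc i) * (a + r) ^ i)"
    by simp
  then show ?thesis
    unfolding incr_eq_sum using assms by (metis mult.commute mult_left_mono)
qed

lemma incr_le_linear:
  assumes "0 \<le> a" "0 \<le> r"
  shows "incr d a r \<le> real d * (a + r) ^ (d - 1) * r"
proof -
  have "a ^ (d - Suc i) * (a + r) ^ i \<le> (a + r) ^ (d - 1)" if "i < d" for i
  proof -
    have "a ^ (d - Suc i) * (a + r) ^ i \<le> (a + r) ^ (d - Suc i) * (a + r) ^ i"
      using assms by (intro mult_right_mono power_mono) auto
    also have "\<dots> = (a + r) ^ (d - 1)"
      using that by (simp flip: power_add)
    finally show ?thesis .
  qed
  then have "(\<Sum>i<d. a ^ (d - Suc i) * (a + r) ^ i) \<le> (\<Sum>i<d. (a + r) ^ (d - 1))"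
    by (intro sum_mono) auto
  then have "(\<Sum>i<d. a ^ (d - Suc i) * (a + r) ^ i) \<le> real d * (a + r) ^ (d - 1)"
    by simp
  then show ?thesis
    unfolding incr_eq_sum using assms by (metis mult.commute mult_left_mono)
qed

lemma incr_ge_power:
  assumes "0 \<le> a" "0 \<le> r" "0 < d"
  shows "r ^ d \<le> incr d a r"
proof -
  have "r ^ (d - 1) \<le> (a + r) ^ (d - 1)"
    using assms by (intro power_mono) auto
  also have "\<dots> = a ^ (d - Suc (d - 1)) * (a + r) ^ (d - 1)"
    using assms by simp
  also have "\<dots> \<le> (\<Sum>i<d. a ^ (d - Suc i) * (a + r) ^ i)"
    using assms by (intro member_le_sum) auto
  finally have "r * r ^ (d - 1) \<le> incr d a r"
    unfolding incr_eq_sum using assms by (intro mult_left_mono)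
  moreover have "r * r ^ (d - 1) = r ^ d"
    using assms by (cases d) auto
  ultimately show ?thesis by simp
qed

lemma incr_le_power: "0 \<le> a \<Longrightarrow> incr d a r \<le> (a + r) ^ d"
  by (simp add: incr_def)

text \<open>A cocycle identity: enlarging a disc in two stages amounts to moving the centre outwards
  in between. It makes nested discs comparable in \<open>orbit_dist_add_spread_le\<close>.\<close>

lemma incr_shift: "incr d a (x + r) = incr d a x + incr d (a + x) r"
  by (simp add: incr_def add.assoc)

lemma incr_scale_down:
  assumes "0 \<le> a" "0 \<le> r" "0 \<le> t" "t \<le> 1"
  shows "incr d a (t * r) \<le> t * incr d a r"
proof -
  have "t * r \<le> r" using assms by (simp add: mult_left_le_one_le)
  then have "(\<Sum>i<d. a ^ (d - Suc i) * (a + t * r) ^ i) \<le> (\<Sum>i<d. a ^ (d - Suc i) * (a + r) ^ i)"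
    using assms by (intro sum_mono mult_left_mono power_mono) auto
  then have "(t * r) * (\<Sum>i<d. a ^ (d - Suc i) * (a + t * r) ^ i)
      \<le> (t * r) * (\<Sum>i<d. a ^ (d - Suc i) * (a + r) ^ i)"
    using assms by (intro mult_left_mono) auto
  then show ?thesis unfolding incr_eq_sum by (simp add: mult.assoc)
qed

text \<open>Each summand of \<open>incr_eq_sum\<close> grows by at most t^(d-1), since
  \<open>a \<le> t * a\<close>. Unlike \<open>incr_scale_down\<close>, this direction costs the full
  power \<open>d\<close>, which is the true rate at the critical point.\<close>

lemma incr_scale_up:
  assumes "0 \<le> a" "0 \<le> r" "1 \<le> t" "0 < d"
  shows "incr d a (t * r) \<le> t ^ d * incr d a r"
proof -
  have "a ^ (d - Suc i) * (a + t * r) ^ i \<le> t ^ (d - 1) * (a ^ (d - Suc i) * (a + r) ^ i)"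
    if "i < d" for i
  proof -
    have "a \<le> t * a" using assms by (simp add: mult_le_cancel_right1)
    then have "(a + t * r) ^ i \<le> (t * (a + r)) ^ i"
      using assms by (intro power_mono) (auto simp: distrib_left)
    also have "\<dots> = t ^ i * (a + r) ^ i" by (simp add: power_mult_distrib)
    also have "\<dots> \<le> t ^ (d - 1) * (a + r) ^ i"
      using assms that by (intro mult_right_mono power_increasing) auto
    finally have "(a + t * r) ^ i \<le> t ^ (d - 1) * (a + r) ^ i" .
    then have "a ^ (d - Suc i) * (a + t * r) ^ i \<le> a ^ (d - Suc i) * (t ^ (d - 1) * (a + r) ^ i)"
      using assms by (intro mult_left_mono) auto
    then show ?thesis by (simp add: mult_ac)
  qed
  then have "(\<Sum>i<d. a ^ (d - Suc i) * (a + t * r) ^ i)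
      \<le> t ^ (d - 1) * (\<Sum>i<d. a ^ (d - Suc i) * (a + r) ^ i)"
    unfolding sum_distrib_left by (intro sum_mono) auto
  then have "incr d a (t * r) \<le> (t * r) * (t ^ (d - 1) * (\<Sum>i<d. a ^ (d - Suc i) * (a + r) ^ i))"
    unfolding incr_eq_sum using assms by (intro mult_left_mono) auto
  also have "\<dots> = (t * t ^ (d - 1)) * incr d a r"
    unfolding incr_eq_sum by (simp add: mult_ac)
  also have "t * t ^ (d - 1) = t ^ d"
    using assms by (cases d) auto
  finally show ?thesis .
qed

lemma incr_le_linear_small:
  assumes "0 \<le> a" "0 \<le> r" "r \<le> u * a"
  shows "incr d a r \<le> (1 + u) ^ (d - 1) * (real d * a ^ (d - 1)) * r"
proof -
  have "(a + r) ^ (d - 1) \<le> ((1 + u) * a) ^ (d - 1)"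
    using assms by (intro power_mono) (auto simp: algebra_simps)
  then have "real d * (a + r) ^ (d - 1) * r \<le> real d * ((1 + u) * a) ^ (d - 1) * r"
    using assms by (intro mult_right_mono mult_left_mono) auto
  with incr_le_linear[OF assms(1,2), of d] show ?thesis
    by (simp add: power_mult_distrib mult_ac)
qed

text \<open>If \<open>a j\<close> is the modulus of the \<open>j\<close>-th point of an orbit, \<open>spread d a s m r\<close> bounds the image
  under the \<open>m\<close>-th iterate of the disc of radius \<open>r\<close> about the \<open>s\<close>-th point, and \<open>slope d a s m\<close> is
  the modulus of the derivative of that iterate.\<close>

fun spread :: "nat \<Rightarrow> (nat \<Rightarrow> real) \<Rightarrow> nat \<Rightarrow> nat \<Rightarrow> real \<Rightarrow> real" where
  "spread d a s 0 r = r"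
| "spread d a s (Suc m) r = incr d (a (s + m)) (spread d a s m r)"

definition slope :: "nat \<Rightarrow> (nat \<Rightarrow> real) \<Rightarrow> nat \<Rightarrow> nat \<Rightarrow> real" where
  "slope d a s m = (\<Prod>i<m. real d * a (s + i) ^ (d - 1))"

lemma spread_add: "spread d a s (m + n) r = spread d a (s + m) n (spread d a s m r)"
  by (induction n) (auto simp: add.assoc)

lemma slope_0 [simp]: "slope d a s 0 = 1"
  by (simp add: slope_def)

lemma slope_Suc: "slope d a s (Suc m) = slope d a s m * (real d * a (s + m) ^ (d - 1))"
  by (simp add: slope_def)

lemma slope_add: "slope d a s (m + n) = slope d a s m * slope d a (s + m) n"
  by (induction n) (auto simp: slope_Suc add.assoc mult_ac)

lemma slope_Suc_left: "slope d a s (Suc m) = (real d * a s ^ (d - 1)) * slope d a (Suc s) m"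
  using slope_add[of d a s 1 m] by (simp add: slope_Suc)

context
  fixes a :: "nat \<Rightarrow> real"
  assumes a_nonneg: "\<And>j. 0 \<le> a j"
begin

lemma slope_nonneg: "0 \<le> slope d a s m"
  unfolding slope_def using a_nonneg by (intro prod_nonneg) auto

lemma spread_nonneg: "0 \<le> r \<Longrightarrow> 0 \<le> spread d a s m r"
  by (induction m) (auto intro: incr_nonneg a_nonneg)

lemma spread_mono:
  assumes "\<And>j. a j \<le> a' j" "0 \<le> r" "r \<le> r'"
  shows "spread d a s m r \<le> spread d a' s m r'"
proof (induction m)
  case (Suc m)
  then show ?case
    using assms a_nonneg by (auto intro!: incr_mono spread_nonneg)
qed (use assms in auto)

lemma spread_scale_down:
  assumes "0 \<le> r" "0 \<le> t" "t \<le> 1"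
  shows "spread d a s m (t * r) \<le> t * spread d a s m r"
proof (induction m)
  case (Suc m)
  have "spread d a s (Suc m) (t * r) \<le> incr d (a (s + m)) (t * spread d a s m r)"
    using Suc assms a_nonneg by (auto intro!: incr_mono spread_nonneg)
  also have "\<dots> \<le> t * incr d (a (s + m)) (spread d a s m r)"
    using assms a_nonneg by (intro incr_scale_down spread_nonneg) auto
  finally show ?case by simp
qed auto

lemma spread_ge_slope:
  assumes "0 \<le> r"
  shows "slope d a s m * r \<le> spread d a s m r"
proof (induction m)
  case (Suc m)
  have "slope d a s (Suc m) * r = (real d * a (s + m) ^ (d - 1)) * (slope d a s m * r)"
    by (simp add: slope_Suc)
  also have "\<dots> \<le> (real d * a (s + m) ^ (d - 1)) * spread d a s m r"
    using Suc a_nonneg by (intro mult_left_mono) auto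
  also have "\<dots> \<le> spread d a s (Suc m) r"
    using incr_ge_linear[OF a_nonneg spread_nonneg[OF assms]] by simp
  finally show ?case .
qed auto

text \<open>Upper counterpart of \<open>spread_ge_slope\<close>: while the disc is small relative to
  its distance from the critical point, each step deviates from linearity by at most the factor (1 +
  u)^(d-1).\<close>

lemma spread_le_slope:
  assumes "0 \<le> r" "0 \<le> u" "\<And>k. k < m \<Longrightarrow> spread d a s k r \<le> u * a (s + k)"
  shows "spread d a s m r \<le> (1 + u) ^ ((d - 1) * m) * slope d a s m * r"
  using assms(3)
proof (induction m)
  case (Suc m)
  have "spread d a s (Suc m) r
      \<le> (1 + u) ^ (d - 1) * (real d * a (s + m) ^ (d - 1)) * spread d a s m r"
    unfolding spread.simps using Suc.prems[of m]
    by (intro incr_le_linear_small a_nonneg spread_nonneg assms(1)) auto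
  also have "\<dots> \<le> (1 + u) ^ (d - 1) * (real d * a (s + m) ^ (d - 1))
      * ((1 + u) ^ ((d - 1) * m) * slope d a s m * r)"
    using Suc a_nonneg assms(2) by (intro mult_left_mono) auto
  also have "\<dots> = (1 + u) ^ ((d - 1) * Suc m) * slope d a s (Suc m) * r"
    by (simp add: slope_Suc power_add)
  finally show ?case .
qed auto

lemma spread_le_Lipschitz:
  assumes "\<And>j. a j \<le> B" "0 \<le> r" "\<And>k. k < m \<Longrightarrow> spread d a s k r \<le> 1"
  shows "spread d a s m r \<le> (real d * (B + 1) ^ (d - 1)) ^ m * r"
  using assms(3)
proof (induction m)
  case (Suc m)
  let ?L = "real d * (B + 1) ^ (d - 1)"
  have B: "0 \<le> B" using assms(1)[of 0] a_nonneg[of 0] by simp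
  have nn: "0 \<le> spread d a s m r" using assms by (simp add: spread_nonneg)
  have "(a (s + m) + spread d a s m r) ^ (d - 1) \<le> (B + 1) ^ (d - 1)"
    using Suc.prems[of m] assms(1)[of "s + m"] a_nonneg[of "s + m"] nn by (intro power_mono) auto
  then have "real d * (a (s + m) + spread d a s m r) ^ (d - 1) * spread d a s m r
      \<le> ?L * spread d a s m r"
    using nn by (intro mult_right_mono mult_left_mono) auto
  then have "spread d a s (Suc m) r \<le> ?L * spread d a s m r"
    using incr_le_linear[of "a (s + m)" "spread d a s m r" d] a_nonneg nn by auto
  also have "\<dots> \<le> ?L * (?L ^ m * r)"
    using Suc B by (intro mult_left_mono) auto
  finally show ?case by simp
qed auto

end

section \<open>Lower bounds for derivatives along noncontracting orbits\<close>

text \<open>No disc about an orbit point is mapped into itself by an iterate; orbits in the Julia set have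
  this property. The radii \<open>a\<close> may exceed the moduli of the points \<open>p\<close>, so that visits to
  the critical point below a given depth can be truncated.\<close>

definition noncontracting :: "nat \<Rightarrow> real \<Rightarrow> (nat \<Rightarrow> complex) \<Rightarrow> (nat \<Rightarrow> real) \<Rightarrow> bool" where
  "noncontracting d B p a \<longleftrightarrow> (\<forall>j. norm (p j) \<le> a j \<and> a j \<le> B) \<and>
     (\<forall>s m r. 0 < m \<longrightarrow> 0 < r \<longrightarrow> r < dist (p s) (p (s + m)) + spread d a s m r)"

lemma noncontracting_nonneg: "noncontracting d B p a \<Longrightarrow> 0 \<le> a j"
  unfolding noncontracting_def by (meson norm_ge_zero order_trans)

lemma noncontractingD:
  assumes "noncontracting d B p a"
  shows "norm (p j) \<le> a j" "a j \<le> B"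
    "0 < m \<Longrightarrow> 0 < r \<Longrightarrow> r < dist (p s) (p (s + m)) + spread d a s m r"
  using assms by (auto simp: noncontracting_def)

lemma noncontracting_radii:
  assumes "noncontracting d B p a" "0 < m" "0 < r"
  shows "r < a s + a (s + m) + spread d a s m r"
proof -
  have "dist (p s) (p (s + m)) \<le> norm (p s) + norm (p (s + m))"
    unfolding dist_norm by (rule norm_triangle_ineq4)
  with noncontractingD[OF assms(1)] assms(2,3) show ?thesis
    by (smt (verit))
qed

text \<open>This is what permits truncation: the points \<open>p\<close> stay and only the radii
  grow, which helps the strict inequality.\<close>

lemma noncontracting_mono:
  assumes "noncontracting d B p a" "\<And>j. a j \<le> a' j" "\<And>j. a' j \<le> B"
  shows "noncontracting d B p a'"
  unfolding noncontracting_def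
proof (intro conjI allI impI)
  show "norm (p j) \<le> a' j" for j
    using assms(2) noncontractingD(1)[OF assms(1)] by (meson order_trans)
  fix s m :: nat and r :: real
  assume "0 < m" "0 < r"
  then have "r < dist (p s) (p (s + m)) + spread d a s m r"
    using assms(1) noncontractingD(3) by blast
  also have "spread d a s m r \<le> spread d a' s m r"
    using assms \<open>0 < r\<close> noncontracting_nonneg[OF assms(1)] by (intro spread_mono) auto
  finally show "r < dist (p s) (p (s + m)) + spread d a' s m r" by simp
qed (use assms in auto)

text \<open>The inflation by \<open>(1 + \<eta>) ^ m\<close> makes the discs started at a lonely time shrink
  geometrically, so two lonely times that are far apart in time but close in space contradict
  \<open>noncontracting\<close>.\<close>

definition captures :: "nat \<Rightarrow> real \<Rightarrow> real \<Rightarrow> (nat \<Rightarrow> real) \<Rightarrow> nat \<Rightarrow> nat \<Rightarrow> real \<Rightarrow> bool" where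
  "captures d \<eta> \<delta> a s m r \<longleftrightarrow> \<eta> * min \<delta> (a (s + m)) \<le> (1 + \<eta>) ^ m * spread d a s m r"

definition lonely :: "nat \<Rightarrow> real \<Rightarrow> real \<Rightarrow> (nat \<Rightarrow> real) \<Rightarrow> nat \<Rightarrow> nat \<Rightarrow> bool" where
  "lonely d \<eta> \<delta> a n s \<longleftrightarrow> (\<forall>m. 0 < m \<and> s + m \<le> n \<longrightarrow> \<not> captures d \<eta> \<delta> a s m (\<eta> * \<delta>))"

lemma not_captures_less:
  assumes "\<not> captures d \<eta> \<delta> a s m r" "\<And>j. 0 \<le> a j" "0 \<le> r" "0 < \<eta>"
  shows "spread d a s m r < \<eta> * min \<delta> (a (s + m))"
proof -
  have "1 * spread d a s m r \<le> (1 + \<eta>) ^ m * spread d a s m r"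
    using assms by (intro mult_right_mono one_le_power spread_nonneg) auto
  then show ?thesis using assms(1) by (simp add: captures_def)
qed

text \<open>Pigeonhole over a finite net and over residues modulo \<open>q\<close>. Equal residues
  force a gap of at least \<open>q\<close>, after which the inflation factor is at least 2 and the
  disc has shrunk below half its radius; equal net points put the two centres within the other half.
  The disc would then be mapped into itself. The bound is uniform in the orbit, the radii and
  \<open>n\<close>.\<close>

lemma card_lonely_bounded:
  assumes "0 < \<eta>" "0 < \<delta>"
  obtains P :: nat where "\<And>d p a n. noncontracting d B p a \<Longrightarrow> card {s. s < n \<and> lonely d \<eta> \<delta> a n s} \<le> P"
proof -
  have e: "0 < \<eta> * \<delta> / 4" using assms by simp
  obtain F :: "complex set" where F: "finite F" "cball 0 B \<subseteq> (\<Union>x\<in>F. ball x (\<eta> * \<delta> / 4))"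
    using compactE_image[OF compact_cball, of UNIV "\<lambda>x. ball x (\<eta> * \<delta> / 4)" 0 B] e
    by (smt (verit, best) UNIV_I UN_I centre_in_ball open_ball subsetI)
  obtain q where q: "2 \<le> (1 + \<eta>) ^ q"
    using real_arch_pow[of "1 + \<eta>" 2] assms by (auto intro: less_imp_le)
  then have "0 < q" using assms by (cases q) auto
  show thesis
  proof (rule that)
    fix d p a n assume nc: "noncontracting d B p a"
    let ?S = "{s. s < n \<and> lonely d \<eta> \<delta> a n s}"
    have nn: "0 \<le> a j" for j using nc by (rule noncontracting_nonneg)
    have "\<exists>x\<in>F. dist (p s) x < \<eta> * \<delta> / 4" for s
      using F(2) noncontractingD(1,2)[OF nc, of s] by (force simp: dist_commute)
    then obtain c where c: "\<And>s. c s \<in> F" "\<And>s. dist (p s) (c s) < \<eta> * \<delta> / 4" by metis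
    have neq: False if "s \<in> ?S" "t \<in> ?S" "s < t" "c s = c t" "s mod q = t mod q" for s t
    proof -
      obtain m where m: "t = s + m" "0 < m" using \<open>s < t\<close> less_imp_add_positive by blast
      have "q dvd m"
        using that m by (metis add_diff_cancel_left' mod_eq_dvd_iff_nat le_add1)
      then have "q \<le> m" using m by (simp add: dvd_imp_le)
      then have "2 \<le> (1 + \<eta>) ^ m"
        using q assms(1) power_increasing[of q m "1 + \<eta>"] by linarith
      moreover have "(1 + \<eta>) ^ m * spread d a s m (\<eta> * \<delta>) < \<eta> * \<delta>"
      proof -
        have "(1 + \<eta>) ^ m * spread d a s m (\<eta> * \<delta>) < \<eta> * min \<delta> (a (s + m))"
          using that m unfolding lonely_def captures_def by auto
        also have "\<dots> \<le> \<eta> * \<delta>" using assms by auto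
        finally show ?thesis .
      qed
      moreover have "0 \<le> spread d a s m (\<eta> * \<delta>)" using nn assms by (intro spread_nonneg) auto
      ultimately have "2 * spread d a s m (\<eta> * \<delta>) < \<eta> * \<delta>"
        using mult_right_mono[of 2 "(1 + \<eta>) ^ m" "spread d a s m (\<eta> * \<delta>)"] by linarith
      moreover have "dist (p s) (p (s + m)) < \<eta> * \<delta> / 2"
        using c(2)[of s] c(2)[of t] that(4) m
          dist_triangle_half_r[of "c s" "p s" "\<eta> * \<delta> / 2" "p t"]
        by (auto simp: dist_commute)
      moreover have "\<eta> * \<delta> < dist (p s) (p (s + m)) + spread d a s m (\<eta> * \<delta>)"
        using noncontractingD(3)[OF nc m(2)] assms by auto
      ultimately show False by linarith
    qed
    have "inj_on (\<lambda>s. (c s, s mod q)) ?S"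
    proof (rule inj_onI)
      fix s t assume "s \<in> ?S" "t \<in> ?S" "(c s, s mod q) = (c t, t mod q)"
      then show "s = t" using neq[of s t] neq[of t s] by (cases s t rule: linorder_cases) auto
    qed
    moreover have "(\<lambda>s. (c s, s mod q)) ` ?S \<subseteq> F \<times> {..<q}"
      using c \<open>0 < q\<close> by auto
    ultimately have "card ?S \<le> card (F \<times> {..<q})"
      using F(1) by (intro card_inj_on_le) auto
    then show "card ?S \<le> card F * q" by (simp add: card_cartesian_product)
  qed
qed

context
  fixes d :: nat and B \<eta> \<delta> :: real and m0 :: nat and p :: "nat \<Rightarrow> complex" and a :: "nat \<Rightarrow> real"
  assumes d: "2 \<le> d" and B: "0 \<le> B" and eta: "0 < \<eta>" "\<eta> \<le> 1"
    and m0: "5 ^ d \<le> real d * \<eta> * (1 + \<eta>) ^ m0"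
    and delta: "0 < \<delta>" "\<delta> \<le> 1/4"
    and delta_small: "(2 * (real d * (B + 1) ^ (d - 1))) ^ m0 * 5 ^ d * \<delta> < \<eta>"
    and nc: "noncontracting d B p a"
begin

lemma radius_nonneg: "0 \<le> a j"
  using nc by (rule noncontracting_nonneg)

text \<open>Before the first capture the disc stays below \<eta> times each radius, so
  \<open>spread_le_slope\<close> applies, and the capture itself turns the upper bound on
  \<open>spread\<close> into a lower bound on \<open>slope\<close>. The exponent
  \<open>d * l\<close> consists of \<open>(d - 1) * l\<close> from distortion and \<open>l\<close>
  from the inflation in \<open>captures\<close>.\<close>

lemma jump_free:
  assumes "\<delta> \<le> a s" "captures d \<eta> \<delta> a s l (\<eta> * \<delta>)"
    "\<And>k. 0 < k \<Longrightarrow> k < l \<Longrightarrow> \<not> captures d \<eta> \<delta> a s k (\<eta> * \<delta>)"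
  shows "min \<delta> (a (s + l)) \<le> (1 + \<eta>) ^ (d * l) * (\<delta> * slope d a s l)"
proof -
  have "spread d a s k (\<eta> * \<delta>) \<le> \<eta> * a (s + k)" if "k < l" for k
  proof (cases "k = 0")
    case True
    then show ?thesis using assms(1) eta by simp
  next
    case False
    then have "spread d a s k (\<eta> * \<delta>) < \<eta> * min \<delta> (a (s + k))"
      using assms(3) that radius_nonneg eta delta by (intro not_captures_less) auto
    also have "\<dots> \<le> \<eta> * a (s + k)" using eta by auto
    finally show ?thesis by simp
  qed
  then have "spread d a s l (\<eta> * \<delta>) \<le> (1 + \<eta>) ^ ((d - 1) * l) * slope d a s l * (\<eta> * \<delta>)"
    using eta delta radius_nonneg by (intro spread_le_slope) auto
  then have "(1 + \<eta>) ^ l * spread d a s l (\<eta> * \<delta>)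
      \<le> (1 + \<eta>) ^ l * ((1 + \<eta>) ^ ((d - 1) * l) * slope d a s l * (\<eta> * \<delta>))"
    using eta by (intro mult_left_mono) auto
  then have "\<eta> * min \<delta> (a (s + l)) \<le> \<eta> * ((1 + \<eta>) ^ l * (1 + \<eta>) ^ ((d - 1) * l) * (\<delta> * slope d a s l))"
    using assms(2) unfolding captures_def by (simp add: mult_ac)
  then have "min \<delta> (a (s + l)) \<le> (1 + \<eta>) ^ l * (1 + \<eta>) ^ ((d - 1) * l) * (\<delta> * slope d a s l)"
    using eta by (simp add: mult_le_cancel_left)
  also have "(1 + \<eta>) ^ l * (1 + \<eta>) ^ ((d - 1) * l) = (1 + \<eta>) ^ (d * l)"
    using d by (simp flip: power_add add: algebra_simps diff_mult_distrib)
  finally show ?thesis .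
qed

text \<open>Since no disc about the critical point returns into itself, a disc of radius \<open>R\<close> needs a time
  of order \<open>- ln R\<close> before it captures again; this absorbs the constants.\<close>

lemma jump_close:
  assumes R: "a s \<le> R" "0 < R" "R \<le> \<delta>" and "0 < l" "captures d \<eta> \<delta> a s l (4 * R)"
    and before: "\<And>k. 0 < k \<Longrightarrow> k < l \<Longrightarrow> \<not> captures d \<eta> \<delta> a s k (4 * R)"
  shows "a s ^ d * min \<delta> (a (s + l)) \<le> (1 + \<eta>) ^ ((d + 1) * l) * R ^ d * (a s * slope d a s l)"
proof -
  let ?L = "real d * (B + 1) ^ (d - 1)"
  obtain k where k: "l = Suc k" using \<open>0 < l\<close> by (cases l) auto
  define X where "X = spread d a s l (4 * R)"
  have X: "X = spread d a (Suc s) k (incr d (a s) (4 * R))"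
    unfolding X_def k using spread_add[of d a s 1 k] by simp
  have "incr d (a s) (4 * R) \<le> (a s + 4 * R) ^ d"
    using radius_nonneg by (rule incr_le_power)
  also have "\<dots> \<le> (5 * R) ^ d"
    using R radius_nonneg by (intro power_mono) auto
  finally have first: "incr d (a s) (4 * R) \<le> (5 * R) ^ d" .
  have first_nn: "0 \<le> incr d (a s) (4 * R)"
    using R radius_nonneg by (intro incr_nonneg) auto
  have small: "spread d a (Suc s) i (incr d (a s) (4 * R)) < \<eta> * min \<delta> (a (Suc s + i))"
    if "i < k" for i
  proof -
    have "spread d a s (Suc i) (4 * R) < \<eta> * min \<delta> (a (s + Suc i))"
      using before[of "Suc i"] that k radius_nonneg R eta by (intro not_captures_less) auto
    then show ?thesis using spread_add[of d a s 1 i] by simp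
  qed
  have L1: "1 \<le> ?L"
  proof -
    have "1 * 1 \<le> ?L" using d B by (intro mult_mono one_le_power) auto
    then show ?thesis by simp
  qed
  have Xnn: "0 \<le> X" unfolding X_def using radius_nonneg R by (intro spread_nonneg) auto
  have "X \<le> ?L ^ k * incr d (a s) (4 * R)"
    unfolding X
  proof (rule spread_le_Lipschitz)
    fix i assume "i < k"
    then have "spread d a (Suc s) i (incr d (a s) (4 * R)) < \<eta> * \<delta>"
      using small[of i] eta by (smt (verit) min.cobounded1 mult_left_mono)
    also have "\<dots> \<le> 1 * 1" using eta delta by (intro mult_mono) auto
    finally show "spread d a (Suc s) i (incr d (a s) (4 * R)) \<le> 1" by simp
  qed (use radius_nonneg first_nn noncontractingD(2)[OF nc] in auto)
  also have "\<dots> \<le> ?L ^ k * (5 * R) ^ d"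
    using first L1 by (intro mult_left_mono) auto
  also have "\<dots> \<le> ?L ^ l * (5 * R) ^ d"
    unfolding k using L1 R by (intro mult_right_mono power_increasing) auto
  finally have XL: "X \<le> ?L ^ l * (5 * R) ^ d" .
  have ev: "\<eta> * min \<delta> (a (s + l)) \<le> (1 + \<eta>) ^ l * X"
    using assms(5) by (simp add: captures_def X_def)
  have one: "1 \<le> (1 + \<eta>) ^ l" using eta by (intro one_le_power) auto
  \<comment> \<open>At the capture the disc is again of size comparable to \<open>R\<close>. If the
    new point is within \<delta> of 0, noncontraction leaves at least \<open>3 * R\<close> for
    \<open>a (s + l) + X\<close>, and the capture controls \<open>a (s + l)\<close> by
    \<open>X\<close>; otherwise the capture is measured against \<delta>, which is at least
    \<open>R\<close>.\<close>
  have "\<eta> * R \<le> (1 + \<eta>) ^ l * X"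
  proof (cases "a (s + l) \<le> \<delta>")
    case True
    have "4 * R < a s + a (s + l) + X"
      unfolding X_def using nc \<open>0 < l\<close> R by (intro noncontracting_radii) auto
    then have "\<eta> * (3 * R) \<le> \<eta> * (a (s + l) + X)"
      using R eta by (intro mult_left_mono) auto
    also have "\<dots> \<le> (1 + \<eta>) ^ l * X + \<eta> * X"
      using ev True by (simp add: distrib_left)
    also have "\<eta> * X \<le> (1 + \<eta>) ^ l * X"
    proof -
      have "\<eta> \<le> (1 + \<eta>) ^ l" using one eta by linarith
      then show ?thesis using Xnn by (intro mult_right_mono)
    qed
    finally have "3 * (\<eta> * R) \<le> 2 * ((1 + \<eta>) ^ l * X)" by (simp add: mult_ac)
    moreover have "0 \<le> \<eta> * R" "0 \<le> (1 + \<eta>) ^ l * X" using eta R Xnn by auto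
    ultimately show ?thesis by linarith
  next
    case False
    have "\<eta> * R \<le> \<eta> * \<delta>" using R eta by simp
    then show ?thesis using ev False by simp
  qed
  also have "\<dots> \<le> (1 + \<eta>) ^ l * (?L ^ l * (5 * R) ^ d)"
    using XL one by (intro mult_left_mono) auto
  also have "\<dots> \<le> 2 ^ l * (?L ^ l * (5 * R) ^ d)"
    using eta R L1 by (intro mult_right_mono power_mono) auto
  also have "\<dots> = ((2 * ?L) ^ l * 5 ^ d * R ^ (d - 1)) * R"
    using d by (cases d) (auto simp: power_mult_distrib mult_ac)
  finally have "\<eta> \<le> (2 * ?L) ^ l * 5 ^ d * R ^ (d - 1)"
    using R by (simp add: mult_le_cancel_right)
  also have "\<dots> \<le> (2 * ?L) ^ l * 5 ^ d * \<delta>"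
  proof -
    have "R ^ (d - 1) \<le> R ^ 1" using R delta d by (intro power_decreasing) auto
    then have "R ^ (d - 1) \<le> \<delta>" using R by simp
    then show ?thesis using L1 by (intro mult_left_mono) auto
  qed
  finally have gap: "\<eta> \<le> (2 * ?L) ^ l * 5 ^ d * \<delta>" .
  \<comment> \<open>\<open>delta_small\<close> was arranged so that \<open>gap\<close> rules out
    short returns. From time \<open>m0\<close> on the inflation absorbs the 5^d of the first step;
    in \<open>absorb\<close>, \<eta> cancels the one in \<open>captures\<close> and \<open>d\<close>
    belongs to the first derivative factor.\<close>
  have "m0 \<le> l"
  proof (rule ccontr)
    assume "\<not> m0 \<le> l"
    then have "(2 * ?L) ^ l \<le> (2 * ?L) ^ m0"
      using L1 by (intro power_increasing) auto
    then have "(2 * ?L) ^ l * 5 ^ d * \<delta> \<le> (2 * ?L) ^ m0 * 5 ^ d * \<delta>"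
      using delta by (intro mult_right_mono) auto
    with gap delta_small show False by linarith
  qed
  then have "real d * \<eta> * (1 + \<eta>) ^ m0 \<le> real d * \<eta> * (1 + \<eta>) ^ l"
    using eta by (intro mult_left_mono power_increasing) auto
  with m0 have absorb: "5 ^ d \<le> real d * \<eta> * (1 + \<eta>) ^ l" by linarith
  let ?D = "slope d a (Suc s) k"
  have Dnn: "0 \<le> ?D" using radius_nonneg by (rule slope_nonneg)
  have "X \<le> (1 + \<eta>) ^ ((d - 1) * k) * ?D * incr d (a s) (4 * R)"
    unfolding X
  proof (rule spread_le_slope)
    fix i assume "i < k"
    have "\<eta> * min \<delta> (a (Suc s + i)) \<le> \<eta> * a (Suc s + i)" using eta by auto
    then show "spread d a (Suc s) i (incr d (a s) (4 * R)) \<le> \<eta> * a (Suc s + i)"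
      using small[OF \<open>i < k\<close>] by linarith
  qed (use radius_nonneg first_nn eta in auto)
  also have "\<dots> \<le> (1 + \<eta>) ^ ((d - 1) * l) * ?D * (5 * R) ^ d"
    using first Dnn eta first_nn k by (intro mult_mono power_increasing) auto
  finally have "(1 + \<eta>) ^ l * X \<le> (1 + \<eta>) ^ l * ((1 + \<eta>) ^ ((d - 1) * l) * ?D * (5 * R) ^ d)"
    using eta by (intro mult_left_mono) auto
  also have "\<dots> = (1 + \<eta>) ^ (l + (d - 1) * l) * ?D * R ^ d * 5 ^ d"
    by (simp add: power_add power_mult_distrib mult_ac)
  also have "l + (d - 1) * l = d * l"
    using d by (cases d) auto
  also have "(1 + \<eta>) ^ (d * l) * ?D * R ^ d * 5 ^ d
      \<le> (1 + \<eta>) ^ (d * l) * ?D * R ^ d * (real d * \<eta> * (1 + \<eta>) ^ l)"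
    using absorb eta Dnn R by (intro mult_left_mono) auto
  also have "\<dots> = \<eta> * ((1 + \<eta>) ^ ((d + 1) * l) * R ^ d * (real d * ?D))"
    by (simp add: power_add mult_ac)
  finally have "\<eta> * min \<delta> (a (s + l)) \<le> \<eta> * ((1 + \<eta>) ^ ((d + 1) * l) * R ^ d * (real d * ?D))"
    using ev by linarith
  then have "min \<delta> (a (s + l)) \<le> (1 + \<eta>) ^ ((d + 1) * l) * R ^ d * (real d * ?D)"
    using eta by (simp add: mult_le_cancel_left)
  \<comment> \<open>Multiplication by \<open>a s ^ d\<close> supplies the first factor
    \<open>d * a s ^ (d - 1)\<close> of the slope and leaves one \<open>a s\<close>, so the
    inequality stays meaningful when \<open>a s\<close> is tiny.\<close>
  then have "a s ^ d * min \<delta> (a (s + l)) \<le> a s ^ d * ((1 + \<eta>) ^ ((d + 1) * l) * R ^ d * (real d * ?D))"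
    using radius_nonneg by (intro mult_left_mono) auto
  also have "\<dots> = (1 + \<eta>) ^ ((d + 1) * l) * R ^ d * (a s * slope d a s l)"
    unfolding k slope_Suc_left using d by (cases d) (auto simp: mult_ac)
  finally show ?thesis .
qed

text \<open>From a time \<open>s\<close> with \<open>a s < \<delta>\<close> one follows the disc of radius comparable to the maximum of
  \<open>a s\<close> and the smallest later radius: it is captured no later than when that smallest radius is
  attained. Hence a visit to the critical point costs only the ratio between its depth and the depth
  of the next ones, and the losses telescope.\<close>

lemma jump:
  assumes s: "s < n" and al: "0 < \<alpha>" "\<alpha> \<le> \<delta>" "\<And>j. s \<le> j \<Longrightarrow> j \<le> n \<Longrightarrow> \<alpha> \<le> a j"
  obtains
    (hit) l \<beta> where "0 < l" "s + l \<le> n" "0 < \<beta>" "\<beta> \<le> \<delta>" "\<And>j. s + l \<le> j \<Longrightarrow> j \<le> n \<Longrightarrow> \<beta> \<le> a j"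
      "\<alpha> ^ d * min \<delta> (a (s + l)) \<le> (1 + \<eta>) ^ ((d + 1) * l) * \<beta> ^ d * (min \<delta> (a s) * slope d a s l)"
  | (miss) \<beta> where "lonely d \<eta> \<delta> a n s" "0 < \<beta>" "\<beta> \<le> \<delta>" "\<And>j. s < j \<Longrightarrow> j \<le> n \<Longrightarrow> \<beta> \<le> a j"
      "\<delta> ^ d * \<alpha> ^ d * min \<delta> (a (Suc s)) \<le> \<beta> ^ d * (min \<delta> (a s) * (real d * a s ^ (d - 1)))"
proof -
  note eta_nn = less_imp_le[OF eta(1)]
  have as: "\<alpha> \<le> a s" using al s by simp
  show thesis
  proof (cases "\<delta> \<le> a s")
    case free: True
    show thesis
    proof (cases "lonely d \<eta> \<delta> a n s")
      case True
      have "\<delta> ^ d * \<alpha> ^ d * min \<delta> (a (Suc s)) \<le> \<delta> ^ (d - 1) * \<alpha> ^ d * \<delta>"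
        using al delta radius_nonneg by (intro mult_mono power_decreasing) auto
      also have "\<dots> = \<alpha> ^ d * (\<delta> * (1 * \<delta> ^ (d - 1)))" by simp
      also have "\<dots> \<le> \<alpha> ^ d * (\<delta> * (real d * a s ^ (d - 1)))"
        using al delta free d by (intro mult_left_mono mult_mono power_mono) auto
      finally show thesis
        using True al delta free by (intro miss[of \<alpha>]) auto
    next
      case False
      then have "\<exists>l. 0 < l \<and> s + l \<le> n \<and> captures d \<eta> \<delta> a s l (\<eta> * \<delta>)"
        by (auto simp: lonely_def)
      then obtain l where l: "0 < l" "s + l \<le> n" "captures d \<eta> \<delta> a s l (\<eta> * \<delta>)"
        and least: "\<And>k. k < l \<Longrightarrow> \<not> (0 < k \<and> s + k \<le> n \<and> captures d \<eta> \<delta> a s k (\<eta> * \<delta>))"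
        using exists_least_iff[of "\<lambda>l. 0 < l \<and> s + l \<le> n \<and> captures d \<eta> \<delta> a s l (\<eta> * \<delta>)"] by blast
      have "min \<delta> (a (s + l)) \<le> (1 + \<eta>) ^ (d * l) * (\<delta> * slope d a s l)"
        using l least free by (intro jump_free) auto
      also have "\<dots> \<le> (1 + \<eta>) ^ ((d + 1) * l) * (\<delta> * slope d a s l)"
        using eta delta radius_nonneg slope_nonneg[OF radius_nonneg]
        by (intro mult_right_mono power_increasing) auto
      finally have "\<alpha> ^ d * min \<delta> (a (s + l)) \<le> \<alpha> ^ d * ((1 + \<eta>) ^ ((d + 1) * l) * (\<delta> * slope d a s l))"
        using al by (intro mult_left_mono) auto
      then show thesis
        using l al free by (intro hit[of l \<alpha>]) (auto simp: mult_ac)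
    qed
  next
    case close: False
    obtain j where j: "s < j" "j \<le> n" and jmin: "\<And>i. s < i \<Longrightarrow> i \<le> n \<Longrightarrow> a j \<le> a i"
    proof -
      have "finite {s<..n}" "{s<..n} \<noteq> {}" using s by auto
      then have "Min (a ` {s<..n}) \<in> a ` {s<..n}" by (intro Min_in) auto
      then obtain j where "j \<in> {s<..n}" "a j = Min (a ` {s<..n})" by auto
      then show thesis by (intro that[of j]) auto
    qed
    define \<beta> where "\<beta> = min \<delta> (a j)"
    define R where "R = max (a s) \<beta>"
    have beta: "0 < \<beta>" "\<beta> \<le> \<delta>" "\<alpha> \<le> \<beta>" "\<And>i. s < i \<Longrightarrow> i \<le> n \<Longrightarrow> \<beta> \<le> a i"
      using al less_le_trans[OF al(1) al(3)[of j]] delta j jmin unfolding \<beta>_def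
      by (auto simp: min_le_iff_disj)
    have R: "a s \<le> R" "0 < R" "R \<le> \<delta>" "\<beta> \<le> R"
      using beta close unfolding R_def by auto
    show thesis
    proof (cases "\<exists>l. 0 < l \<and> s + l \<le> n \<and> captures d \<eta> \<delta> a s l (4 * R)")
      case True
      then obtain l where l: "0 < l" "s + l \<le> n" "captures d \<eta> \<delta> a s l (4 * R)"
        and least: "\<And>k. k < l \<Longrightarrow> \<not> (0 < k \<and> s + k \<le> n \<and> captures d \<eta> \<delta> a s k (4 * R))"
        using exists_least_iff[of "\<lambda>l. 0 < l \<and> s + l \<le> n \<and> captures d \<eta> \<delta> a s l (4 * R)"] by blast
      have main: "a s ^ d * min \<delta> (a (s + l)) \<le> (1 + \<eta>) ^ ((d + 1) * l) * R ^ d * (a s * slope d a s l)"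
        using l least R by (intro jump_close) auto
      \<comment> \<open>Whichever of \<open>a s\<close> and \<beta> equals \<open>R\<close>, the
        other one is at least \<alpha>. This lets \<alpha>^d / \<beta>^d be the only cost of the
        visit.\<close>
      have "\<alpha> * R \<le> a s * \<beta>"
        unfolding R_def using as beta radius_nonneg[of s] al
        by (auto simp: max_def mult.commute intro: mult_mono mult_right_mono)
      then have aR: "\<alpha> ^ d * R ^ d \<le> a s ^ d * \<beta> ^ d"
        using al R by (metis mult_nonneg_nonneg less_imp_le power_mono power_mult_distrib)
      define Y where "Y = (1 + \<eta>) ^ ((d + 1) * l) * (a s * slope d a s l)"
      have Y: "0 \<le> Y" unfolding Y_def using eta radius_nonneg slope_nonneg[OF radius_nonneg] by auto
      have "a s ^ d * (\<alpha> ^ d * min \<delta> (a (s + l))) = \<alpha> ^ d * (a s ^ d * min \<delta> (a (s + l)))"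
        by simp
      also have "\<dots> \<le> \<alpha> ^ d * (R ^ d * Y)"
        using main al unfolding Y_def by (intro mult_left_mono) (auto simp: mult_ac)
      also have "\<dots> = (\<alpha> ^ d * R ^ d) * Y" by simp
      also have "\<dots> \<le> (a s ^ d * \<beta> ^ d) * Y"
        using aR Y by (rule mult_right_mono)
      finally have "a s ^ d * (\<alpha> ^ d * min \<delta> (a (s + l))) \<le> a s ^ d * (\<beta> ^ d * Y)"
        by (simp add: mult_ac)
      moreover have "0 < a s ^ d" using as al by simp
      ultimately have "\<alpha> ^ d * min \<delta> (a (s + l)) \<le> \<beta> ^ d * Y"
        by (simp add: mult_le_cancel_left)
      then show thesis
        using l beta close by (intro hit[of l \<beta>]) (auto simp: Y_def mult_ac)
    next
      case False
      \<comment> \<open>If the smallest later radius were at most \<delta>, both endpoints would lie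
        within \<open>R\<close> of 0, so noncontraction would give the disc a radius above
        \<open>2 * R\<close> at time \<open>j\<close>: a capture. A disc that is never captured
        therefore sees no further visit within \<delta>, and \<beta> can be reset to
        \<delta>.\<close>
      have "\<delta> < a j"
      proof (rule ccontr)
        assume "\<not> \<delta> < a j"
        then have bj: "\<beta> = a j" by (simp add: \<beta>_def)
        have sj: "s + (j - s) = j" using j by simp
        have "4 * R < a s + a j + spread d a s (j - s) (4 * R)"
          using noncontracting_radii[OF nc, of "j - s" "4 * R" s] j R by simp
        then have "2 * R < spread d a s (j - s) (4 * R)" using R bj by linarith
        moreover have "\<eta> * \<beta> \<le> 1 * \<beta>" using eta beta by (intro mult_right_mono) auto
        moreover have "spread d a s (j - s) (4 * R) \<le> (1 + \<eta>) ^ (j - s) * spread d a s (j - s) (4 * R)"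
          using spread_nonneg[of a "4 * R" d s "j - s"] radius_nonneg R eta
            mult_right_mono[of 1 "(1 + \<eta>) ^ (j - s)" "spread d a s (j - s) (4 * R)"] by simp
        ultimately have "\<eta> * \<beta> \<le> (1 + \<eta>) ^ (j - s) * spread d a s (j - s) (4 * R)"
          using R by linarith
        then have "captures d \<eta> \<delta> a s (j - s) (4 * R)"
          unfolding captures_def sj using bj \<open>\<not> \<delta> < a j\<close> by simp
        moreover have "0 < j - s" "s + (j - s) \<le> n" using j by auto
        ultimately show False using False by blast
      qed
      then have bd: "\<beta> = \<delta>" by (simp add: \<beta>_def)
      then have "R = \<delta>" using R by simp
      have lonely: "lonely d \<eta> \<delta> a n s"
        unfolding lonely_def
      proof (intro allI impI notI)
        fix m assume m: "0 < m \<and> s + m \<le> n" and c: "captures d \<eta> \<delta> a s m (\<eta> * \<delta>)"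
        have "\<eta> * \<delta> \<le> 4 * R" using eta delta \<open>R = \<delta>\<close> mult_right_mono[of \<eta> 1 \<delta>] by simp
        then have "spread d a s m (\<eta> * \<delta>) \<le> spread d a s m (4 * R)"
          using radius_nonneg eta delta by (intro spread_mono) auto
        then have "(1 + \<eta>) ^ m * spread d a s m (\<eta> * \<delta>) \<le> (1 + \<eta>) ^ m * spread d a s m (4 * R)"
          using eta by (intro mult_left_mono) auto
        with c have "captures d \<eta> \<delta> a s m (4 * R)" unfolding captures_def by linarith
        then show False using False m by blast
      qed
      have "\<delta> ^ d * \<alpha> ^ d * min \<delta> (a (Suc s)) \<le> \<delta> ^ d * a s ^ d * 1"
        using as al delta radius_nonneg by (intro mult_mono power_mono) auto
      also have "\<dots> \<le> \<delta> ^ d * (a s * (real d * a s ^ (d - 1)))"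
      proof -
        have "a s ^ d = 1 * (a s * a s ^ (d - 1))" using d by (cases d) auto
        also have "\<dots> \<le> real d * (a s * a s ^ (d - 1))"
          using d radius_nonneg by (intro mult_right_mono) auto
        finally have "a s ^ d \<le> a s * (real d * a s ^ (d - 1))" by (simp add: mult_ac)
        then show ?thesis using delta by (auto intro: mult_left_mono)
      qed
      finally show thesis
        using lonely beta close bd by (intro miss[of \<beta>]) auto
    qed
  qed
qed

text \<open>Jumps are chained: the powers \<beta>^d and the minima cancel between consecutive jumps,
  the exponents of \<open>1 + \<eta>\<close> add up, and only lonely times leave a factor
  \<delta>^d. The last factor on the right arises at \<open>s = n\<close>, where \<alpha>^d is
  bounded by the \<open>d\<close>-th power of the minimum, split as 1 + (d - 1).\<close>

lemma slope_lower_bound_card: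
  assumes "s \<le> n" "0 < \<alpha>" "\<alpha> \<le> \<delta>" "\<And>j. s \<le> j \<Longrightarrow> j \<le> n \<Longrightarrow> \<alpha> \<le> a j"
  shows "(\<delta> ^ d) ^ card {j. s \<le> j \<and> j < n \<and> lonely d \<eta> \<delta> a n j} * \<alpha> ^ d
    \<le> (1 + \<eta>) ^ ((d + 1) * (n - s)) * (min \<delta> (a s) * slope d a s (n - s)) * min \<delta> (a n) ^ (d - 1)"
  using assms
proof (induction "n - s" arbitrary: s \<alpha> rule: less_induct)
  case less
  let ?P = "\<lambda>s. {j. s \<le> j \<and> j < n \<and> lonely d \<eta> \<delta> a n j}"
  let ?g = "\<delta> ^ d" and ?e = "min \<delta> (a n) ^ (d - 1)"
  have g: "0 < ?g" "?g \<le> 1" using delta by (auto intro: power_le_one)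
  have fin: "finite (?P t)" for t by (rule finite_subset[of _ "{..<n}"]) auto
  have bn: "0 \<le> ?e" using delta radius_nonneg by simp
  show ?case
  proof (cases "s = n")
    case True
    have "\<alpha> ^ d \<le> min \<delta> (a n) ^ d" using less.prems True by (intro power_mono) auto
    also have "\<dots> = min \<delta> (a n) * ?e" using d by (cases d) auto
    finally have "\<alpha> ^ d \<le> min \<delta> (a n) * ?e" .
    moreover have c0: "card (?P s) = 0" unfolding True card_eq_0_iff by auto
    ultimately show ?thesis unfolding c0 using True by simp
  next
    case False
    with less.prems have "s < n" by simp
    show ?thesis
    proof (rule jump[OF \<open>s < n\<close> less.prems(2-4)], goal_cases)
      case hit: (3 l \<beta>)
      let ?b = "min \<delta> (a (s + l))"
      let ?D = "min \<delta> (a s) * slope d a s l"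
      have pos: "0 < ?b" using hit(2,3) hit(5)[of "s + l"] delta by auto
      have D: "0 \<le> ?D" using delta radius_nonneg slope_nonneg[OF radius_nonneg] by auto
      have IH: "?g ^ card (?P (s + l)) * \<beta> ^ d \<le> (1 + \<eta>) ^ ((d + 1) * (n - (s + l))) *
          (?b * slope d a (s + l) (n - (s + l))) * ?e"
        using hit \<open>s < n\<close> by (intro less.hyps) auto
      have "card (?P (s + l)) \<le> card (?P s)" by (intro card_mono fin) auto
      then have gg: "?g ^ card (?P s) \<le> ?g ^ card (?P (s + l))"
        using g by (intro power_decreasing) auto
      have "?b * (?g ^ card (?P s) * \<alpha> ^ d) = ?g ^ card (?P s) * (\<alpha> ^ d * ?b)" by simp
      also have "\<dots> \<le> ?g ^ card (?P (s + l)) * ((1 + \<eta>) ^ ((d + 1) * l) * \<beta> ^ d * ?D)"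
        using g pos less.prems by (intro mult_mono[OF gg hit(6)]) auto
      also have "\<dots> = ((1 + \<eta>) ^ ((d + 1) * l) * ?D) * (?g ^ card (?P (s + l)) * \<beta> ^ d)"
        by (simp add: mult_ac)
      also have "\<dots> \<le> ((1 + \<eta>) ^ ((d + 1) * l) * ?D) * ((1 + \<eta>) ^ ((d + 1) * (n - (s + l))) *
          (?b * slope d a (s + l) (n - (s + l))) * ?e)"
        using IH D eta by (intro mult_left_mono) auto
      also have "\<dots> = ?b * ((1 + \<eta>) ^ ((d + 1) * l + (d + 1) * (n - (s + l))) *
          (min \<delta> (a s) * (slope d a s l * slope d a (s + l) (n - (s + l)))) * ?e)"
        by (simp add: power_add mult_ac)
      also have "(d + 1) * l + (d + 1) * (n - (s + l)) = (d + 1) * (n - s)"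
      proof -
        have "l + (n - (s + l)) = n - s" using hit(2) by simp
        then show ?thesis by (metis distrib_left)
      qed
      also have "slope d a s l * slope d a (s + l) (n - (s + l)) = slope d a s (n - s)"
        using hit(2) slope_add[of d a s l "n - (s + l)"] by simp
      finally show ?thesis using pos by (simp add: mult_le_cancel_left)
    next
      case miss: (4 \<beta>)
      let ?b = "min \<delta> (a (Suc s))"
      let ?D = "min \<delta> (a s) * (real d * a s ^ (d - 1))"
      have pos: "0 < ?b" using miss(2) miss(4)[of "Suc s"] \<open>s < n\<close> delta by auto
      have D: "0 \<le> ?D" using delta radius_nonneg by auto
      have IH: "?g ^ card (?P (Suc s)) * \<beta> ^ d \<le> (1 + \<eta>) ^ ((d + 1) * (n - Suc s)) *
          (?b * slope d a (Suc s) (n - Suc s)) * ?e"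
        using miss \<open>s < n\<close> by (intro less.hyps) auto
      have "?P s = insert s (?P (Suc s))" using miss(1) \<open>s < n\<close> by auto
      then have card: "card (?P s) = Suc (card (?P (Suc s)))" using fin by simp
      have "?b * (?g ^ card (?P s) * \<alpha> ^ d) = ?g ^ card (?P (Suc s)) * (?g * \<alpha> ^ d * ?b)"
        by (simp add: card)
      also have "\<dots> \<le> ?g ^ card (?P (Suc s)) * (\<beta> ^ d * ?D)"
        using miss(5) g by (intro mult_left_mono) auto
      also have "\<dots> = ?D * (?g ^ card (?P (Suc s)) * \<beta> ^ d)" by (simp add: mult_ac)
      also have "\<dots> \<le> ?D * ((1 + \<eta>) ^ ((d + 1) * (n - Suc s)) *
          (?b * slope d a (Suc s) (n - Suc s)) * ?e)"
        using IH D by (intro mult_left_mono)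
      also have "\<dots> = ?b * ((1 + \<eta>) ^ ((d + 1) * (n - Suc s)) *
          (min \<delta> (a s) * slope d a s (Suc (n - Suc s))) * ?e)"
        by (simp add: slope_Suc_left mult_ac)
      also have "Suc (n - Suc s) = n - s" using \<open>s < n\<close> by simp
      finally have "?b * (?g ^ card (?P s) * \<alpha> ^ d) \<le> ?b * ((1 + \<eta>) ^ ((d + 1) * (n - Suc s)) *
          (min \<delta> (a s) * slope d a s (n - s)) * ?e)" .
      then have "?g ^ card (?P s) * \<alpha> ^ d \<le> (1 + \<eta>) ^ ((d + 1) * (n - Suc s)) *
          (min \<delta> (a s) * slope d a s (n - s)) * ?e"
        using pos by (simp add: mult_le_cancel_left)
      also have "\<dots> \<le> (1 + \<eta>) ^ ((d + 1) * (n - s)) *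
          (min \<delta> (a s) * slope d a s (n - s)) * ?e"
        using eta bn delta radius_nonneg slope_nonneg[OF radius_nonneg] \<open>s < n\<close>
        by (intro mult_right_mono power_increasing mult_left_mono) auto
      finally show ?thesis .
    qed
  qed
qed

end

text \<open>The constants are uniform over all noncontracting data, so they serve all truncation
  depths at once. For a segment ending at a close visit of depth \<alpha>, the trailing factor pays
  for \<open>d - 1\<close> of the \<open>d\<close> powers of \<alpha> on the left.\<close>

definition slope_bound :: "nat \<Rightarrow> real \<Rightarrow> real \<Rightarrow> real \<Rightarrow> real \<Rightarrow> bool" where
  "slope_bound d B \<eta> C \<delta> \<longleftrightarrow> 0 < C \<and> 0 < \<delta> \<and> \<delta> \<le> 1/4 \<and>
    (\<forall>p a s n \<alpha>. noncontracting d B p a \<longrightarrow> s \<le> n \<longrightarrow> 0 < \<alpha> \<longrightarrow> \<alpha> \<le> \<delta> \<longrightarrow>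
      (\<forall>j. s \<le> j \<longrightarrow> j \<le> n \<longrightarrow> \<alpha> \<le> a j) \<longrightarrow>
      C * \<alpha> ^ d \<le> (1 + \<eta>) ^ ((d + 1) * (n - s)) *
        (min \<delta> (a s) * slope d a s (n - s)) * min \<delta> (a n) ^ (d - 1))"

lemma slope_bound_pos:
  assumes "slope_bound d B \<eta> C \<delta>"
  shows "0 < C" "0 < \<delta>" "\<delta> \<le> 1/4"
  using assms by (auto simp: slope_bound_def)

lemma slope_boundD:
  assumes "slope_bound d B \<eta> C \<delta>" "noncontracting d B p a" "s \<le> n" "0 < \<alpha>" "\<alpha> \<le> \<delta>"
    "\<And>j. s \<le> j \<Longrightarrow> j \<le> n \<Longrightarrow> \<alpha> \<le> a j"
  shows "C * \<alpha> ^ d \<le> (1 + \<eta>) ^ ((d + 1) * (n - s)) *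
    (min \<delta> (a s) * slope d a s (n - s)) * min \<delta> (a n) ^ (d - 1)"
  using assms unfolding slope_bound_def by blast

proposition slope_lower_bound:
  assumes d: "2 \<le> d" and B: "0 \<le> B" and eta: "0 < \<eta>" "\<eta> \<le> 1"
  obtains C \<delta> where "slope_bound d B \<eta> C \<delta>"
proof -
  obtain m0 where "5 ^ d / (real d * \<eta>) \<le> (1 + \<eta>) ^ m0"
    using real_arch_pow[of "1 + \<eta>" "5 ^ d / (real d * \<eta>)"] eta by (auto intro: less_imp_le)
  then have m0: "5 ^ d \<le> real d * \<eta> * (1 + \<eta>) ^ m0"
    using d eta by (simp add: field_simps)
  define L where "L = real d * (B + 1) ^ (d - 1)"
  have L: "0 < L" unfolding L_def using d B by simp
  \<comment> \<open>Chosen after \<open>m0\<close>: so small that a disc about a point within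
    \<delta> of 0 needs at least \<open>m0\<close> steps before it captures.\<close>
  define \<delta> where "\<delta> = min (1/4) (\<eta> / (2 * ((2 * L) ^ m0 * 5 ^ d)))"
  have delta: "0 < \<delta>" "\<delta> \<le> 1/4" unfolding \<delta>_def using eta L by auto
  have "(2 * L) ^ m0 * 5 ^ d * \<delta> \<le> (2 * L) ^ m0 * 5 ^ d * (\<eta> / (2 * ((2 * L) ^ m0 * 5 ^ d)))"
    using L unfolding \<delta>_def by (intro mult_left_mono) auto
  also have "\<dots> = \<eta> / 2" using L by (simp add: field_simps)
  also have "\<dots> < \<eta>" using eta by simp
  finally have small: "(2 * L) ^ m0 * 5 ^ d * \<delta> < \<eta>" .
  obtain P where P: "\<And>p a n. noncontracting d B p a \<Longrightarrow> card {s. s < n \<and> lonely d \<eta> \<delta> a n s} \<le> P"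
    using card_lonely_bounded[OF eta(1) delta(1)] by metis
  show thesis
  proof (rule that[of "(\<delta> ^ d) ^ P" \<delta>], unfold slope_bound_def, intro conjI allI impI)
    fix p a s n \<alpha>
    assume nc: "noncontracting d B p a" and *: "s \<le> n" "0 < \<alpha>" "\<alpha> \<le> \<delta>"
      and "\<forall>j. s \<le> j \<longrightarrow> j \<le> n \<longrightarrow> \<alpha> \<le> a j"
    then have al: "\<And>j. s \<le> j \<Longrightarrow> j \<le> n \<Longrightarrow> \<alpha> \<le> a j" by blast
    have "card {j. s \<le> j \<and> j < n \<and> lonely d \<eta> \<delta> a n j} \<le> card {s. s < n \<and> lonely d \<eta> \<delta> a n s}"
      by (intro card_mono) auto
    also have "\<dots> \<le> P" using P[OF nc] .
    finally have "(\<delta> ^ d) ^ P \<le> (\<delta> ^ d) ^ card {j. s \<le> j \<and> j < n \<and> lonely d \<eta> \<delta> a n j}"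
      using delta by (intro power_decreasing) (auto intro: power_le_one)
    then have "(\<delta> ^ d) ^ P * \<alpha> ^ d \<le> (\<delta> ^ d) ^ card {j. s \<le> j \<and> j < n \<and> lonely d \<eta> \<delta> a n j} * \<alpha> ^ d"
      using * by (intro mult_right_mono) auto
    with slope_lower_bound_card[OF d B eta m0 delta small[unfolded L_def] nc * al]
    show "(\<delta> ^ d) ^ P * \<alpha> ^ d \<le> (1 + \<eta>) ^ ((d + 1) * (n - s)) *
        (min \<delta> (a s) * slope d a s (n - s)) * min \<delta> (a n) ^ (d - 1)" by linarith
  qed (use delta in auto)
qed

section \<open>Orbits in the Julia set\<close>

lemma norm_power_diff_le: "norm (u ^ d - v ^ d) \<le> incr d (norm v) (norm (u - v))" for u v :: complex
proof -
  have u: "norm u \<le> norm v + norm (u - v)" by (rule norm_triangle_sub)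
  have "norm (u ^ d - v ^ d) = norm (u - v) * norm (\<Sum>i<d. v ^ (d - Suc i) * u ^ i)"
    by (subst power_diff_sumr2) (simp add: norm_mult)
  also have "\<dots> \<le> norm (u - v) * (\<Sum>i<d. norm v ^ (d - Suc i) * (norm v + norm (u - v)) ^ i)"
    using u by (intro mult_left_mono order_trans[OF norm_sum] sum_mono)
      (auto simp: norm_mult norm_power intro!: mult_left_mono power_mono)
  finally show ?thesis unfolding incr_eq_sum .
qed

abbreviation orbit :: "nat \<Rightarrow> complex \<Rightarrow> complex \<Rightarrow> nat \<Rightarrow> complex" where
  "orbit d c z n \<equiv> (unicrit d c ^^ n) z"

abbreviation radii :: "nat \<Rightarrow> complex \<Rightarrow> complex \<Rightarrow> nat \<Rightarrow> real" where
  "radii d c z n \<equiv> norm (orbit d c z n)"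

lemma orbit_add: "orbit d c z (m + n) = orbit d c (orbit d c z m) n"
  by (simp add: add.commute[of m] funpow_add)

lemma unicrit_dist_le: "dist (unicrit d c u) (unicrit d c v) \<le> incr d (norm v) (dist u v)"
  using norm_power_diff_le[of u d v] by (simp add: unicrit_def dist_norm)

lemma orbit_dist_le:
  assumes "dist u (orbit d c z s) \<le> r"
  shows "dist (orbit d c u m) (orbit d c z (s + m)) \<le> spread d (radii d c z) s m r"
proof (induction m)
  case (Suc m)
  have "dist (orbit d c u (Suc m)) (orbit d c z (s + Suc m))
      \<le> incr d (radii d c z (s + m)) (dist (orbit d c u m) (orbit d c z (s + m)))"
    by (simp add: unicrit_dist_le)
  also have "\<dots> \<le> incr d (radii d c z (s + m)) (spread d (radii d c z) s m r)"
    using Suc by (intro incr_mono) auto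
  finally show ?case by simp
qed (use assms in auto)

lemma continuous_on_unicrit: "continuous_on S (unicrit d c)"
  unfolding unicrit_def by (intro continuous_intros)

lemma continuous_on_orbit: "continuous_on S (\<lambda>z. orbit d c z n)"
proof (induction n)
  case (Suc n)
  then show ?case
    using continuous_on_compose[OF Suc continuous_on_unicrit[of _ d c]] by (simp add: o_def)
qed auto

context
  fixes d :: nat and c :: complex
  assumes d: "2 \<le> d"
begin

section \<open>Escape radius, invariance and topology of the Julia set\<close>

lemma unicrit_expands:
  assumes "2 + norm c < norm z"
  shows "2 * norm z \<le> norm (unicrit d c z)"
proof -
  have "norm z ^ 2 \<le> norm z ^ d"
    using assms d norm_ge_zero[of c] by (intro power_increasing) linarith+
  moreover have "(2 + norm c) * norm z \<le> norm z ^ 2"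
    using assms norm_ge_zero[of z] by (simp add: power2_eq_square mult_right_mono)
  moreover have "norm c * 1 \<le> norm c * norm z"
    using assms norm_ge_zero[of c] by (intro mult_left_mono) linarith+
  moreover have "norm (z ^ d) - norm c \<le> norm (unicrit d c z)"
    unfolding unicrit_def by (rule norm_diff_ineq)
  ultimately show ?thesis by (simp add: norm_power algebra_simps)
qed

lemma orbit_unbounded:
  assumes "2 + norm c < norm z"
  shows "z \<notin> filled_julia (unicrit d c)"
proof
  assume "z \<in> filled_julia (unicrit d c)"
  then obtain M where M: "\<And>n. norm (orbit d c z n) \<le> M"
    unfolding filled_julia_def bounded_iff by auto
  have big: "2 + norm c < norm (orbit d c z n) \<and> 2 ^ n * norm z \<le> norm (orbit d c z n)" for n
  proof (induction n)
    case (Suc n)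
    then have *: "2 * norm (orbit d c z n) \<le> norm (orbit d c z (Suc n))"
      using unicrit_expands by auto
    moreover have "2 ^ Suc n * norm z \<le> 2 * norm (orbit d c z n)" using Suc by simp
    ultimately show ?case using Suc norm_ge_zero[of "orbit d c z n"] by linarith
  qed (use assms in auto)
  obtain n where "M < 2 ^ n" using real_arch_pow[of 2 M] by auto
  moreover
  have "1 \<le> norm z" using assms norm_ge_zero[of c] by linarith
  then have "2 ^ n * 1 \<le> 2 ^ n * norm z" by (intro mult_left_mono) auto
  then have "(2::real) ^ n \<le> 2 ^ n * norm z" by simp
  ultimately show False using big[of n] M[of n] by linarith
qed

lemma filled_julia_iff_orbit: "orbit d c z n \<in> filled_julia (unicrit d c) \<longleftrightarrow> z \<in> filled_julia (unicrit d c)"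
proof
  assume "z \<in> filled_julia (unicrit d c)"
  then show "orbit d c z n \<in> filled_julia (unicrit d c)"
    unfolding filled_julia_def by (auto intro: bounded_subset simp flip: orbit_add)
next
  assume "orbit d c z n \<in> filled_julia (unicrit d c)"
  then have "bounded (range (\<lambda>m. orbit d c z (n + m)) \<union> (\<lambda>m. orbit d c z m) ` {..<n})"
    unfolding filled_julia_def by (simp add: orbit_add finite_imp_bounded)
  moreover have "range (orbit d c z) \<subseteq> range (\<lambda>m. orbit d c z (n + m)) \<union> (\<lambda>m. orbit d c z m) ` {..<n}"
  proof
    fix x assume "x \<in> range (orbit d c z)"
    then obtain k where "x = orbit d c z k" by auto
    then show "x \<in> range (\<lambda>m. orbit d c z (n + m)) \<union> (\<lambda>m. orbit d c z m) ` {..<n}"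
      by (cases "k < n") (auto intro: range_eqI[of _ _ "k - n"])
  qed
  ultimately show "z \<in> filled_julia (unicrit d c)"
    unfolding filled_julia_def mem_Collect_eq by (rule bounded_subset)
qed

lemma filled_julia_eq: "filled_julia (unicrit d c) = (\<Inter>n. {z. norm (orbit d c z n) \<le> 2 + norm c})"
proof (intro equalityI subsetI)
  fix z assume "z \<in> filled_julia (unicrit d c)"
  then show "z \<in> (\<Inter>n. {z. norm (orbit d c z n) \<le> 2 + norm c})"
    using orbit_unbounded filled_julia_iff_orbit by (force simp: not_less[symmetric])
next
  fix z assume "z \<in> (\<Inter>n. {z. norm (orbit d c z n) \<le> 2 + norm c})"
  then show "z \<in> filled_julia (unicrit d c)"
    unfolding filled_julia_def bounded_iff by auto
qed

lemma closed_filled_julia: "closed (filled_julia (unicrit d c))"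
  unfolding filled_julia_eq
  by (intro closed_INT ballI closed_Collect_le continuous_intros continuous_on_orbit)

lemma closed_julia: "closed (julia (unicrit d c))"
  by (simp add: julia_def)

lemma julia_subset: "julia (unicrit d c) \<subseteq> filled_julia (unicrit d c)"
  unfolding julia_def using closed_filled_julia by (rule frontier_subset_closed)

lemma interior_julia: "interior (julia (unicrit d c)) = {}"
proof -
  let ?K = "filled_julia (unicrit d c)"
  have "interior (frontier ?K) \<subseteq> interior ?K"
    using frontier_subset_closed[OF closed_filled_julia] by (rule interior_mono)
  moreover have "interior (frontier ?K) \<inter> interior ?K = {}"
    using interior_subset[of "frontier ?K"] unfolding frontier_def by blast
  ultimately show ?thesis unfolding julia_def by blast
qed

lemma norm_orbit_julia_le: "z \<in> julia (unicrit d c) \<Longrightarrow> norm (orbit d c z n) \<le> 2 + norm c"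
  using julia_subset filled_julia_eq by blast

lemma interior_filled_julia_orbit:
  assumes "orbit d c z n \<in> interior (filled_julia (unicrit d c))"
  shows "z \<in> interior (filled_julia (unicrit d c))"
proof -
  let ?U = "(\<lambda>z. orbit d c z n) -` interior (filled_julia (unicrit d c))"
  have "open ?U"
    using continuous_on_orbit by (intro open_vimage) auto
  moreover have "?U \<subseteq> filled_julia (unicrit d c)"
    using interior_subset filled_julia_iff_orbit by blast
  ultimately show ?thesis using assms interior_maximal by blast
qed

lemma orbit_in_julia:
  assumes "z \<in> julia (unicrit d c)"
  shows "orbit d c z n \<in> julia (unicrit d c)"
proof -
  have z: "z \<in> filled_julia (unicrit d c)" "z \<notin> interior (filled_julia (unicrit d c))"
    using assms closed_filled_julia unfolding julia_def frontier_def by auto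
  then show ?thesis
    using interior_filled_julia_orbit filled_julia_iff_orbit closure_subset
    unfolding julia_def frontier_def by blast
qed

text \<open>If an iterate maps a disc into itself, all orbits from the disc stay in its first
  \<open>m\<close> images, a bounded set. The disc then lies in the filled Julia set, and interior
  points pull back along the orbit to \<open>z\<close>, which is a frontier point.\<close>

lemma noncontracting_julia:
  assumes z: "z \<in> julia (unicrit d c)"
  shows "noncontracting d (2 + norm c) (orbit d c z) (radii d c z)"
  unfolding noncontracting_def
proof (intro conjI allI impI)
  show "norm (orbit d c z j) \<le> radii d c z j" "radii d c z j \<le> 2 + norm c" for j
    using norm_orbit_julia_le[OF z] by auto
next
  fix s m :: nat and r :: real
  assume m: "0 < m" and r: "0 < r"
  show "r < dist (orbit d c z s) (orbit d c z (s + m)) + spread d (radii d c z) s m r"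
  proof (rule ccontr)
    assume neg: "\<not> ?thesis"
    let ?B = "cball (orbit d c z s) r"
    have inv: "orbit d c u m \<in> ?B" if "u \<in> ?B" for u
    proof -
      have "dist (orbit d c u m) (orbit d c z (s + m)) \<le> spread d (radii d c z) s m r"
        using that by (intro orbit_dist_le) (simp add: dist_commute)
      then show ?thesis
        using neg dist_triangle[of "orbit d c z s" "orbit d c u m" "orbit d c z (s + m)"]
        by (simp add: dist_commute)
    qed
    have inv': "orbit d c u (k * m) \<in> ?B" if "u \<in> ?B" for u k
    proof (induction k)
      case (Suc k)
      then show ?case using inv[OF Suc] orbit_add[where m = "k * m" and n = m] by (simp add: add.commute)
    qed (use that in simp)
    have "?B \<subseteq> filled_julia (unicrit d c)"
    proof
      fix u assume u: "u \<in> ?B"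
      have "orbit d c u n \<in> (\<Union>i<m. (\<lambda>u. orbit d c u i) ` ?B)" for n
      proof -
        have "orbit d c u n = orbit d c (orbit d c u (n div m * m)) (n mod m)"
          by (simp flip: orbit_add)
        moreover have "n mod m \<in> {..<m}" using m by simp
        ultimately show ?thesis using inv'[OF u] by (intro UN_I[of "n mod m"] image_eqI)
      qed
      then have "range (orbit d c u) \<subseteq> (\<Union>i<m. (\<lambda>u. orbit d c u i) ` ?B)" by blast
      moreover have "bounded (\<Union>i<m. (\<lambda>u. orbit d c u i) ` ?B)"
        by (intro bounded_UN ballI compact_imp_bounded compact_continuous_image continuous_on_orbit) auto
      ultimately show "u \<in> filled_julia (unicrit d c)"
        unfolding filled_julia_def by (auto intro: bounded_subset)
    qed
    then have "orbit d c z s \<in> interior (filled_julia (unicrit d c))"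
      using r by (meson ball_subset_cball centre_in_ball interior_maximal open_ball order_trans subsetD)
    then have "z \<in> interior (filled_julia (unicrit d c))" by (rule interior_filled_julia_orbit)
    then show False using z unfolding julia_def frontier_def by auto
  qed
qed

end

section \<open>Covering arguments\<close>

lemma measure_UN_le_disjoint:
  assumes "countable C" "0 \<le> q" "V \<in> fmeasurable M"
    and A: "\<And>i. i \<in> C \<Longrightarrow> A i \<in> fmeasurable M"
    and D: "\<And>i. i \<in> C \<Longrightarrow> D i \<in> fmeasurable M" "\<And>i. i \<in> C \<Longrightarrow> D i \<subseteq> V"
    and disj: "pairwise (\<lambda>i j. disjnt (D i) (D j)) C"
    and le: "\<And>i. i \<in> C \<Longrightarrow> measure M (A i) \<le> q * measure M (D i)"
  shows "(\<Union>i\<in>C. A i) \<in> fmeasurable M \<and> measure M (\<Union>i\<in>C. A i) \<le> q * measure M V"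
proof -
  have fin: "measure M (\<Union>i\<in>I. A i) \<le> q * measure M V" if I: "I \<subseteq> C" "finite I" for I
  proof -
    have "measure M (\<Union>i\<in>I. A i) \<le> (\<Sum>i\<in>I. measure M (A i))"
      using I A by (intro measure_UNION_le) (auto simp: fmeasurableD)
    also have "\<dots> \<le> (\<Sum>i\<in>I. q * measure M (D i))"
      using I le by (intro sum_mono) auto
    also have "\<dots> = q * (\<Sum>i\<in>I. measure M (D i))" by (simp add: sum_distrib_left)
    also have "(\<Sum>i\<in>I. measure M (D i)) = measure M (\<Union>i\<in>I. D i)"
      using I D(1) pairwise_mono[OF disj] by (intro measure_UNION'[symmetric]) auto
    also have "q * measure M (\<Union>i\<in>I. D i) \<le> q * measure M V"
      using I D assms(2,3)
      by (intro mult_left_mono measure_mono_fmeasurable) (auto intro!: sets.finite_UN simp: fmeasurableD)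
    finally show ?thesis .
  qed
  show ?thesis
    using fmeasurable_UN_bound[OF \<open>countable C\<close> A fin] measure_UN_bound[OF \<open>countable C\<close> A fin] by simp
qed

lemma measure_ball_complex: "0 \<le> r \<Longrightarrow> measure lborel (ball (z::complex) r) = pi * r\<^sup>2"
  using content_ball[of r z] by (simp add: unit_ball_vol_2)

lemma measure_cball_complex: "0 \<le> r \<Longrightarrow> measure lborel (cball (z::complex) r) = pi * r\<^sup>2"
  using content_cball[of r z] by (simp add: unit_ball_vol_2)

lemma fmeasurable_ball [simp]: "ball (z::complex) r \<in> fmeasurable lborel"
  by (intro fmeasurableI) (use emeasure_lborel_ball_finite[of z r] in auto)

lemma fmeasurable_cball [simp]: "cball (z::complex) r \<in> fmeasurable lborel"
  by (intro fmeasurableI) (use emeasure_lborel_cball_finite[of z r] in auto)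

text \<open>Vitali's covering lemma: the discs of a fifth of the radius can be taken disjoint while
  the full discs still cover, at the price 25 in area.\<close>

lemma measure_le_local:
  fixes E :: "complex set"
  assumes E: "E \<in> sets borel" "E \<subseteq> cball 0 B" and q: "0 \<le> q"
    and loc: "\<And>z. z \<in> E \<Longrightarrow> \<exists>t. 0 < t \<and> t \<le> T \<and> measure lborel (E \<inter> cball z t) \<le> q * t\<^sup>2"
  shows "measure lborel E \<le> 25 * q / pi * measure lborel (ball (0::complex) (B + T))"
proof -
  obtain t where t: "\<And>z. z \<in> E \<Longrightarrow> 0 < t z" "\<And>z. z \<in> E \<Longrightarrow> t z \<le> T"
    "\<And>z. z \<in> E \<Longrightarrow> measure lborel (E \<inter> cball z (t z)) \<le> q * (t z)\<^sup>2"
    using loc by metis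
  have "E \<subseteq> (\<Union>z\<in>E. ball z (t z / 5))" using t(1) by force
  then obtain C where C: "countable C" "C \<subseteq> E"
    and disj: "pairwise (\<lambda>i j. disjnt (ball i (t i / 5)) (ball j (t j / 5))) C"
    and cov: "E \<subseteq> (\<Union>i\<in>C. ball i (5 * (t i / 5)))"
    by (rule Vitali_covering_lemma_balls[where B = "T / 5"]) (use t in auto)
  have "(\<Union>i\<in>C. E \<inter> cball i (t i)) \<in> fmeasurable lborel \<and>
    measure lborel (\<Union>i\<in>C. E \<inter> cball i (t i)) \<le> (25 * q / pi) * measure lborel (ball (0::complex) (B + T))"
  proof (rule measure_UN_le_disjoint[OF C(1), where D = "\<lambda>i. ball i (t i / 5)"])
    fix i assume i: "i \<in> C"
    then have "i \<in> E" using C by auto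
    show "E \<inter> cball i (t i) \<in> fmeasurable lborel"
      using E by (subst Int_commute, intro fmeasurable_Int_fmeasurable fmeasurable_cball) auto
    show "ball i (t i / 5) \<subseteq> ball 0 (B + T)"
    proof
      fix x assume "x \<in> ball i (t i / 5)"
      then have "dist i x < t i / 5" by simp
      moreover have "norm i \<le> B" using \<open>i \<in> E\<close> E by auto
      moreover have "norm x \<le> norm i + dist i x"
        using norm_triangle_sub[of x i] by (simp add: dist_norm norm_minus_commute)
      ultimately show "x \<in> ball 0 (B + T)" using t[OF \<open>i \<in> E\<close>] by simp
    qed
    have "measure lborel (E \<inter> cball i (t i)) \<le> q * (t i)\<^sup>2" using t \<open>i \<in> E\<close> by auto
    also have "\<dots> = (25 * q / pi) * measure lborel (ball i (t i / 5))"
      using t(1)[OF \<open>i \<in> E\<close>] by (subst measure_ball_complex) (auto simp: power_divide)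
    finally show "measure lborel (E \<inter> cball i (t i)) \<le> (25 * q / pi) * measure lborel (ball i (t i / 5))" .
  qed (use q disj in auto)
  moreover have "E = (\<Union>i\<in>C. E \<inter> cball i (t i))" using cov by force
  ultimately show ?thesis by simp
qed

section \<open>Porosity points of a closed set form a null set\<close>

definition porous_at :: "real \<Rightarrow> complex set \<Rightarrow> complex \<Rightarrow> bool" where
  "porous_at \<kappa> J z \<longleftrightarrow> (\<forall>e>0. \<exists>t w. 0 < t \<and> t < e \<and> dist z w < t \<and> ball w (\<kappa> * t) \<inter> J = {})"

text \<open>Vitali's covering theorem inside an open \<open>U\<close> containing \<open>Z\<close>
  with \<open>U - Z\<close> of small area: the chosen discs are disjoint and cover almost all of
  \<open>Z\<close>, while the hole in each takes the proportion \<kappa>^2 of it and lies in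
  \<open>U - Z\<close>. So the total area of the discs is at most that of \<open>U - Z\<close>
  divided by \<kappa>^2.\<close>

lemma porous_null:
  fixes J :: "complex set"
  assumes J: "closed J" and k: "0 < \<kappa>" "\<kappa> \<le> 1"
  shows "AE z in lborel. z \<in> J \<longrightarrow> \<not> porous_at \<kappa> J z"
proof -
  \<comment> \<open>Demanding that \<open>z\<close> lie in the disc about \<open>w\<close>, instead
    of being its centre, makes each of these sets a union of open discs; hence \<open>Z\<close> is
    Borel.\<close>
  define O' where "O' m = {z. \<exists>t w. 0 < t \<and> t < 1 / real (Suc m) \<and> dist z w < t \<and> ball w (\<kappa> * t) \<inter> J = {}}" for m
  define Z where "Z = J \<inter> (\<Inter>m. O' m)"
  have openO: "open (O' m)" for m
  proof -
    have "O' m = (\<Union>(t, w)\<in>{(t, w). 0 < t \<and> t < 1 / real (Suc m) \<and> ball w (\<kappa> * t) \<inter> J = {}}. ball w t)"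
      unfolding O'_def by (fastforce simp: dist_commute)
    then show ?thesis by auto
  qed
  have Zb: "Z \<in> sets borel" unfolding Z_def using J openO by auto
  have "emeasure lborel Z \<le> 0"
  proof (rule ennreal_le_epsilon)
    fix e :: real assume e: "0 < e"
    define e' where "e' = e * \<kappa>\<^sup>2 / 4"
    have e': "0 < e'" using e k by (simp add: e'_def)
    obtain U where U: "open U" "Z \<subseteq> U" "emeasure lborel (U - Z) < ennreal e'"
      using outer_regular_lborel[OF Zb e'] by metis
    have UZ: "U - Z \<in> fmeasurable lborel"
      using U Zb by (intro fmeasurableI) (auto simp: less_top[symmetric] intro: less_trans ennreal_less_top)
    define K where "K = {(w, t). 0 < t \<and> ball w t \<subseteq> U \<and> ball w (\<kappa> * t) \<inter> J = {}}"
    obtain C where C: "countable C" "C \<subseteq> K"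
      and disj: "pairwise (\<lambda>i j. disjnt (ball (fst i) (snd i)) (ball (fst j) (snd j))) C"
      and neg: "negligible (Z - (\<Union>i\<in>C. ball (fst i) (snd i)))"
    proof (rule Vitali_covering_theorem_balls[of Z K fst snd])
      fix x d :: real and z assume z: "z \<in> Z" and d: "0 < d"
      obtain r where r: "0 < r" "ball z r \<subseteq> U" using U z by (meson open_contains_ball subsetD)
      obtain m where m: "1 / real (Suc m) < min d (r / 2)"
        using d r nat_approx_posE[of "min d (r / 2)"] by auto
      obtain t w where tw: "0 < t" "t < 1 / real (Suc m)" "dist z w < t" "ball w (\<kappa> * t) \<inter> J = {}"
        using z unfolding Z_def O'_def by blast
      have "ball w t \<subseteq> ball z r"
      proof
        fix x assume "x \<in> ball w t"
        then show "x \<in> ball z r" using tw m dist_triangle[of z x w] by auto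
      qed
      then have "(w, t) \<in> K" using tw r unfolding K_def by auto
      then show "\<exists>i. i \<in> K \<and> z \<in> ball (fst i) (snd i) \<and> snd i < d"
        using tw m by (intro exI[of _ "(w, t)"]) (auto simp: dist_commute)
    qed
    have *: "(\<Union>i\<in>C. ball (fst i) (snd i)) \<in> fmeasurable lborel \<and>
      measure lborel (\<Union>i\<in>C. ball (fst i) (snd i)) \<le> (1 / \<kappa>\<^sup>2) * measure lborel (U - Z)"
    proof (rule measure_UN_le_disjoint[OF C(1) _ UZ, where D = "\<lambda>i. ball (fst i) (\<kappa> * snd i)"])
      show "pairwise (\<lambda>i j. disjnt (ball (fst i) (\<kappa> * snd i)) (ball (fst j) (\<kappa> * snd j))) C"
        unfolding pairwise_def
      proof (intro ballI impI)
        fix i j assume ij: "i \<in> C" "j \<in> C" "i \<noteq> j"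
        have "ball (fst i) (\<kappa> * snd i) \<subseteq> ball (fst i) (snd i)" if "i \<in> C" for i
          using that C k unfolding K_def by (auto intro!: subset_ball mult_left_le_one_le)
        then show "disjnt (ball (fst i) (\<kappa> * snd i)) (ball (fst j) (\<kappa> * snd j))"
          using disj ij unfolding pairwise_def by (meson disjnt_subset1 disjnt_subset2)
      qed
      fix i assume i: "i \<in> C"
      then have iK: "0 < snd i" "ball (fst i) (snd i) \<subseteq> U" "ball (fst i) (\<kappa> * snd i) \<inter> J = {}"
        using subsetD[OF C(2) i] unfolding K_def by (auto simp: case_prod_beta)
      have "ball (fst i) (\<kappa> * snd i) \<subseteq> ball (fst i) (snd i)"
        using iK k by (intro subset_ball mult_left_le_one_le) auto
      then show "ball (fst i) (\<kappa> * snd i) \<subseteq> U - Z"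
        using iK unfolding Z_def by blast
      show "measure lborel (ball (fst i) (snd i)) \<le> 1 / \<kappa>\<^sup>2 * measure lborel (ball (fst i) (\<kappa> * snd i))"
        using iK k by (simp add: measure_ball_complex power_mult_distrib)
    qed auto
    have "emeasure lborel Z \<le> emeasure lborel (\<Union>i\<in>C. ball (fst i) (snd i))"
    proof (rule emeasure_mono_AE)
      have "Z - (\<Union>i\<in>C. ball (fst i) (snd i)) \<in> null_sets lebesgue"
        using neg by (simp add: negligible_iff_null_sets)
      moreover have "Z - (\<Union>i\<in>C. ball (fst i) (snd i)) \<in> sets borel"
        using Zb * by (auto simp: fmeasurable_def)
      ultimately have "Z - (\<Union>i\<in>C. ball (fst i) (snd i)) \<in> null_sets lborel"
        by (simp add: null_sets_completion_iff)
      then show "AE x in lborel. x \<in> Z \<longrightarrow> x \<in> (\<Union>i\<in>C. ball (fst i) (snd i))"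
        by (rule AE_I') auto
    qed (use * in \<open>auto simp: fmeasurable_def\<close>)
    also have "\<dots> = ennreal (measure lborel (\<Union>i\<in>C. ball (fst i) (snd i)))"
      using * by (simp add: emeasure_eq_measure2)
    also have "\<dots> \<le> ennreal e"
    proof (rule ennreal_leI)
      have "measure lborel (U - Z) \<le> e'"
        using U(3) e' unfolding measure_def by (simp add: enn2real_leI less_imp_le)
      then have "(1 / \<kappa>\<^sup>2) * measure lborel (U - Z) \<le> (1 / \<kappa>\<^sup>2) * e'"
        by (intro mult_left_mono) auto
      also have "\<dots> = e / 4" using k by (simp add: e'_def)
      finally show "measure lborel (\<Union>i\<in>C. ball (fst i) (snd i)) \<le> e" using * e by linarith
    qed
    finally show "emeasure lborel Z \<le> 0 + ennreal e" by simp
  qed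
  then have "Z \<in> null_sets lborel" using Zb by (auto simp: null_sets_def)
  moreover have "{z \<in> space lborel. \<not> (z \<in> J \<longrightarrow> \<not> porous_at \<kappa> J z)} \<subseteq> Z"
  proof
    fix z assume "z \<in> {z \<in> space lborel. \<not> (z \<in> J \<longrightarrow> \<not> porous_at \<kappa> J z)}"
    then have "z \<in> J" "porous_at \<kappa> J z" by auto
    then show "z \<in> Z"
      unfolding Z_def O'_def porous_at_def by auto
  qed
  ultimately show ?thesis by (rule AE_I')
qed

section \<open>Pulling back small sets\<close>

lemma power_minus_const_factorization:
  assumes "0 < d"
  obtains xs :: "complex list" where "length xs = d" "\<And>u. u ^ d - w = (\<Prod>x\<leftarrow>xs. u - x)"
proof -
  define p where "p = monom (1::complex) d + [:-w:]"
  have deg: "degree p = d"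
    unfolding p_def using assms by (subst degree_add_eq_left) (auto simp: degree_monom_eq)
  have lc: "lead_coeff p = 1"
    unfolding deg using assms by (cases d) (auto simp: p_def)
  then have "p \<noteq> 0" by auto
  then obtain A where A: "size A = degree p" "p = smult (lead_coeff p) (\<Prod>x\<in>#A. [:-x, 1:])"
    using alg_closed_imp_factorization[of p] by blast
  obtain xs where xs: "A = mset xs" by (metis ex_mset)
  have "poly p u = (\<Prod>x\<leftarrow>xs. u - x)" for u
  proof -
    have "poly p u = poly (\<Prod>x\<leftarrow>xs. [:-x, 1:]) u"
      using A(2) lc xs by (simp flip: prod_mset_prod_list)
    also have "\<dots> = (\<Prod>x\<leftarrow>xs. u - x)" by (induction xs) (auto simp: algebra_simps)
    finally show ?thesis .
  qed
  moreover have "poly p u = u ^ d - w" for u by (simp add: p_def poly_monom)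
  ultimately show thesis using that[of xs] A(1) deg xs by simp
qed

lemma prod_list_ge_power:
  assumes "\<And>x. x \<in> set xs \<Longrightarrow> r \<le> norm (u - x :: complex)" "0 \<le> r"
  shows "r ^ length xs \<le> norm (\<Prod>x\<leftarrow>xs. u - x)"
  using assms by (induction xs) (auto simp: norm_mult intro!: mult_mono)

text \<open>The left side of the inequality is the product of the distances from \<open>u\<close> to
  the \<open>d\<close> roots, so one of them is below \<open>r\<close>.\<close>

lemma near_root:
  assumes "0 < d" "norm (u ^ d - w) < r ^ d" "0 \<le> r"
  obtains x :: complex where "x ^ d = w" "norm (u - x) < r"
proof -
  obtain xs where xs: "length xs = d" "\<And>u. u ^ d - w = (\<Prod>x\<leftarrow>xs. u - x)"
    using power_minus_const_factorization[OF assms(1)] by metis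
  have "\<exists>x\<in>set xs. norm (u - x) < r"
    using prod_list_ge_power[of xs r u] xs assms by (force simp: not_less[symmetric])
  then obtain x where x: "x \<in> set xs" "norm (u - x) < r" by blast
  then have "x ^ d - w = 0" unfolding xs(2) by (auto simp: prod_list_zero_iff)
  then show thesis using that x by simp
qed

text \<open>Quantitative injectivity of the power map on a disc far from 0. The difference quotient
  is a sum of \<open>d\<close> monomials of degree \<open>d - 1\<close>, each deviating from
  \<open>y ^ (d - 1)\<close> by at most (1 + u)^(d-1) - 1 relatively; what survives is 1 minus this
  error.\<close>

lemma norm_power_diff_ge:
  fixes p q y :: complex
  assumes p: "norm (p - y) \<le> r" and q: "norm (q - y) \<le> r" and r: "r \<le> u * norm y" and "0 \<le> u"
  shows "norm (p - q) * (real d * norm y ^ (d - 1)) * (2 - (1 + u) ^ (d - 1)) \<le> norm (p ^ d - q ^ d)"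
proof -
  let ?a = "norm y"
  have r0: "0 \<le> r" using p norm_ge_zero[of "p - y"] by linarith
  have pd: "norm (x ^ n - y ^ n) \<le> (?a + r) ^ n - ?a ^ n" if "norm (x - y) \<le> r" for x n
    using order_trans[OF norm_power_diff_le[of x n y] incr_mono[of ?a ?a "norm (x - y)" r n]] that
    by (simp add: incr_def)
  have pn: "norm (p ^ n) \<le> (?a + r) ^ n" for n
    using p norm_triangle_sub[of p y] by (auto simp: norm_power intro!: power_mono)
  have mixed: "norm (q ^ m * p ^ n - y ^ (m + n)) \<le> (?a + r) ^ (m + n) - ?a ^ (m + n)" for m n
  proof -
    have "q ^ m * p ^ n - y ^ (m + n) = (q ^ m - y ^ m) * p ^ n + y ^ m * (p ^ n - y ^ n)"
      by (simp add: algebra_simps power_add)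
    also have "norm \<dots> \<le> norm (q ^ m - y ^ m) * norm (p ^ n) + norm (y ^ m) * norm (p ^ n - y ^ n)"
      by (rule order_trans[OF norm_triangle_ineq]) (simp add: norm_mult)
    also have "\<dots> \<le> ((?a + r) ^ m - ?a ^ m) * (?a + r) ^ n + ?a ^ m * ((?a + r) ^ n - ?a ^ n)"
      using pd[OF p] pd[OF q] pn r0 by (intro add_mono mult_mono) (auto simp: norm_power intro: power_mono)
    also have "\<dots> = (?a + r) ^ (m + n) - ?a ^ (m + n)" by (simp add: algebra_simps power_add)
    finally show ?thesis .
  qed
  let ?S = "\<Sum>i<d. q ^ (d - Suc i) * p ^ i"
  have "norm (?S - of_nat d * y ^ (d - 1)) = norm (\<Sum>i<d. q ^ (d - Suc i) * p ^ i - y ^ (d - 1))"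
    by (simp add: sum_subtractf)
  also have "\<dots> \<le> (\<Sum>i<d. (?a + r) ^ (d - 1) - ?a ^ (d - 1))"
  proof (intro order_trans[OF norm_sum] sum_mono)
    fix i assume "i \<in> {..<d}"
    then have "d - Suc i + i = d - 1" by auto
    then show "norm (q ^ (d - Suc i) * p ^ i - y ^ (d - 1)) \<le> (?a + r) ^ (d - 1) - ?a ^ (d - 1)"
      using mixed[of "d - Suc i" i] by simp
  qed
  also have "\<dots> = real d * ((?a + r) ^ (d - 1) - ?a ^ (d - 1))" by simp
  also have "\<dots> \<le> real d * (((1 + u) * ?a) ^ (d - 1) - ?a ^ (d - 1))"
    using r r0 by (intro mult_left_mono diff_right_mono power_mono) (auto simp: algebra_simps)
  also have "\<dots> = real d * ?a ^ (d - 1) * ((1 + u) ^ (d - 1) - 1)"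
    unfolding power_mult_distrib by (simp add: right_diff_distrib mult_ac)
  finally have "norm (?S - of_nat d * y ^ (d - 1)) \<le> real d * ?a ^ (d - 1) * ((1 + u) ^ (d - 1) - 1)" .
  moreover have "norm (of_nat d * y ^ (d - 1)) = real d * ?a ^ (d - 1)"
    by (simp add: norm_mult norm_power)
  ultimately have "real d * ?a ^ (d - 1) * (2 - (1 + u) ^ (d - 1)) \<le> norm ?S"
    using norm_triangle_ineq2[of "of_nat d * y ^ (d - 1)" ?S] by (simp add: norm_minus_commute algebra_simps)
  then have "norm (p - q) * (real d * ?a ^ (d - 1) * (2 - (1 + u) ^ (d - 1))) \<le> norm (p - q) * norm ?S"
    by (intro mult_left_mono) auto
  also have "\<dots> = norm (p ^ d - q ^ d)" by (subst power_diff_sumr2) (simp add: norm_mult)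
  finally show ?thesis by (simp add: mult.assoc)
qed

lemma power_one_plus_le:
  fixes x :: real
  assumes "0 \<le> x" "real n * x < 1"
  shows "(1 + x) ^ n \<le> 1 / (1 - real n * x)"
proof -
  have "(1 + x) ^ n \<le> exp x ^ n" using assms by (intro power_mono exp_ge_add_one_self) auto
  also have "\<dots> = 1 / exp (- (real n * x))" by (simp add: exp_of_nat_mult exp_minus divide_inverse)
  also have "\<dots> \<le> 1 / (1 - real n * x)"
    using assms exp_ge_add_one_self[of "- (real n * x)"] by (intro divide_left_mono) auto
  finally show ?thesis .
qed

lemma power_one_plus_le_four_thirds:
  fixes x :: real
  assumes "2 \<le> d" "0 \<le> x" "4 * real d * x \<le> 1"
  shows "(1 + x) ^ (d - 1) \<le> 4 / 3"
proof -
  have "real (d - 1) * x \<le> real d * x" using assms by (intro mult_right_mono) auto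
  then have le: "real (d - 1) * x \<le> 1 / 4" using assms by linarith
  then have "(1 + x) ^ (d - 1) \<le> 1 / (1 - real (d - 1) * x)"
    using assms by (intro power_one_plus_le) auto
  also have "\<dots> \<le> 4 / 3" using le by (simp add: field_simps)
  finally show ?thesis .
qed

text \<open>The pieces are arbitrary sets of small diameter; they stand in for the components of a
  preimage, and \<open>n\<close> for the degree of the iterate.\<close>

definition covered :: "complex set \<Rightarrow> nat \<Rightarrow> real \<Rightarrow> bool" where
  "covered A n h \<longleftrightarrow> (\<exists>F. finite F \<and> card F \<le> n \<and> A \<subseteq> \<Union>F \<and> (\<forall>G\<in>F. \<forall>u\<in>G. \<forall>v\<in>G. dist u v \<le> h))"

lemma covered_single: "(\<And>u v. u \<in> A \<Longrightarrow> v \<in> A \<Longrightarrow> dist u v \<le> h) \<Longrightarrow> 1 \<le> n \<Longrightarrow> covered A n h"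
  unfolding covered_def by (intro exI[of _ "{A}"]) auto

lemma covered_mono: "covered A n h \<Longrightarrow> n \<le> n' \<Longrightarrow> h \<le> h' \<Longrightarrow> covered A n' h'"
  unfolding covered_def by (meson order_trans)

lemma covered_vimage:
  assumes "covered (f ` A) n h'"
    and pull: "\<And>D. D \<subseteq> A \<Longrightarrow> (\<And>u v. u \<in> D \<Longrightarrow> v \<in> D \<Longrightarrow> dist (f u) (f v) \<le> h') \<Longrightarrow> covered D m h"
  shows "covered A (m * n) h"
proof -
  obtain F where F: "finite F" "card F \<le> n" "f ` A \<subseteq> \<Union>F" "\<forall>G\<in>F. \<forall>u\<in>G. \<forall>v\<in>G. dist u v \<le> h'"
    using assms(1) unfolding covered_def by (elim exE conjE) (rule that)
  have "covered (A \<inter> f -` G) m h" if "G \<in> F" for G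
    using F(4) that by (intro pull) auto
  then have "\<forall>G\<in>F. \<exists>H. finite H \<and> card H \<le> m \<and> A \<inter> f -` G \<subseteq> \<Union>H \<and> (\<forall>G\<in>H. \<forall>u\<in>G. \<forall>v\<in>G. dist u v \<le> h)"
    unfolding covered_def by blast
  then obtain H where H: "\<And>G. G \<in> F \<Longrightarrow> finite (H G)" "\<And>G. G \<in> F \<Longrightarrow> card (H G) \<le> m"
    "\<And>G. G \<in> F \<Longrightarrow> A \<inter> f -` G \<subseteq> \<Union>(H G)"
    "\<And>G. G \<in> F \<Longrightarrow> \<forall>G\<in>H G. \<forall>u\<in>G. \<forall>v\<in>G. dist u v \<le> h"
    by metis
  have "card (\<Union>G\<in>F. H G) \<le> (\<Sum>G\<in>F. card (H G))" using F(1) by (rule card_UN_le)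
  also have "\<dots> \<le> (\<Sum>G\<in>F. m)" using H(2) by (intro sum_mono) auto
  also have "\<dots> \<le> m * n" using F(2) by simp
  finally have "card (\<Union>G\<in>F. H G) \<le> m * n" .
  moreover have "A \<subseteq> \<Union>(\<Union>G\<in>F. H G)"
  proof
    fix x assume x: "x \<in> A"
    then obtain G where "G \<in> F" "f x \<in> G" using F(3) by blast
    then show "x \<in> \<Union>(\<Union>G\<in>F. H G)" using H(3)[of G] x by blast
  qed
  ultimately show ?thesis
    unfolding covered_def using F(1) H(1) H(4) by (intro exI[of _ "\<Union>G\<in>F. H G"] conjI) blast+
qed

lemma measure_le_covered:
  assumes "covered E n h" "0 \<le> h" "E \<in> sets borel"
  shows "measure lborel E \<le> real n * (pi * h\<^sup>2)"
proof -
  obtain F where F: "finite F" "card F \<le> n" "E \<subseteq> \<Union>F" "\<forall>G\<in>F. \<forall>u\<in>G. \<forall>v\<in>G. dist u v \<le> h"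
    using assms(1) unfolding covered_def by (elim exE conjE) (rule that)
  define pt where "pt G = (SOME u. u \<in> G)" for G :: "complex set"
  have sub: "E \<subseteq> (\<Union>G\<in>F. cball (pt G) h)"
  proof
    fix x assume "x \<in> E"
    then obtain G where G: "G \<in> F" "x \<in> G" using F(3) by blast
    then have "pt G \<in> G" unfolding pt_def by (metis someI)
    then show "x \<in> (\<Union>G\<in>F. cball (pt G) h)" using F(4) G by auto
  qed
  have fm: "(\<Union>G\<in>F. cball (pt G) h) \<in> fmeasurable lborel"
    using F(1) by (intro fmeasurable.finite_UN) auto
  have "measure lborel E \<le> measure lborel (\<Union>G\<in>F. cball (pt G) h)"
    using sub assms(3) fm by (intro measure_mono_fmeasurable) auto
  also have "\<dots> \<le> (\<Sum>G\<in>F. measure lborel (cball (pt G) h))"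
    using F(1) by (intro measure_UNION_le) auto
  also have "\<dots> = real (card F) * (pi * h\<^sup>2)"
    using assms(2) by (simp add: measure_cball_complex)
  also have "\<dots> \<le> real n * (pi * h\<^sup>2)"
    using F(2) by (intro mult_right_mono) auto
  finally show ?thesis .
qed

text \<open>Diameters are measured relative to the majorant radius, \<open>incr\<close> in the image
  and \<open>T\<close> in the source. The derivative then cancels, and a step costs only a factor
  close to 1.\<close>

lemma pull_back_near_linear:
  assumes D: "D \<subseteq> cball y T" "\<And>u v. u \<in> D \<Longrightarrow> v \<in> D \<Longrightarrow> norm (u ^ d - v ^ d) \<le> h * incr d (norm y) T"
    and h: "0 \<le> h" and y: "y \<noteq> 0" "0 \<le> T" "T \<le> u * norm y" and u: "0 \<le> u" "(1 + u) ^ (d - 1) < 2" and "0 < d"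
  shows "covered D 1 ((1 + u) ^ (d - 1) / (2 - (1 + u) ^ (d - 1)) * h * T)"
proof (rule covered_single)
  fix p q assume pq: "p \<in> D" "q \<in> D"
  let ?l = "real d * norm y ^ (d - 1)" and ?P = "(1 + u) ^ (d - 1)"
  have l: "0 < ?l" using y \<open>0 < d\<close> by simp
  have "norm (p - q) * ?l * (2 - ?P) \<le> norm (p ^ d - q ^ d)"
    using pq D(1) y u by (intro norm_power_diff_ge[where r = T]) (auto simp: dist_norm norm_minus_commute)
  also have "\<dots> \<le> h * incr d (norm y) T" using D(2) pq by simp
  also have "\<dots> \<le> h * (?P * ?l * T)"
    using h y by (intro mult_left_mono incr_le_linear_small) auto
  finally have "?l * (norm (p - q) * (2 - ?P)) \<le> ?l * (?P * h * T)" by (simp add: mult_ac)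
  then have "norm (p - q) * (2 - ?P) \<le> ?P * h * T" using l by (simp only: mult_le_cancel_left_pos)
  then show "dist p q \<le> ?P / (2 - ?P) * h * T"
    using u by (simp add: dist_norm field_simps)
qed auto

text \<open>At worst a relative diameter turns into its \<open>d\<close>-th root, as at the critical
  point. For \<open>1 < h\<close> the diameter of the disc suffices; a disc far from 0 is handled
  almost linearly; for a disc near 0 the \<open>d\<close> roots of one image value serve as centres
  of the pieces.\<close>

lemma pull_back_general:
  assumes D: "D \<subseteq> cball y T" "\<And>u v. u \<in> D \<Longrightarrow> v \<in> D \<Longrightarrow> norm (u ^ d - v ^ d) \<le> h * incr d (norm y) T"
    and h: "0 < h" and t: "0 < T" and d: "2 \<le> d"
  shows "covered D d ((16 * real d + 4) * h powr (1 / real d) * T)"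
proof -
  let ?C = "16 * real d + 4"
  have "0 < d" using d by simp
  have C: "2 \<le> ?C" using d by simp
  have hp: "0 < h powr (1 / real d)" using h by simp
  consider "1 < h" | "h \<le> 1" "4 * real d * T \<le> norm y" | "h \<le> 1" "norm y < 4 * real d * T" by linarith
  then show ?thesis
  proof cases
    case 1
    have "1 \<le> h powr (1 / real d)" using 1 by (intro ge_one_powr_ge_zero) auto
    then have "2 * 1 \<le> ?C * h powr (1 / real d)" using C by (intro mult_mono) auto
    then have "2 * T \<le> ?C * h powr (1 / real d) * T" using t by (intro mult_right_mono) auto
    moreover have "dist p q \<le> 2 * T" if "p \<in> D" "q \<in> D" for p q
    proof -
      have "dist y p \<le> T" "dist y q \<le> T" using that D(1) by (auto simp: subset_iff)
      then show ?thesis using dist_triangle3[of p q y] by linarith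
    qed
    ultimately show ?thesis using d by (intro covered_single) force+
  next
    case 2
    let ?u = "1 / (4 * real d)"
    let ?P = "(1 + ?u) ^ (d - 1)"
    have P: "?P \<le> 4 / 3" using d by (intro power_one_plus_le_four_thirds) auto
    have "0 < 4 * real d * T" using t d by simp
    then have "y \<noteq> 0" using 2 by auto
    then have cov: "covered D 1 (?P / (2 - ?P) * h * T)"
    proof (intro pull_back_near_linear[where y = y and u = ?u])
      show "?P < 2" using P by linarith
      show "T \<le> ?u * norm y" using 2 d by (simp add: field_simps)
    qed (use D t h d in auto)
    have "?P / (2 - ?P) \<le> (4 / 3) / (2 - 4 / 3)"
      using P by (intro frac_le) auto
    also have "\<dots> = 2" by simp
    also have "\<dots> \<le> ?C" by (rule C)
    finally have le1: "?P / (2 - ?P) \<le> ?C" .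
    have "h = h powr 1" using h by simp
    also have "\<dots> \<le> h powr (1 / real d)"
      using 2 h d by (intro powr_mono') auto
    finally have "?P / (2 - ?P) * h * T \<le> ?C * h powr (1 / real d) * T"
      using le1 t h by (intro mult_mono) auto
    then show ?thesis using covered_mono[OF cov] d by simp
  next
    case 3
    show ?thesis
    proof (cases "D = {}")
      case True
      then show ?thesis using d by (intro covered_single) auto
    next
      case False
      then obtain v where v: "v \<in> D" by blast
      \<comment> \<open>Here |y| + T is below (4 d + 1) T, hence below the
        \<open>8 * real d + 2\<close> times \<open>T\<close> used for the radius. Doubling the
        radius to bound a diameter gives \<open>16 * real d + 4\<close>.\<close>
      let ?x = "(8 * real d + 2) * h powr (1 / real d) * T"
      have x: "0 < ?x" using hp t by simp
      have "(h powr (1 / real d)) ^ d = h"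
        using h d by (simp add: powr_powr flip: powr_realpow)
      then have xd: "?x ^ d = h * ((8 * real d + 2) * T) ^ d"
        by (simp add: power_mult_distrib mult_ac)
      have "incr d (norm y) T \<le> (norm y + T) ^ d" by (rule incr_le_power) auto
      also have "\<dots> < ((8 * real d + 2) * T) ^ d"
      proof (rule power_strict_mono)
        have "0 \<le> real d * T" using t by simp
        then show "norm y + T < (8 * real d + 2) * T"
          using 3 t unfolding distrib_right mult.assoc by linarith
      qed (use t \<open>0 < d\<close> in auto)
      finally have small: "h * incr d (norm y) T < ?x ^ d" using h by (simp add: xd)
      obtain xs where xs: "length xs = d" "\<And>u. u ^ d - v ^ d = (\<Prod>x\<leftarrow>xs. u - x)"
        using power_minus_const_factorization[OF \<open>0 < d\<close>] by metis
      show ?thesis unfolding covered_def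
      proof (intro exI conjI ballI)
        show "finite ((\<lambda>w. cball w ?x) ` set xs)" by simp
        show "card ((\<lambda>w. cball w ?x) ` set xs) \<le> d"
          using card_image_le[of "set xs" "\<lambda>w. cball w ?x"] card_length[of xs] xs(1) by simp
        show "D \<subseteq> \<Union>((\<lambda>w. cball w ?x) ` set xs)"
        proof
          fix u assume "u \<in> D"
          then have "norm (u ^ d - v ^ d) < ?x ^ d" using D(2)[OF _ v] small by force
          then have "\<not> (\<forall>w\<in>set xs. ?x \<le> norm (u - w))"
            using prod_list_ge_power[of xs ?x u] xs x by (metis less_imp_le not_less)
          then show "u \<in> \<Union>((\<lambda>w. cball w ?x) ` set xs)"
            by (auto simp: dist_norm norm_minus_commute not_le intro: less_imp_le)
        qed
      next
        fix G p q assume "G \<in> (\<lambda>w. cball w ?x) ` set xs" "p \<in> G" "q \<in> G"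
        then obtain w where "dist w p \<le> ?x" "dist w q \<le> ?x" by auto
        then have "dist p q \<le> 2 * ?x" using dist_triangle2[of p q w] by (simp add: dist_commute)
        then show "dist p q \<le> ?C * h powr (1 / real d) * T" by (simp add: algebra_simps)
      qed
    qed
  qed
qed

section \<open>Slow recurrence\<close>

lemma incr_pos: "0 \<le> a \<Longrightarrow> 0 < r \<Longrightarrow> 0 < d \<Longrightarrow> 0 < incr d a r"
  unfolding incr_def by (simp add: power_strict_mono)

lemma spread_pos: "(\<And>j. 0 \<le> a j) \<Longrightarrow> 0 < r \<Longrightarrow> 0 < d \<Longrightarrow> 0 < spread d a s m r"
  by (induction m) (auto intro: incr_pos)

lemma spread_zero: "0 < d \<Longrightarrow> spread d a s m 0 = 0"
  by (induction m) (auto simp: incr_def)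

lemma continuous_on_spread: "continuous_on S (\<lambda>r. spread d a s m r)"
  by (induction m) (auto simp: incr_def intro!: continuous_intros)

text \<open>One constraint is added at a time. If the current \<open>t\<close> violates the new one,
  the intermediate value theorem lowers \<open>t\<close> until equality holds there; the earlier
  constraints survive by monotonicity.\<close>

lemma exists_scale:
  assumes "\<And>j. 0 \<le> a j" "0 < d" "\<And>j. 0 < b j"
  shows "\<exists>t. 0 < t \<and> t \<le> b 0 \<and> (\<forall>j\<le>k. spread d a 0 j t \<le> b j) \<and> (\<exists>j\<le>k. spread d a 0 j t = b j)"
proof (induction k)
  case 0
  then show ?case using assms by (intro exI[of _ "b 0"]) auto
next
  case (Suc k)
  then obtain t where t: "0 < t" "t \<le> b 0" "\<And>j. j \<le> k \<Longrightarrow> spread d a 0 j t \<le> b j"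
    "\<exists>j\<le>k. spread d a 0 j t = b j" by blast
  show ?case
  proof (cases "spread d a 0 (Suc k) t \<le> b (Suc k)")
    case True
    then show ?thesis using t by (intro exI[of _ t]) (auto simp: le_Suc_eq)
  next
    case False
    have "\<exists>x. 0 \<le> x \<and> x \<le> t \<and> spread d a 0 (Suc k) x = b (Suc k)"
      using False t assms(3)[of "Suc k"] spread_zero[OF assms(2), of a 0 "Suc k"]
      by (intro IVT' continuous_on_spread) auto
    then obtain x where x: "0 \<le> x" "x \<le> t" "spread d a 0 (Suc k) x = b (Suc k)" by blast
    have "x \<noteq> 0" using x(3) assms(3)[of "Suc k"] spread_zero[OF assms(2), of a 0 "Suc k"] by auto
    moreover have "spread d a 0 j x \<le> b j" if "j \<le> Suc k" for j
    proof (cases "j = Suc k")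
      case False
      then show ?thesis
        using t(3)[of j] that spread_mono[of a a x t d 0 j] x assms(1) by force
    qed (use x in simp)
    ultimately show ?thesis using x t by (intro exI[of _ x]) auto
  qed
qed

text \<open>The times in \<open>S\<close> are the close visits to the critical point: only there the pull-back is not
  almost linear, and each of them multiplies the number of pieces by \<open>d\<close>.\<close>

lemma covered_preimage:
  fixes d k :: nat and c z :: complex and \<rho> t u :: real and S :: "nat set"
  defines "T \<equiv> \<lambda>j. spread d (radii d c z) 0 j t"
  defines "F \<equiv> (1 + u) ^ (d - 1) / (2 - (1 + u) ^ (d - 1))"
  assumes d: "2 \<le> d" and E: "E \<subseteq> cball z t" "(\<lambda>w. orbit d c w k) ` E \<subseteq> ball 0 \<rho>" and pos: "0 < t" "0 < \<rho>"
    and u: "0 \<le> u" "(1 + u) ^ (d - 1) < 2"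
    and lin: "\<And>j. j < k \<Longrightarrow> j \<notin> S \<Longrightarrow> T j \<le> u * radii d c z j"
  shows "covered E (d ^ card {j \<in> S. j < k})
    ((16 * real d + 4) ^ card {j \<in> S. j < k} * F ^ k * (2 * \<rho> / T k) powr (1 / real d ^ card {j \<in> S. j < k}) * t)"
proof -
  let ?C = "16 * real d + 4"
  define H where "H = 2 * \<rho> / T k"
  define M where "M j = card {i \<in> S. j \<le> i \<and> i < k}" for j
  define E' where "E' j = (\<lambda>w. orbit d c w j) ` E" for j
  have tau: "0 < T j" for j unfolding T_def using pos d by (intro spread_pos) auto
  have H: "0 < H" unfolding H_def using tau pos by simp
  have P1: "1 \<le> (1 + u) ^ (d - 1)" using u by (intro one_le_power) auto
  then have F: "1 \<le> F" unfolding F_def using u by (simp add: field_simps)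
  have C: "1 \<le> ?C" by simp
  have sub: "E' j \<subseteq> cball (orbit d c z j) (T j)" for j
  proof
    fix x assume "x \<in> E' j"
    then obtain w where w: "w \<in> E" "x = orbit d c w j" unfolding E'_def by blast
    then have "dist w (orbit d c z 0) \<le> t" using E(1) by (auto simp: dist_commute)
    from orbit_dist_le[OF this, of j] show "x \<in> cball (orbit d c z j) (T j)"
      by (simp add: w T_def dist_commute)
  qed
  have image: "unicrit d c ` E' j = E' (Suc j)" for j
    unfolding E'_def by (auto simp: image_image)
  \<comment> \<open>Induction downwards from time \<open>k\<close>, with diameters relative to
    \<open>T j\<close>: a step outside \<open>S\<close> multiplies by \<open>F\<close>, a step in
    \<open>S\<close> takes the \<open>d\<close>-th root and costs a constant.\<close>
  have "covered (E' j) (d ^ M j) (?C ^ M j * F ^ (k - j) * H powr (1 / real d ^ M j) * T j)" if "j \<le> k" for j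
    using that
  proof (induction rule: inc_induct)
    case base
    have M0: "M k = 0" unfolding M_def by (auto simp: card_eq_0_iff)
    show ?case
    proof (rule covered_single)
      fix p q assume "p \<in> E' k" "q \<in> E' k"
      then have "norm p < \<rho>" "norm q < \<rho>" using E(2) unfolding E'_def by auto
      then have "dist p q \<le> 2 * \<rho>"
        using norm_triangle_ineq4[of p q] by (simp add: dist_norm)
      also have "2 * \<rho> = H * T k" unfolding H_def using tau[of k] by simp
      finally show "dist p q \<le> ?C ^ M k * F ^ (k - k) * H powr (1 / real d ^ M k) * T k"
        using H by (simp add: M0)
    qed (use d in simp)
  next
    case (step j)
    define h where "h = ?C ^ M (Suc j) * F ^ (k - Suc j) * H powr (1 / real d ^ M (Suc j))"
    have h: "0 < h" unfolding h_def using C F H by (intro mult_pos_pos zero_less_power) auto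
    have tauS: "T (Suc j) = incr d (radii d c z j) (T j)" by (simp add: T_def)
    have kj: "k - j = Suc (k - Suc j)" using step by simp
    have cov: "covered (unicrit d c ` E' j) (d ^ M (Suc j)) (h * T (Suc j))"
      using step.IH by (simp add: image h_def)
    have pw: "norm (p ^ d - q ^ d) \<le> h * incr d (norm (orbit d c z j)) (T j)"
      if "dist (unicrit d c p) (unicrit d c q) \<le> h * T (Suc j)" for p q
      using that by (simp add: tauS unicrit_def dist_norm)
    show ?case
    proof (cases "j \<in> S")
      case False
      then have "{i \<in> S. j \<le> i \<and> i < k} = {i \<in> S. Suc j \<le> i \<and> i < k}"
        by (auto simp: Suc_le_eq le_less)
      then have M: "M j = M (Suc j)" by (simp add: M_def)
      have small: "T j \<le> u * radii d c z j" using lin False step by auto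
      then have "orbit d c z j \<noteq> 0" using tau[of j] by auto
      have "covered (E' j) (1 * d ^ M (Suc j)) (F * h * T j)"
      proof (rule covered_vimage[OF cov])
        fix D assume D: "D \<subseteq> E' j" "\<And>p q. p \<in> D \<Longrightarrow> q \<in> D \<Longrightarrow> dist (unicrit d c p) (unicrit d c q) \<le> h * T (Suc j)"
        show "covered D 1 (F * h * T j)"
          unfolding F_def using D(1) sub[of j] pw D(2) h \<open>orbit d c z j \<noteq> 0\<close> tau[of j] small u d
          by (intro pull_back_near_linear[where y = "orbit d c z j"]) auto
      qed
      then show ?thesis by (simp add: h_def M kj mult_ac)
    next
      case True
      then have "{i \<in> S. j \<le> i \<and> i < k} = insert j {i \<in> S. Suc j \<le> i \<and> i < k}"
        using step by auto
      then have M: "M j = Suc (M (Suc j))" by (simp add: M_def)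
      have "covered (E' j) (d * d ^ M (Suc j)) (?C * h powr (1 / real d) * T j)"
      proof (rule covered_vimage[OF cov])
        fix D assume D: "D \<subseteq> E' j" "\<And>p q. p \<in> D \<Longrightarrow> q \<in> D \<Longrightarrow> dist (unicrit d c p) (unicrit d c q) \<le> h * T (Suc j)"
        show "covered D d (?C * h powr (1 / real d) * T j)"
          using D(1) sub[of j] pw D(2) h tau[of j] d
          by (intro pull_back_general[where y = "orbit d c z j"]) auto
      qed
      moreover have "?C * h powr (1 / real d) * T j
          \<le> ?C ^ M j * F ^ (k - j) * H powr (1 / real d ^ M j) * T j"
      proof (rule mult_right_mono)
        define X where "X = ?C ^ M (Suc j) * F ^ (k - Suc j)"
        have "1 * 1 \<le> X" unfolding X_def using C F by (intro mult_mono one_le_power) auto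
        then have X: "1 \<le> X" by simp
        have "h powr (1 / real d) = X powr (1 / real d) * H powr (1 / real d ^ M j)"
          unfolding h_def X_def[symmetric] using X H by (simp add: powr_mult powr_powr M mult.commute)
        \<comment> \<open>As \<open>X\<close> is at least 1, its root is at most \<open>X\<close>.
          The constants merely accumulate, and \<open>H\<close> alone carries the fractional
          exponent.\<close>
        also have "\<dots> \<le> X powr 1 * H powr (1 / real d ^ M j)"
          using X d by (intro mult_right_mono powr_mono) auto
        finally have "?C * h powr (1 / real d) \<le> ?C * (X * H powr (1 / real d ^ M j))"
          using X C by (intro mult_left_mono) auto
        also have "\<dots> = (?C ^ M j * F ^ (k - Suc j)) * H powr (1 / real d ^ M j)"
          by (simp add: X_def M mult_ac)
        also have "\<dots> \<le> (?C ^ M j * F ^ (k - j)) * H powr (1 / real d ^ M j)"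
          using C F by (intro mult_right_mono mult_left_mono power_increasing) auto
        finally show "?C * h powr (1 / real d) \<le> ?C ^ M j * F ^ (k - j) * H powr (1 / real d ^ M j)"
          by simp
      qed (use tau[of j] in simp)
      ultimately show ?thesis using covered_mono[of "E' j" "d * d ^ M (Suc j)" _ "d ^ M j"] by (simp add: M)
    qed
  qed
  from this[of 0] show ?thesis by (simp add: E'_def M_def H_def T_def)
qed

section \<open>Sparsity of close visits\<close>

lemma spread_le_Lipschitz_power:
  assumes "\<And>j. 0 \<le> a j" "\<And>j. a j \<le> B" "0 \<le> r" "1 \<le> L" "L = real d * (B + 1) ^ (d - 1)" "L ^ m * r \<le> 1"
  shows "spread d a s m r \<le> L ^ m * r"
  using assms(6)
proof (induction m rule: less_induct)
  case (less m)
  have "spread d a s k r \<le> 1" if "k < m" for k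
  proof -
    have "L ^ k * r \<le> L ^ m * r" using that assms by (intro mult_right_mono power_increasing) auto
    with less that show ?thesis by force
  qed
  then show ?case unfolding assms(5) using assms by (intro spread_le_Lipschitz) auto
qed

text \<open>Noncontraction forces the disc of radius \<open>4 * r\<close> about the first point to
  have radius above \<open>2 * r\<close> at the second visit. But the first step shrinks it to order
  r^2, and growing back to order \<open>r\<close> at rate \<open>L\<close> takes a time of order -
  ln r.\<close>

lemma close_visits_gap:
  assumes nc: "noncontracting d B p a" and d: "2 \<le> d" and m: "0 < m" and r: "0 < r" "4 * r \<le> 1"
    and close: "a s \<le> r" "a (s + m) \<le> r" and L: "L = real d * (B + 1) ^ (d - 1)"
  shows "2 \<le> L ^ m * 5 ^ d * r"
proof (rule ccontr)
  assume neg: "\<not> ?thesis"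
  have nn: "0 \<le> a j" for j using nc by (rule noncontracting_nonneg)
  have aB: "a j \<le> B" for j using noncontractingD(2)[OF nc] .
  have B: "0 \<le> B" using nn[of 0] aB[of 0] by linarith
  have "1 * 1 \<le> L" unfolding L using d B by (intro mult_mono one_le_power) auto
  then have L1: "1 \<le> L" by simp
  obtain k where k: "m = Suc k" using m by (cases m) auto
  have "incr d (a s) (4 * r) \<le> (a s + 4 * r) ^ d" by (rule incr_le_power[OF nn])
  also have "\<dots> \<le> (5 * r) ^ d" using close r nn[of s] by (intro power_mono) auto
  also have "\<dots> = 5 ^ d * (r * r ^ (d - 1))" using d by (cases d) (auto simp: power_mult_distrib)
  also have "r ^ (d - 1) \<le> r ^ 1" using r d by (intro power_decreasing) auto
  then have "5 ^ d * (r * r ^ (d - 1)) \<le> 5 ^ d * (r * r)" using r by (intro mult_left_mono) auto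
  finally have first: "incr d (a s) (4 * r) \<le> 5 ^ d * r * r" by (simp add: mult_ac)
  have firstnn: "0 \<le> incr d (a s) (4 * r)" using nn r by (intro incr_nonneg) auto
  have "L ^ k * incr d (a s) (4 * r) \<le> L ^ m * (5 ^ d * r * r)"
    unfolding k using first L1 firstnn r by (intro mult_mono power_increasing) auto
  also have "\<dots> = (L ^ m * 5 ^ d * r) * r" by simp
  also have "\<dots> \<le> 2 * r" using neg r by (intro mult_right_mono) auto
  finally have le: "L ^ k * incr d (a s) (4 * r) \<le> 2 * r" .
  have "spread d a s m (4 * r) = spread d a (Suc s) k (incr d (a s) (4 * r))"
    unfolding k using spread_add[of d a s 1 k] by simp
  also have "\<dots> \<le> L ^ k * incr d (a s) (4 * r)"
    using nn aB firstnn L1 L le r by (intro spread_le_Lipschitz_power[where B = B]) auto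
  finally have "spread d a s m (4 * r) \<le> 2 * r" using le by linarith
  moreover have "4 * r < a s + a (s + m) + spread d a s m (4 * r)"
    using nc m r by (intro noncontracting_radii) auto
  ultimately show False using close by linarith
qed

lemma card_separated_le:
  fixes S :: "nat set" and g :: real
  assumes "S \<subseteq> {..<k}" "0 < g" and sep: "\<And>x y. x \<in> S \<Longrightarrow> y \<in> S \<Longrightarrow> x < y \<Longrightarrow> g \<le> real y - real x"
  shows "card S \<le> nat \<lfloor>real k / g\<rfloor> + 1"
proof -
  let ?h = "\<lambda>x. nat \<lfloor>real x / g\<rfloor>"
  have lt: "?h x < ?h y" if "x \<in> S" "y \<in> S" "x < y" for x y
  proof -
    have "1 \<le> (real y - real x) / g" using sep[OF that] assms(2) by simp
    then have "real x / g + 1 \<le> real y / g" by (simp add: diff_divide_distrib)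
    then have "\<lfloor>real x / g\<rfloor> + 1 \<le> \<lfloor>real y / g\<rfloor>" by linarith
    moreover have "0 \<le> \<lfloor>real x / g\<rfloor>" using assms(2) by simp
    ultimately show ?thesis by linarith
  qed
  have "inj_on ?h S"
  proof (rule inj_onI)
    fix x y assume "x \<in> S" "y \<in> S" "?h x = ?h y"
    then show "x = y" using lt[of x y] lt[of y x] by (cases x y rule: linorder_cases) auto
  qed
  moreover have "?h ` S \<subseteq> {..nat \<lfloor>real k / g\<rfloor>}"
    using assms(1,2) by (auto intro!: nat_mono floor_mono divide_right_mono)
  ultimately have "card S \<le> card {..nat \<lfloor>real k / g\<rfloor>}" by (intro card_inj_on_le) auto
  then show ?thesis by simp
qed

lemma tendsto_exp_neg_linear: "0 < e \<Longrightarrow> ((\<lambda>k::nat. q * exp (- e * real k)) \<longlongrightarrow> 0) sequentially" for q e :: real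
proof -
  assume "0 < e"
  then have "((\<lambda>k. q * (exp (- e)) ^ k) \<longlongrightarrow> q * 0) sequentially"
    by (intro tendsto_intros LIMSEQ_realpow_zero) auto
  then show ?thesis by (simp flip: exp_of_nat_mult add: mult.commute)
qed

text \<open>At depth exp (- \<xi> k) the gap between visits is proportional to \<open>k\<close>, so
  their number before time \<open>k\<close> is bounded independently of \<open>k\<close>. Half of
  the exponent absorbs 5^d, the other half gives the gap; this is the 2 in \<open>N\<close> and
  \<open>g\<close>.\<close>

lemma card_close_visits:
  assumes d: "2 \<le> d" and B: "0 \<le> B" and \<xi>: "0 < \<xi>"
  obtains N :: nat where "\<forall>\<^sub>F k in sequentially. \<forall>p a. noncontracting d B p a \<longrightarrow>
    card {j. j < k \<and> a j < exp (- \<xi> * real k)} \<le> N"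
proof -
  define L where "L = real d * (B + 1) ^ (d - 1)"
  have "1 * 1 \<le> (B + 1) ^ (d - 1)" using B by (simp add: one_le_power)
  then have "2 * 1 \<le> L" unfolding L_def using d by (intro mult_mono) auto
  then have L: "1 < L" by simp
  have lnL: "0 < ln L" using L by simp
  define N where "N = nat \<lfloor>2 * ln L / \<xi>\<rfloor> + 1"
  have ev: "\<forall>\<^sub>F k in sequentially. 4 * exp (- \<xi> * real k) \<le> 1 \<and> 5 ^ d * exp (- \<xi> * real k / 2) \<le> 2 \<and> 0 < k"
  proof (intro eventually_conj)
    show "\<forall>\<^sub>F k in sequentially. 4 * exp (- \<xi> * real k) \<le> 1"
      using order_tendstoD(2)[OF tendsto_exp_neg_linear[OF \<xi>, of 4], of 1] by (auto elim: eventually_mono)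
    show "\<forall>\<^sub>F k in sequentially. 5 ^ d * exp (- \<xi> * real k / 2) \<le> 2"
      using order_tendstoD(2)[OF tendsto_exp_neg_linear[of "\<xi> / 2" "5 ^ d"], of 2] \<xi> by (auto elim: eventually_mono)
    show "\<forall>\<^sub>F k::nat in sequentially. 0 < k" by (rule eventually_gt_at_top)
  qed
  show thesis
  proof (rule that)
    show "\<forall>\<^sub>F k in sequentially. \<forall>p a. noncontracting d B p a \<longrightarrow>
        card {j. j < k \<and> a j < exp (- \<xi> * real k)} \<le> N"
      using ev
    proof (eventually_elim, intro allI impI)
      fix k p a
      let ?h = "exp (- \<xi> * real k / 2)" and ?S = "{j. j < k \<and> a j < exp (- \<xi> * real k)}"
      assume elim: "4 * exp (- \<xi> * real k) \<le> 1 \<and> 5 ^ d * ?h \<le> 2 \<and> 0 < k"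
        and nc: "noncontracting d B p a"
      define g where "g = \<xi> * real k / (2 * ln L)"
      have g: "0 < g" using elim \<xi> lnL by (simp add: g_def)
      have "card ?S \<le> nat \<lfloor>real k / g\<rfloor> + 1"
      proof (rule card_separated_le[OF _ g])
        fix x y assume xy: "x \<in> ?S"
          "y \<in> ?S" "x < y"
        obtain m where m: "y = x + m" "0 < m" using xy(3) less_imp_add_positive by blast
        let ?r = "exp (- \<xi> * real k)"
        have "2 \<le> L ^ m * 5 ^ d * ?r"
          using xy m elim by (intro close_visits_gap[OF nc d m(2), where s = x]) (auto simp: L_def)
        also have "?r = ?h * ?h"
          by (simp flip: exp_add)
        also have "L ^ m * 5 ^ d * (?h * ?h)
            = (L ^ m * ?h) * (5 ^ d * ?h)" by simp
        also have "\<dots> \<le> (L ^ m * ?h) * 2"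
          using elim L by (intro mult_left_mono) auto
        finally have "1 \<le> L ^ m * ?h" by simp
        then have "0 \<le> ln (L ^ m * ?h)" by simp
        also have "\<dots> = real m * ln L - \<xi> * real k / 2"
          using L by (simp add: ln_mult ln_realpow)
        finally have "\<xi> * real k / 2 \<le> real m * ln L" by simp
        then have "g \<le> real m" using lnL by (simp add: g_def field_simps)
        then show "g \<le> real y - real x" using m by simp
      qed auto
      also have "real k / g = 2 * ln L / \<xi>" using elim \<xi> lnL by (simp add: g_def field_simps)
      finally show "card ?S \<le> N" by (simp add: N_def)
    qed
  qed
qed

text \<open>The lower bound for the derivatives is applied to the radii truncated at depth \<open>\<theta>\<close>. At each of the
  at most \<open>N\<close> visits below that depth the disc has size at least \<open>W d \<theta>\<close>, and there the
  nonlinearity only raises the loss to its \<open>d\<close>-th power.\<close>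

lemma spread_lower_bound:
  fixes d N k j0 :: nat and a :: "nat \<Rightarrow> real" and \<theta> \<eta> t C \<delta> :: real
  defines "a' \<equiv> \<lambda>j. max (a j) \<theta>"
  defines "T \<equiv> \<lambda>j. spread d a 0 j t"
  defines "W \<equiv> \<eta> * C / (real d * (1 + \<eta>) ^ ((d + 1) * k))"
  assumes d: "2 \<le> d" and a: "\<And>j. 0 \<le> a j" and th: "0 < \<theta>" "\<theta> \<le> \<delta>" and eta: "0 < \<eta>" "\<eta> \<le> 1" and C: "0 < C" "C \<le> 1"
    and bound: "\<And>s n \<alpha>. \<lbrakk>s \<le> n; 0 < \<alpha>; \<alpha> \<le> \<delta>; \<And>j. s \<le> j \<Longrightarrow> j \<le> n \<Longrightarrow> \<alpha> \<le> a' j\<rbrakk>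
      \<Longrightarrow> C * \<alpha> ^ d \<le> (1 + \<eta>) ^ ((d + 1) * (n - s)) *
        (min \<delta> (a' s) * slope d a' s (n - s)) * min \<delta> (a' n) ^ (d - 1)"
    and t: "0 < t" and j0: "j0 \<le> k" "T j0 = \<eta> * a' j0"
    and ak: "a k < \<theta>" and N: "card {j. j < k \<and> a j < \<theta>} \<le> N"
  shows "W ^ (d ^ N) * \<theta> \<le> T k"
proof -
  have a': "0 < a' j" for j using th by (simp add: a'_def max_def)
  then have a'nn: "0 \<le> a' j" for j by (rule less_imp_le)
  have W0: "0 < W" unfolding W_def using eta C d by (intro divide_pos_pos mult_pos_pos) auto
  have "\<eta> * C \<le> 1 * 1" using eta C by (intro mult_mono) auto
  also have "1 * 1 \<le> real d * (1 + \<eta>) ^ ((d + 1) * k)"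
    using d eta by (intro mult_mono one_le_power) auto
  finally have W1: "W \<le> 1" unfolding W_def using d eta by (simp add: divide_le_eq_1)
  \<comment> \<open>The linear prediction for the size of the disc, computed from time
    \<open>j0\<close> with the truncated radii.\<close>
  define V where "V j = \<eta> * a' j0 * slope d a' j0 (j - j0)" for j
  have Vnn: "0 \<le> V j" for j unfolding V_def using eta a'nn slope_nonneg[of a'] by auto
  \<comment> \<open>The trailing factor of the slope bound equals \<theta>^(d-1) here, so the
    prediction at a visit is at least of order \<theta>, not \<theta>^d.\<close>
  have V: "W * real d * \<theta> \<le> V i" if i: "j0 \<le> i" "i \<le> k" "a i < \<theta>" for i
  proof -
    have ai: "a' i = \<theta>" using i by (simp add: a'_def)
    let ?Q = "(1 + \<eta>) ^ ((d + 1) * k)"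
    have "C * \<theta> ^ d \<le> (1 + \<eta>) ^ ((d + 1) * (i - j0)) *
        (min \<delta> (a' j0) * slope d a' j0 (i - j0)) * min \<delta> (a' i) ^ (d - 1)"
      using i th by (intro bound) (auto simp: a'_def)
    also have "min \<delta> (a' i) = \<theta>" using ai th by simp
    also have "(1 + \<eta>) ^ ((d + 1) * (i - j0)) * (min \<delta> (a' j0) * slope d a' j0 (i - j0)) * \<theta> ^ (d - 1)
        \<le> ?Q * (a' j0 * slope d a' j0 (i - j0)) * \<theta> ^ (d - 1)"
      using eta i th a'nn slope_nonneg[of a'] a'[of j0]
      by (intro mult_right_mono mult_mono power_increasing) auto
    also have "C * \<theta> ^ d = C * \<theta> * \<theta> ^ (d - 1)" using d by (cases d) auto
    finally have "C * \<theta> \<le> ?Q * (a' j0 * slope d a' j0 (i - j0))"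
      using th by simp
    then have "\<eta> * (C * \<theta>) \<le> \<eta> * (?Q * (a' j0 * slope d a' j0 (i - j0)))"
      using eta by (intro mult_left_mono) auto
    also have "\<dots> = ?Q * V i" by (simp add: V_def mult_ac)
    finally have "\<eta> * C * \<theta> \<le> ?Q * V i" by (simp add: mult.assoc)
    moreover have "W * real d * \<theta> = \<eta> * C * \<theta> / ?Q" unfolding W_def using d by simp
    ultimately show ?thesis using eta by (simp add: divide_le_eq mult.commute)
  qed
  define M where "M j = card {i. j0 \<le> i \<and> i < j \<and> a i < \<theta>}" for j
  have taunn: "0 \<le> T j" for j unfolding T_def using a t by (intro spread_nonneg) auto
  \<comment> \<open>At a visit the true radius is at least the \<open>d\<close>-th power of the
    previous one, while the prediction only gains d \<theta>^(d-1). Raising the induction hypothesis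
    to the power \<open>d\<close> and using \<open>V\<close> adds \<open>d - 1\<close> factors of
    \<open>W\<close>: the exponent obeys e -> e d + (d - 1), solved by
    \<open>d ^ M j - 1\<close>.\<close>
  have main: "W ^ (d ^ M j - 1) * V j \<le> T j" if "j0 \<le> j" "j \<le> k" for j
    using that
  proof (induction rule: dec_induct)
    case base
    have "M j0 = 0" unfolding M_def by (auto simp: card_eq_0_iff)
    then show ?case using j0 by (simp add: V_def)
  next
    case (step j)
    have Suc: "Suc j - j0 = Suc (j - j0)" "j0 + (j - j0) = j" using step by auto
    have VS: "V (Suc j) = V j * (real d * a' j ^ (d - 1))"
      unfolding V_def Suc(1) slope_Suc Suc(2) by (simp add: mult_ac)
    have tS: "T (Suc j) = incr d (a j) (T j)" by (simp add: T_def)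
    have IH: "W ^ (d ^ M j - 1) * V j \<le> T j" using step by simp
    show ?case
    proof (cases "a j < \<theta>")
      case False
      then have "{i. j0 \<le> i \<and> i < Suc j \<and> a i < \<theta>} = {i. j0 \<le> i \<and> i < j \<and> a i < \<theta>}"
        by (auto simp: less_Suc_eq)
      then have M: "M (Suc j) = M j" by (simp add: M_def)
      have aj: "a' j = a j" using False by (simp add: a'_def)
      have "W ^ (d ^ M (Suc j) - 1) * V (Suc j) = (real d * a j ^ (d - 1)) * (W ^ (d ^ M j - 1) * V j)"
        by (simp add: M VS aj)
      also have "\<dots> \<le> (real d * a j ^ (d - 1)) * T j"
        using IH a by (intro mult_left_mono) auto
      also have "\<dots> \<le> T (Suc j)" unfolding tS using a taunn by (intro incr_ge_linear) auto
      finally show ?thesis .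
    next
      case True
      then have "{i. j0 \<le> i \<and> i < Suc j \<and> a i < \<theta>} = insert j {i. j0 \<le> i \<and> i < j \<and> a i < \<theta>}"
        using step by auto
      then have M: "M (Suc j) = Suc (M j)" by (simp add: M_def)
      define e where "e = d ^ M j - 1"
      have e: "d ^ M (Suc j) - 1 = e * d + (d - 1)"
      proof -
        have "1 \<le> d ^ M j" using d by simp
        then have "(d ^ M j - 1) * d + d = d ^ M j * d" using d by (simp add: diff_mult_distrib)
        then show ?thesis unfolding M e_def using d by (simp add: mult.commute)
      qed
      have aj: "a' j = \<theta>" using True by (simp add: a'_def)
      have V': "W * real d * \<theta> \<le> V j" using V True step by simp
      have dd: "real d ^ 1 \<le> real d ^ (d - 1)" using d by (intro power_increasing) auto
      have "W ^ (d ^ M (Suc j) - 1) * V (Suc j) = W ^ (e * d) * V j * (W ^ (d - 1) * real d ^ 1 * \<theta> ^ (d - 1))"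
        unfolding e VS aj by (simp add: power_add mult_ac)
      also have "\<dots> \<le> W ^ (e * d) * V j * (W ^ (d - 1) * real d ^ (d - 1) * \<theta> ^ (d - 1))"
        using dd W0 Vnn th by (intro mult_left_mono mult_right_mono) auto
      also have "\<dots> = W ^ (e * d) * V j * (W * real d * \<theta>) ^ (d - 1)"
        by (simp add: power_mult_distrib)
      also have "\<dots> \<le> W ^ (e * d) * V j * V j ^ (d - 1)"
        using V' W0 Vnn th d by (intro mult_left_mono power_mono) auto
      also have "\<dots> = (W ^ e * V j) ^ d"
        unfolding power_mult_distrib power_mult using d by (cases d) auto
      also have "\<dots> \<le> T j ^ d"
        using IH W0 Vnn by (intro power_mono) (auto simp: e_def)
      also have "\<dots> \<le> T (Suc j)" unfolding tS using a taunn d by (intro incr_ge_power) auto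
      finally show ?thesis .
    qed
  qed
  have "M k \<le> card {j. j < k \<and> a j < \<theta>}" unfolding M_def by (intro card_mono) auto
  with N have MN: "M k \<le> N" by simp
  have "W ^ (d ^ N) * \<theta> \<le> W ^ (d ^ M k) * \<theta>"
    using W0 W1 MN d th by (intro mult_right_mono power_decreasing power_increasing) auto
  also have "W ^ (d ^ M k) = W ^ (d ^ M k - 1) * W"
  proof -
    have "d ^ M k = Suc (d ^ M k - 1)" using d by simp
    then show ?thesis by (metis power_Suc2)
  qed
  also have "W ^ (d ^ M k - 1) * W * \<theta> = W ^ (d ^ M k - 1) * (W * 1 * \<theta>)" by simp
  also have "\<dots> \<le> W ^ (d ^ M k - 1) * (W * real d * \<theta>)"
    using W0 th d by (intro mult_left_mono mult_right_mono) auto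
  also have "\<dots> \<le> W ^ (d ^ M k - 1) * V k"
    using V[OF j0(1) order_refl ak] W0 by (intro mult_left_mono) auto
  also have "\<dots> \<le> T k" using main[OF j0(1)] by simp
  finally show ?thesis .
qed

section \<open>Rarity of close returns\<close>

lemma exists_small_rate:
  fixes m n :: nat and A B :: real
  assumes "1 < A" "1 < B"
  obtains \<eta> :: real where "0 < \<eta>" "\<eta> \<le> 1" "(1 + \<eta>) ^ m \<le> A" "(1 + \<eta>) ^ n < 2"
    "(1 + \<eta>) ^ n / (2 - (1 + \<eta>) ^ n) \<le> B"
proof -
  have lim: "((\<lambda>\<eta>::real. (1 + \<eta>) ^ k) \<longlongrightarrow> (1 + 0) ^ k) (at_right 0)" for k
    by (intro tendsto_intros)
  have lim2: "((\<lambda>\<eta>::real. (1 + \<eta>) ^ n / (2 - (1 + \<eta>) ^ n)) \<longlongrightarrow> (1 + 0) ^ n / (2 - (1 + 0) ^ n)) (at_right 0)"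
    by (intro tendsto_intros) auto
  have "\<forall>\<^sub>F \<eta>::real in at_right 0. 0 < \<eta> \<and> \<eta> < 1 \<and> (1 + \<eta>) ^ m < A \<and> (1 + \<eta>) ^ n < 2 \<and>
      (1 + \<eta>) ^ n / (2 - (1 + \<eta>) ^ n) < B"
    using assms order_tendstoD(2)[OF lim[of m], of A] order_tendstoD(2)[OF lim[of n], of 2] order_tendstoD(2)[OF lim2, of B]
    by (intro eventually_conj eventually_at_right_less) (auto simp: eventually_at_right[of 0 1] intro!: exI[of _ 1])
  then have "\<exists>\<eta>::real. 0 < \<eta> \<and> \<eta> < 1 \<and> (1 + \<eta>) ^ m < A \<and> (1 + \<eta>) ^ n < 2 \<and>
      (1 + \<eta>) ^ n / (2 - (1 + \<eta>) ^ n) < B"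
    using eventually_happens trivial_limit_at_right_real by blast
  then show thesis using that by (auto intro: less_imp_le)
qed

lemma close_returns_borel: "{z \<in> julia (unicrit d c). radii d c z k < r} \<in> sets borel"
proof -
  have "open {z. radii d c z k < r}"
    by (intro open_Collect_less continuous_intros continuous_on_orbit)
  moreover have "closed (julia (unicrit d c))" by (simp add: julia_def)
  moreover have "{z \<in> julia (unicrit d c). radii d c z k < r} = julia (unicrit d c) \<inter> {z. radii d c z k < r}" by auto
  ultimately show ?thesis by auto
qed

text \<open>About a point whose orbit comes close to the critical point at time \<open>k\<close> there is a disc on
  which the \<open>k\<close>-th iterate has bounded degree and an image of size at least of order
  \<open>exp (- \<epsilon> k / 2)\<close>; the points of this disc sharing the close return are therefore exponentially
  rare in it.\<close>

lemma measure_close_returns: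
  fixes d :: nat and c :: complex and \<epsilon> :: real
  assumes d: "2 \<le> d" and \<epsilon>: "0 < \<epsilon>"
  obtains K \<kappa> where "0 < \<kappa>" "\<forall>\<^sub>F k in sequentially.
    measure lborel {z \<in> julia (unicrit d c). radii d c z k < exp (- \<epsilon> * real k)} \<le> K * exp (- \<kappa> * real k)"
proof -
  define B where "B = 2 + norm c"
  have B: "2 \<le> B" by (simp add: B_def)
  \<comment> \<open>Budget in units of \<xi> k: the truncation depth is 1 and the nonlinear loss is
    at most 1, so the image disc has size at least of order exp (- 2 \<xi> k). The return has depth
    4, which leaves the relative size exp (- 2 \<xi> k).\<close>
  define \<xi> where "\<xi> = \<epsilon> / 4"
  have xi: "0 < \<xi>" using \<epsilon> by (simp add: \<xi>_def)
  obtain N :: nat where N: "\<forall>\<^sub>F k in sequentially. \<forall>p a. noncontracting d B p a \<longrightarrow>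
      card {j. j < k \<and> a j < exp (- \<xi> * real k)} \<le> N"
    using card_close_visits[OF d _ xi, of B] B by auto
  define D where "D = real d ^ N"
  have D: "1 \<le> D" unfolding D_def using d by (intro one_le_power) auto
  obtain \<eta> where eta: "0 < \<eta>" "\<eta> \<le> 1" "(1 + \<eta>) ^ ((d + 1) * d ^ N) \<le> exp \<xi>" "(1 + \<eta>) ^ (d - 1) < 2"
    "(1 + \<eta>) ^ (d - 1) / (2 - (1 + \<eta>) ^ (d - 1)) \<le> exp (\<xi> / D)"
    using exists_small_rate[of "exp \<xi>" "exp (\<xi> / D)" "(d + 1) * d ^ N" "d - 1"] xi D by auto
  define F where "F = (1 + \<eta>) ^ (d - 1) / (2 - (1 + \<eta>) ^ (d - 1))"
  have F0: "0 \<le> F" unfolding F_def using eta by simp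
  obtain C0 \<delta> where C0\<delta>: "slope_bound d B \<eta> C0 \<delta>"
    using slope_lower_bound[OF d order_trans[OF zero_le_numeral B] eta(1,2)] by blast
  note C0 = slope_bound_pos[OF C0\<delta>] and bound0 = slope_boundD[OF C0\<delta>]
  define C where "C = min C0 1"
  have C: "0 < C" "C \<le> 1" using C0 by (auto simp: C_def)
  define G where "G = (\<eta> * C / real d) ^ (d ^ N)"
  have G: "0 < G" unfolding G_def using eta C d by simp
  define Kc where "Kc = (16 * real d + 4) ^ N * (2 / G) powr (1 / D)"
  define K where "K = 25 * (D * Kc\<^sup>2) * measure lborel (ball (0::complex) (B + B))"
  \<comment> \<open>The root of order \<open>D\<close> turns the gain 2 \<xi> into 2 \<xi> / D, the
    almost linear steps give back \<xi> / D, and squaring for the area doubles the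
    remainder.\<close>
  define \<kappa> where "\<kappa> = 2 * \<xi> / D"
  have ev: "\<forall>\<^sub>F k::nat in sequentially. exp (- \<xi> * real k) \<le> \<delta> \<and> (2 / G) * exp (- (2 * \<xi>) * real k) \<le> 1"
  proof (intro eventually_conj)
    show "\<forall>\<^sub>F k::nat in sequentially. exp (- \<xi> * real k) \<le> \<delta>"
      using order_tendstoD(2)[OF tendsto_exp_neg_linear[OF xi, of 1] C0(2)] by (auto elim: eventually_mono)
    show "\<forall>\<^sub>F k::nat in sequentially. (2 / G) * exp (- (2 * \<xi>) * real k) \<le> 1"
      using order_tendstoD(2)[OF tendsto_exp_neg_linear[of "2 * \<xi>" "2 / G"], of 1] xi
      by (auto elim!: eventually_mono)
  qed
  show thesis
  proof (rule that[of \<kappa>])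
    show "0 < \<kappa>" unfolding \<kappa>_def using xi D by simp
    show "\<forall>\<^sub>F k in sequentially.
      measure lborel {z \<in> julia (unicrit d c). radii d c z k < exp (- \<epsilon> * real k)} \<le> K * exp (- \<kappa> * real k)"
      using N ev
    proof eventually_elim
      case (elim k)
      let ?x = "exp (- (2 * \<xi>) * real k)"
      let ?E = "{z \<in> julia (unicrit d c). radii d c z k < exp (- \<epsilon> * real k)}"
      define \<theta> where "\<theta> = exp (- \<xi> * real k)"
      define \<rho> where "\<rho> = exp (- \<epsilon> * real k)"
      define h where "h = Kc * exp (- (\<xi> / D) * real k)"
      have th: "0 < \<theta>" "\<theta> \<le> \<delta>" "\<rho> \<le> \<theta>" "0 < \<rho>"
        using elim xi \<epsilon> by (auto simp: \<theta>_def \<rho>_def \<xi>_def mult_right_mono)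
      have hnn: "0 \<le> h" unfolding h_def Kc_def by simp
      have "measure lborel ?E \<le> 25 * (D * pi * h\<^sup>2) / pi * measure lborel (ball (0::complex) (B + B))"
      proof (rule measure_le_local)
        show "?E \<in> sets borel" by (rule close_returns_borel)
        show "?E \<subseteq> cball 0 B"
          using norm_orbit_julia_le[OF d, of _ c 0] by (auto simp: B_def)
        show "0 \<le> D * pi * h\<^sup>2" using D by simp
      next
        fix z assume z: "z \<in> ?E"
        define a where "a = radii d c z"
        define a' where "a' j = max (a j) \<theta>" for j
        have nc: "noncontracting d B (orbit d c z) a"
          using noncontracting_julia[OF d] z unfolding a_def B_def by blast
        have ann: "0 \<le> a j" for j by (simp add: a_def)
        have a'pos: "0 < a' j" for j using th by (simp add: a'_def max_def)
        have a'B: "a' j \<le> B" for j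
          using noncontractingD(2)[OF nc, of j] th C0 B by (simp add: a'_def)
        have nc': "noncontracting d B (orbit d c z) a'"
          by (rule noncontracting_mono[OF nc _ a'B]) (simp add: a'_def)
        \<comment> \<open>The scale is limited by \<eta> times the truncated radii. At times outside
          the close visits these are the true radii, so the disc is small there relative to its
          distance from 0; the time of equality is the start \<open>j0\<close> of the lower
          estimate.\<close>
        obtain t where t: "0 < t" "t \<le> \<eta> * a' 0" "\<And>j. j \<le> k \<Longrightarrow> spread d a 0 j t \<le> \<eta> * a' j"
          "\<exists>j\<le>k. spread d a 0 j t = \<eta> * a' j"
          using exists_scale[of a d "\<lambda>j. \<eta> * a' j" k] ann d eta a'pos by auto
        obtain j0 where j0: "j0 \<le> k" "spread d a 0 j0 t = \<eta> * a' j0" using t by blast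
        have "\<eta> * a' 0 \<le> 1 * B" using eta a'B[of 0] a'pos[of 0] by (intro mult_mono) auto
        with t have tB: "t \<le> B" by simp
        have cardN: "card {j. j < k \<and> a j < \<theta>} \<le> N" using elim nc unfolding \<theta>_def by blast
        let ?W = "\<eta> * C / (real d * (1 + \<eta>) ^ ((d + 1) * k))"
        have "?W ^ (d ^ N) * \<theta> \<le> spread d a 0 k t"
        proof (rule spread_lower_bound[where \<delta> = \<delta> and ?j0.0 = j0])
          fix s n :: nat and \<alpha> :: real
          assume *: "s \<le> n" "0 < \<alpha>" "\<alpha> \<le> \<delta>" "\<And>j. s \<le> j \<Longrightarrow> j \<le> n \<Longrightarrow> \<alpha> \<le> max (a j) \<theta>"
          have "C * \<alpha> ^ d \<le> C0 * \<alpha> ^ d" using * by (intro mult_right_mono) (auto simp: C_def)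
          also have "\<dots> \<le> (1 + \<eta>) ^ ((d + 1) * (n - s)) *
              (min \<delta> (a' s) * slope d a' s (n - s)) * min \<delta> (a' n) ^ (d - 1)"
            using * by (intro bound0[OF nc']) (auto simp: a'_def)
          finally show "C * \<alpha> ^ d \<le> (1 + \<eta>) ^ ((d + 1) * (n - s)) *
              (min \<delta> (max (a s) \<theta>) * slope d (\<lambda>j. max (a j) \<theta>) s (n - s)) * min \<delta> (max (a n) \<theta>) ^ (d - 1)"
            unfolding a'_def .
        next
          show "a k < \<theta>" using z th unfolding a_def \<rho>_def by auto
        qed (use d ann th eta C t j0 cardN in \<open>auto simp: a'_def\<close>)
        moreover have "G * exp (- \<xi> * real k) \<le> ?W ^ (d ^ N)"
        proof -
          have "((1 + \<eta>) ^ ((d + 1) * k)) ^ (d ^ N) = ((1 + \<eta>) ^ ((d + 1) * d ^ N)) ^ k"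
            unfolding power_mult[symmetric] by (simp only: mult_ac)
          also have "\<dots> \<le> exp \<xi> ^ k" using eta by (intro power_mono) auto
          finally have "G / exp \<xi> ^ k \<le> G / ((1 + \<eta>) ^ ((d + 1) * k)) ^ (d ^ N)"
            using G eta by (intro divide_left_mono) auto
          also have "\<dots> = ?W ^ (d ^ N)" by (simp add: G_def power_divide power_mult_distrib)
          finally show ?thesis
            by (simp add: exp_minus divide_inverse flip: exp_of_nat_mult add: mult.commute)
        qed
        then have "G * exp (- \<xi> * real k) * \<theta> \<le> ?W ^ (d ^ N) * \<theta>"
          using th by (intro mult_right_mono) auto
        ultimately have "G * exp (- \<xi> * real k) * \<theta> \<le> spread d a 0 k t" by linarith
        moreover have "exp (- \<xi> * real k) * \<theta> = ?x"
          by (simp add: \<theta>_def flip: exp_add)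
        ultimately have tau: "G * ?x \<le> spread d a 0 k t" by (simp add: mult.assoc)
        define H where "H = 2 * \<rho> / spread d a 0 k t"
        have "\<rho> = ?x * ?x"
          by (simp add: \<rho>_def \<xi>_def flip: exp_add)
        then have "2 * \<rho> = (2 / G * ?x) * (G * ?x)"
          using G by simp
        also have "\<dots> \<le> (2 / G * ?x) * spread d a 0 k t"
          using tau G by (intro mult_left_mono) auto
        finally have H: "H \<le> 2 / G * ?x"
          unfolding H_def using spread_pos[of a t d 0 k] ann t d by (simp add: divide_le_eq)
        have Hpos: "0 < H" unfolding H_def using th spread_pos[of a t d 0 k] ann t d by simp
        define M where "M = card {j \<in> {j. a j < \<theta>}. j < k}"
        have M: "M \<le> N" using cardN unfolding M_def by (simp add: conj_commute)
        have cov: "covered (?E \<inter> cball z t) (d ^ M)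
            ((16 * real d + 4) ^ M * F ^ k * H powr (1 / real d ^ M) * t)"
          unfolding M_def F_def H_def a_def
        proof (rule covered_preimage)
          fix j assume "j < k" "j \<notin> {j. radii d c z j < \<theta>}"
          then show "spread d (radii d c z) 0 j t \<le> \<eta> * radii d c z j"
            using t(3)[of j] unfolding a_def a'_def by (simp add: max_def split: if_splits)
        qed (use d t th eta in \<open>auto simp: \<rho>_def\<close>)
        have "(16 * real d + 4) ^ M * F ^ k * H powr (1 / real d ^ M)
            \<le> (16 * real d + 4) ^ N * exp (\<xi> / D) ^ k * ((2 / G) powr (1 / D) * ?x powr (1 / D))"
        proof (intro mult_mono)
          show "(16 * real d + 4) ^ M \<le> (16 * real d + 4) ^ N" using M by (intro power_increasing) auto
          show "F ^ k \<le> exp (\<xi> / D) ^ k" using eta F0 by (intro power_mono) (auto simp: F_def)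
          have dM: "real d ^ M \<le> D" unfolding D_def using M d by (intro power_increasing) auto
          have "H powr (1 / real d ^ M) \<le> (2 / G * ?x) powr (1 / real d ^ M)"
            using H Hpos by (intro powr_mono2) auto
          also have "\<dots> \<le> (2 / G * ?x) powr (1 / D)"
            using elim G d dM D by (intro powr_mono' divide_left_mono) auto
          also have "\<dots> = (2 / G) powr (1 / D) * ?x powr (1 / D)"
            using G by (subst powr_mult) auto
          finally show "H powr (1 / real d ^ M) \<le> (2 / G) powr (1 / D) * ?x powr (1 / D)" .
        qed (use F0 in auto)
        also have "\<dots> = Kc * (exp (\<xi> / D) ^ k * ?x powr (1 / D))"
          by (simp add: Kc_def)
        also have "exp (\<xi> / D) ^ k * ?x powr (1 / D) = exp (- (\<xi> / D) * real k)"
        proof -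
          have "?x powr (1 / D) = exp (- (2 * \<xi>) * real k / D)"
            by (simp add: powr_def)
          moreover have "exp (\<xi> / D) ^ k = exp (real k * (\<xi> / D))"
            by (rule exp_of_nat_mult[symmetric])
          ultimately have "exp (\<xi> / D) ^ k * ?x powr (1 / D)
              = exp (real k * (\<xi> / D) + - (2 * \<xi>) * real k / D)" by (simp only: exp_add)
          also have "real k * (\<xi> / D) + - (2 * \<xi>) * real k / D = - (\<xi> / D) * real k"
            using D by (simp add: field_simps)
          finally show ?thesis .
        qed
        finally have "(16 * real d + 4) ^ M * F ^ k * H powr (1 / real d ^ M) \<le> h"
          by (simp add: h_def)
        then have "(16 * real d + 4) ^ M * F ^ k * H powr (1 / real d ^ M) * t \<le> h * t"
          using t by (intro mult_right_mono) auto
        then have "covered (?E \<inter> cball z t) (d ^ N) (h * t)"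
          using covered_mono[OF cov] M d by (simp add: power_increasing)
        then have "measure lborel (?E \<inter> cball z t) \<le> real (d ^ N) * (pi * (h * t)\<^sup>2)"
          using hnn t close_returns_borel[of d c k "exp (- \<epsilon> * real k)"]
          by (intro measure_le_covered) auto
        also have "\<dots> = D * pi * h\<^sup>2 * t\<^sup>2" by (simp add: D_def power_mult_distrib)
        finally show "\<exists>t>0. t \<le> B \<and> measure lborel (?E \<inter> cball z t) \<le> D * pi * h\<^sup>2 * t\<^sup>2"
          using t tB by blast
      qed
      also have "\<dots> = K * (exp (- (\<xi> / D) * real k))\<^sup>2"
        by (simp add: K_def h_def power_mult_distrib)
      also have "(exp (- (\<xi> / D) * real k))\<^sup>2 = exp (- \<kappa> * real k)"
        by (simp add: \<kappa>_def power2_eq_square flip: exp_add)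
      finally show ?case .
    qed
  qed
qed

text \<open>The exponentially small areas are summable, so Borel-Cantelli applies for each fixed
  rate. The rates 1 / (m + 1) suffice, and their countably many exceptional null sets can be
  united.\<close>

theorem slow_recurrence:
  assumes d: "2 \<le> d"
  shows "AE z in lborel. z \<in> julia (unicrit d c) \<longrightarrow>
    (\<forall>\<epsilon>>0. \<forall>\<^sub>F k in sequentially. exp (- \<epsilon> * real k) \<le> radii d c z k)"
proof -
  let ?E = "\<lambda>\<epsilon> k. {z \<in> julia (unicrit d c). radii d c z k < exp (- \<epsilon> * real k)}"
  have fm: "?E \<epsilon> k \<in> fmeasurable lborel" for \<epsilon> k
  proof (rule fmeasurableI2)
    show "cball (0::complex) (2 + norm c) \<in> fmeasurable lborel" by (rule fmeasurable_cball)
    show "?E \<epsilon> k \<subseteq> cball 0 (2 + norm c)"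
      using norm_orbit_julia_le[OF d, of _ c 0] by auto
  qed (use close_returns_borel in simp)
  have "AE z in lborel. \<forall>\<^sub>F k in sequentially. z \<in> space lborel - ?E \<epsilon> k" if \<epsilon>: "0 < \<epsilon>" for \<epsilon> :: real
  proof (rule borel_cantelli_AE1)
    show "?E \<epsilon> k \<in> sets lborel" "emeasure lborel (?E \<epsilon> k) < \<infinity>" for k
      using fm by (auto simp: fmeasurable_def)
    obtain K \<kappa> where K: "0 < \<kappa>" "\<forall>\<^sub>F k in sequentially. measure lborel (?E \<epsilon> k) \<le> K * exp (- \<kappa> * real k)"
      using that by (rule measure_close_returns[OF d \<epsilon>, of c])
    have "summable (\<lambda>k. exp (- \<kappa>) ^ k)" using K by (intro summable_geometric) auto
    then have "summable (\<lambda>k. K * exp (- \<kappa> * real k))"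
      by (intro summable_mult) (simp flip: exp_of_nat_mult add: mult.commute)
    moreover have "\<forall>\<^sub>F k in sequentially. norm (measure lborel (?E \<epsilon> k)) \<le> K * exp (- \<kappa> * real k)"
      using K(2) by simp
    ultimately show "summable (\<lambda>k. measure lborel (?E \<epsilon> k))"
      by (rule summable_comparison_test_ev[rotated])
  qed
  then have "\<forall>m. AE z in lborel. \<forall>\<^sub>F k in sequentially. z \<in> space lborel - ?E (1 / real (Suc m)) k"
    using divide_pos_pos[OF zero_less_one of_nat_0_less_iff[THEN iffD2, OF zero_less_Suc]] by blast
  then have "AE z in lborel. \<forall>m. \<forall>\<^sub>F k in sequentially. z \<in> space lborel - ?E (1 / real (Suc m)) k"
    unfolding AE_all_countable .
  then show ?thesis
  proof eventually_elim
    case (elim z)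
    show ?case
    proof (intro impI allI)
      fix \<epsilon> :: real assume z: "z \<in> julia (unicrit d c)" and "0 < \<epsilon>"
      then obtain m where m: "1 / real (Suc m) < \<epsilon>" using nat_approx_posE by metis
      have "\<forall>\<^sub>F k in sequentially. z \<in> space lborel - ?E (1 / real (Suc m)) k" using elim by blast
      then show "\<forall>\<^sub>F k in sequentially. exp (- \<epsilon> * real k) \<le> radii d c z k"
      proof eventually_elim
        case (elim k)
        have "1 / real (Suc m) * real k \<le> \<epsilon> * real k" using m by (intro mult_right_mono) auto
        then have "exp (- \<epsilon> * real k) \<le> exp (- (1 / real (Suc m)) * real k)" by simp
        moreover have "\<not> radii d c z k < exp (- (1 / real (Suc m)) * real k)" using elim z by blast
        ultimately show ?case by linarith
      qed
    qed
  qed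
qed

section \<open>Exponents\<close>

text \<open>A new record raises the running maximum by at most \<open>A\<close>, so height
  \<open>S k\<close> takes at least \<open>S k / A\<close> records.\<close>

lemma card_records_ge:
  fixes S :: "nat \<Rightarrow> real"
  assumes "S 0 = 0" "\<And>n. S (Suc n) \<le> S n + A" "0 \<le> A" "k \<le> N"
  shows "S k \<le> A * real (card {n. 0 < n \<and> n \<le> N \<and> (\<forall>j<n. S j < S n)})"
  using assms(4)
proof (induction N arbitrary: k)
  case 0
  then show ?case using assms by simp
next
  case (Suc N)
  let ?R = "\<lambda>N. {n. 0 < n \<and> n \<le> N \<and> (\<forall>j<n. S j < S n)}"
  have fin: "finite (?R N)" for N by (rule finite_subset[of _ "{..N}"]) auto
  have "card (?R N) \<le> card (?R (Suc N))" by (intro card_mono fin) auto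
  then have mono: "A * real (card (?R N)) \<le> A * real (card (?R (Suc N)))"
    using assms(3) by (intro mult_left_mono) auto
  show ?case
  proof (cases "k \<le> N")
    case True
    then show ?thesis using Suc.IH[of k] mono by linarith
  next
    case False
    then have k: "k = Suc N" using Suc.prems by simp
    show ?thesis
    proof (cases "\<forall>j<Suc N. S j < S (Suc N)")
      case True
      then have "?R (Suc N) = insert (Suc N) (?R N)" by (auto simp: le_Suc_eq)
      then have "card (?R (Suc N)) = Suc (card (?R N))" using fin by simp
      then have "A * real (card (?R (Suc N))) = A * real (card (?R N)) + A" by (simp add: algebra_simps)
      then show ?thesis using k assms(2)[of N] Suc.IH[of N] by simp
    next
      case False
      then obtain j where "j \<le> N" "S (Suc N) \<le> S j" by (auto simp: not_less less_Suc_eq_le)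
      then show ?thesis unfolding k using Suc.IH[of j] mono by linarith
    qed
  qed
qed

lemma card_shadow_le:
  fixes x :: real
  assumes "0 \<le> x"
  shows "real (card {n. j < n \<and> real (n - j) < x}) \<le> x" "finite {n. j < n \<and> real (n - j) < x}"
proof -
  have sub: "{n. j < n \<and> real (n - j) < x} \<subseteq> (\<lambda>m. j + m) ` {1..nat \<lfloor>x\<rfloor>}"
  proof
    fix n assume "n \<in> {n. j < n \<and> real (n - j) < x}"
    then have n: "j < n" "real (n - j) < x" by auto
    then have "n - j \<le> nat \<lfloor>x\<rfloor>" by (simp add: le_nat_floor)
    then show "n \<in> (\<lambda>m. j + m) ` {1..nat \<lfloor>x\<rfloor>}"
      using n by (intro image_eqI[of _ _ "n - j"]) auto
  qed
  then show "finite {n. j < n \<and> real (n - j) < x}" by (rule finite_subset) simp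
  have "card {n. j < n \<and> real (n - j) < x} \<le> card ((\<lambda>m. j + m) ` {1..nat \<lfloor>x\<rfloor>})"
    using sub by (intro card_mono) auto
  also have "\<dots> \<le> nat \<lfloor>x\<rfloor>" using card_image_le[of "{1..nat \<lfloor>x\<rfloor>}" "\<lambda>m. j + m"] by simp
  finally show "real (card {n. j < n \<and> real (n - j) < x}) \<le> x"
    using assms by (meson le_nat_floor of_nat_le_iff of_nat_floor order_trans)
qed

lemma sum_card_swap:
  fixes R :: "nat \<Rightarrow> nat \<Rightarrow> bool"
  shows "(\<Sum>n\<le>N. card {j. j < n \<and> R j n}) = (\<Sum>j<N. card {n. j < n \<and> n \<le> N \<and> R j n})"
proof -
  have "(\<Sum>n\<le>N. card {j. j < n \<and> R j n}) = card (SIGMA n:{..N}. {j. j < n \<and> R j n})"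
    by (subst card_SigmaI) auto
  also have "\<dots> = card (SIGMA j:{..<N}. {n. j < n \<and> n \<le> N \<and> R j n})"
  proof (rule bij_betw_same_card[of prod.swap])
    show "bij_betw prod.swap (SIGMA n:{..N}. {j. j < n \<and> R j n}) (SIGMA j:{..<N}. {n. j < n \<and> n \<le> N \<and> R j n})"
      by (rule bij_betwI[where g = prod.swap]) auto
  qed
  also have "\<dots> = (\<Sum>j<N. card {n. j < n \<and> n \<le> N \<and> R j n})"
    by (subst card_SigmaI) auto
  finally show ?thesis .
qed

lemma ln_slope:
  assumes "\<And>j. 0 < a j" "0 < d"
  shows "0 < slope d a s m" "ln (slope d a s m) = (\<Sum>i<m. ln (real d) + real (d - 1) * ln (a (s + i)))"
proof -
  have pos: "0 < slope d a s m" for m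
    unfolding slope_def using assms by (intro prod_pos) auto
  show "0 < slope d a s m" by (rule pos)
  show "ln (slope d a s m) = (\<Sum>i<m. ln (real d) + real (d - 1) * ln (a (s + i)))"
  proof (induction m)
    case (Suc m)
    have q: "0 < a (s + m) ^ (d - 1)" using assms by simp
    have "ln (slope d a s (Suc m)) = ln (slope d a s m) + (ln (real d) + ln (a (s + m) ^ (d - 1)))"
      unfolding slope_Suc using pos[of m] q assms by (subst ln_mult_pos, simp, simp, subst ln_mult_pos) auto
    then show ?case using Suc assms by (simp add: ln_realpow)
  qed auto
qed

text \<open>At a record time of the function \<open>ln (slope d a 0 n) - \<epsilon> n / 2\<close> the orbit segment ending there expands
  backwards at a definite rate; a visit at depth \<open>a j\<close> obstructs only the record times in a shadow
  of length proportional to \<open>- ln (a j)\<close>, and the total length of the shadows is linear.\<close>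

definition good_time :: "nat \<Rightarrow> (nat \<Rightarrow> real) \<Rightarrow> real \<Rightarrow> nat \<Rightarrow> nat \<Rightarrow> bool" where
  "good_time d a \<epsilon> N n \<longleftrightarrow> (\<forall>k\<le>n. exp (\<epsilon> / 2 * real (n - k)) * slope d a 0 k \<le> slope d a 0 n) \<and>
    card {j. j < n \<and> a j < exp (- (\<epsilon> / 4) * real (n - j))} \<le> N"

text \<open>With \<theta> half the guaranteed record density, more than \<theta> N records come
  after time \<theta> N, which sends the good times to infinity. Were all of them bad, each would
  lie in more than \<open>Nc\<close> shadows, and together they would exceed the total shadow length
  4 C1 N / \<epsilon>.\<close>

lemma frequently_good_times:
  fixes a :: "nat \<Rightarrow> real"
  assumes d: "2 \<le> d" and a: "\<And>j. 0 < a j" "\<And>j. a j \<le> B" and B: "1 \<le> B" and \<epsilon>: "0 < \<epsilon>"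
    and low: "\<forall>\<^sub>F n in sequentially. exp (- real n) \<le> slope d a 0 n"
    and high: "\<exists>\<^sub>F n in sequentially. exp (\<epsilon> * real n) < slope d a 0 n"
  obtains Nc where "\<exists>\<^sub>F n in sequentially. good_time d a \<epsilon> Nc n"
proof -
  have pos: "0 < slope d a 0 n" for n using a d by (intro ln_slope) auto
  define l where "l j = max 0 (- ln (a j))" for j
  define C1 where "C1 = 1 + ln (real d) + real (d - 1) * ln B"
  have lnd: "0 \<le> ln (real d)" using d by simp
  have lnB: "0 \<le> ln B" using B by simp
  have C1: "0 < C1" unfolding C1_def using lnd lnB by (simp add: add_pos_nonneg)
  \<comment> \<open>Every factor of the slope is bounded above while the product is at least exp (-
    n). As \<open>d - 1\<close> is at least 1, each depth is charged at least once, so the depths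
    have a linear sum.\<close>
  have suml: "(\<Sum>j<n. l j) \<le> C1 * real n" if n: "exp (- real n) \<le> slope d a 0 n" for n
  proof -
    have "- real n \<le> ln (slope d a 0 n)" using n pos[of n] by (simp add: ln_ge_iff)
    also have "\<dots> = (\<Sum>i<n. ln (real d) + real (d - 1) * ln (a i))"
      using ln_slope(2)[of a d 0 n] a d by simp
    also have "\<dots> \<le> (\<Sum>i<n. ln (real d) + real (d - 1) * ln B - l i)"
    proof (rule sum_mono)
      fix i
      have "ln (a i) \<le> ln B" using a B by simp
      then have "ln (a i) \<le> ln B - l i" using lnB by (auto simp: l_def max_def)
      then have "real (d - 1) * ln (a i) \<le> real (d - 1) * (ln B - l i)" by (intro mult_left_mono) auto
      also have "\<dots> \<le> real (d - 1) * ln B - l i"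
      proof -
        have "1 * l i \<le> real (d - 1) * l i" using d by (intro mult_right_mono) (auto simp: l_def)
        then show ?thesis by (simp add: right_diff_distrib)
      qed
      finally show "ln (real d) + real (d - 1) * ln (a i) \<le> ln (real d) + real (d - 1) * ln B - l i" by simp
    qed
    also have "\<dots> = (ln (real d) + real (d - 1) * ln B) * real n - (\<Sum>i<n. l i)"
      by (simp add: sum_subtractf mult.commute)
    finally show ?thesis by (simp add: C1_def algebra_simps)
  qed
  define S where "S n = ln (slope d a 0 n) - \<epsilon> / 2 * real n" for n
  define A where "A = ln (real d) + real (d - 1) * ln B + 1"
  have A: "1 \<le> A" unfolding A_def using lnd lnB by simp
  have S0: "S 0 = 0" by (simp add: S_def)
  have SSuc: "S (Suc n) \<le> S n + A" for n
  proof -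
    have "ln (a n) \<le> ln B" using a B by simp
    then have "real (d - 1) * ln (a n) \<le> real (d - 1) * ln B" by (intro mult_left_mono) auto
    moreover have "ln (slope d a 0 (Suc n)) = ln (slope d a 0 n) + (ln (real d) + real (d - 1) * ln (a n))"
      using ln_slope(2)[of a d 0] a d by simp
    moreover have "\<epsilon> / 2 * real (Suc n) = \<epsilon> / 2 * real n + \<epsilon> / 2" by (simp add: field_simps)
    ultimately show ?thesis using \<epsilon> unfolding S_def A_def by linarith
  qed
  define \<theta> where "\<theta> = \<epsilon> / (4 * A)"
  have th: "0 < \<theta>" unfolding \<theta>_def using \<epsilon> A by simp
  define Q where "Q n = {j. j < n \<and> a j < exp (- (\<epsilon> / 4) * real (n - j))}" for n
  define Nc where "Nc = nat \<lceil>4 * C1 / (\<epsilon> * \<theta>)\<rceil>"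
  have Nc: "4 * C1 / (\<epsilon> * \<theta>) \<le> real Nc" unfolding Nc_def by (rule real_nat_ceiling_ge)
  define good where "good n \<longleftrightarrow> (\<forall>j<n. S j < S n) \<and> card (Q n) \<le> Nc" for n
  have step: "\<exists>n. \<theta> * real N < real n \<and> good n"
    if N: "0 < N" "exp (- real N) \<le> slope d a 0 N" "exp (\<epsilon> * real N) < slope d a 0 N" for N
  proof (rule ccontr)
    assume neg: "\<not> ?thesis"
    let ?R = "{n. 0 < n \<and> n \<le> N \<and> (\<forall>j<n. S j < S n)}"
    let ?R' = "{n \<in> ?R. \<theta> * real N < real n}"
    let ?Q = "\<lambda>j. {n. j < n \<and> n \<le> N \<and> a j < exp (- (\<epsilon> / 4) * real (n - j))}"
    have fin: "finite ?R" by (rule finite_subset[of _ "{..N}"]) auto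
    have "\<epsilon> * real N < ln (slope d a 0 N)"
      using N(3) pos[of N] by (metis exp_less_cancel_iff exp_ln)
    then have "\<epsilon> / 2 * real N < S N" by (simp add: S_def)
    also have "\<dots> \<le> A * real (card ?R)"
      using S0 SSuc A by (intro card_records_ge) auto
    finally have R: "2 * (\<theta> * real N) < real (card ?R)"
      unfolding \<theta>_def using A by (simp add: field_simps)
    have "?R \<subseteq> ?R' \<union> {n. 0 < n \<and> real n \<le> \<theta> * real N}" by auto
    moreover have "{n. 0 < n \<and> real n \<le> \<theta> * real N} \<subseteq> {1..nat \<lfloor>\<theta> * real N\<rfloor>}"
      by (auto simp: le_nat_floor)
    ultimately have "?R \<subseteq> ?R' \<union> {1..nat \<lfloor>\<theta> * real N\<rfloor>}" by blast
    then have "card ?R \<le> card (?R' \<union> {1..nat \<lfloor>\<theta> * real N\<rfloor>})" using fin by (intro card_mono) auto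
    also have "\<dots> \<le> card ?R' + nat \<lfloor>\<theta> * real N\<rfloor>" using card_Un_le[of ?R' "{1..nat \<lfloor>\<theta> * real N\<rfloor>}"] by simp
    finally have "real (card ?R) \<le> real (card ?R') + \<theta> * real N"
      using of_nat_floor[of "\<theta> * real N"] th mult_nonneg_nonneg[of \<theta> "real N"]
      by (smt (verit) of_nat_0_le_iff of_nat_add of_nat_le_iff)
    with R have R': "\<theta> * real N < real (card ?R')" by linarith
    have big: "real Nc + 1 \<le> real (card (Q n))" if "n \<in> ?R'" for n
      using neg that unfolding good_def by force
    have "(\<Sum>n\<in>?R'. real Nc + 1) \<le> (\<Sum>n\<in>?R'. real (card (Q n)))" using big by (rule sum_mono)
    also have "\<dots> \<le> (\<Sum>n\<le>N. real (card (Q n)))" by (intro sum_mono2) auto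
    also have "\<dots> = real (\<Sum>n\<le>N. card (Q n))" by simp
    also have "(\<Sum>n\<le>N. card (Q n)) = (\<Sum>j<N. card (?Q j))"
      unfolding Q_def by (rule sum_card_swap)
    also have "real \<dots> = (\<Sum>j<N. real (card (?Q j)))"
      by simp
    also have "\<dots> \<le> (\<Sum>j<N. 4 / \<epsilon> * l j)"
    proof (rule sum_mono)
      fix j
      have "?Q j \<subseteq> {n. j < n \<and> real (n - j) < 4 / \<epsilon> * l j}"
      proof
        fix n assume "n \<in> ?Q j"
        then have n: "j < n" "a j < exp (- (\<epsilon> / 4) * real (n - j))" by auto
        have "ln (a j) < - (\<epsilon> / 4) * real (n - j)" using n(2) a(1)[of j] by (metis exp_less_cancel_iff exp_ln)
        then have "\<epsilon> / 4 * real (n - j) < l j" unfolding l_def by linarith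
        then have "real (n - j) < 4 / \<epsilon> * l j" using \<epsilon> by (simp add: field_simps)
        then show "n \<in> {n. j < n \<and> real (n - j) < 4 / \<epsilon> * l j}" using n by simp
      qed
      moreover have "0 \<le> 4 / \<epsilon> * l j" using \<epsilon> by (simp add: l_def)
      ultimately show "real (card (?Q j)) \<le> 4 / \<epsilon> * l j"
        using card_shadow_le[of "4 / \<epsilon> * l j" j] card_mono by (meson of_nat_le_iff order_trans)
    qed
    also have "\<dots> = 4 / \<epsilon> * (\<Sum>j<N. l j)" by (simp add: sum_distrib_left)
    also have "\<dots> \<le> 4 / \<epsilon> * (C1 * real N)" using suml[OF N(2)] \<epsilon> by (intro mult_left_mono) auto
    also have "\<dots> = (4 * C1 / (\<epsilon> * \<theta>)) * (\<theta> * real N)" using th by simp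
    also have "\<dots> \<le> real Nc * (\<theta> * real N)" using Nc th by (intro mult_right_mono) auto
    also have "\<dots> \<le> real Nc * real (card ?R')" using R' by (intro mult_left_mono) auto
    finally have "(real Nc + 1) * real (card ?R') \<le> real Nc * real (card ?R')" by (simp add: mult.commute)
    moreover have "0 < \<theta> * real N" using th N by simp
    ultimately show False using R' unfolding distrib_right by linarith
  qed
  show thesis
  proof (rule that[of Nc])
    show "\<exists>\<^sub>F n in sequentially. good_time d a \<epsilon> Nc n"
      unfolding frequently_sequentially
    proof
      fix m :: nat
      have "\<exists>\<^sub>F N in sequentially. (0 < N \<and> real m / \<theta> \<le> real N \<and> exp (- real N) \<le> slope d a 0 N) \<and>
          exp (\<epsilon> * real N) < slope d a 0 N"
      proof (rule frequently_eventually_conj[OF high])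
        show "\<forall>\<^sub>F N::nat in sequentially. 0 < N \<and> real m / \<theta> \<le> real N \<and> exp (- real N) \<le> slope d a 0 N"
          using eventually_gt_at_top[of 0] eventually_ge_at_top[of "nat \<lceil>real m / \<theta>\<rceil>"] low
          by eventually_elim (auto simp: nat_ceiling_le_eq)
      qed
      then obtain N where N: "0 < N" "real m / \<theta> \<le> real N" "exp (- real N) \<le> slope d a 0 N"
        "exp (\<epsilon> * real N) < slope d a 0 N"
        using frequently_ex by blast
      obtain n where n: "\<theta> * real N < real n" "good n" using step[OF N(1,3,4)] by blast
      have "m \<le> n" using N(2) n(1) th by (simp add: field_simps)
      moreover have "exp (\<epsilon> / 2 * real (n - k)) * slope d a 0 k \<le> slope d a 0 n" if "k \<le> n" for k
      proof -
        have "S k \<le> S n" using n(2) that unfolding good_def by (cases "k = n") (auto intro: less_imp_le)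
        then have "\<epsilon> / 2 * real (n - k) + ln (slope d a 0 k) \<le> ln (slope d a 0 n)"
        proof -
          have "\<epsilon> / 2 * real (n - k) = \<epsilon> / 2 * real n - \<epsilon> / 2 * real k"
            using that by (simp add: of_nat_diff right_diff_distrib)
          then show ?thesis using \<open>S k \<le> S n\<close> unfolding S_def by linarith
        qed
        then have "exp (\<epsilon> / 2 * real (n - k) + ln (slope d a 0 k)) \<le> exp (ln (slope d a 0 n))" by simp
        then show ?thesis using pos by (simp add: exp_add)
      qed
      ultimately show "\<exists>n\<ge>m. good_time d a \<epsilon> Nc n"
        using n(2) unfolding good_def good_time_def Q_def by blast
    qed
  qed
qed

text \<open>The lower bound \<alpha> on the radii combines \<open>c0\<close>, for the finitely many
  times before slow recurrence sets in, with an exponential for the rest. Of the allowance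
  \<epsilon>, one quarter pays for the powers of \<open>1 + \<eta>\<close>, one quarter for
  \<alpha>^d, and one half absorbs the constant \<open>c1\<close>.\<close>

lemma slope_lower_exponent:
  fixes a :: "nat \<Rightarrow> real"
  assumes d: "2 \<le> d" and nc: "noncontracting d B p a" and a: "\<And>j. 0 < a j"
    and slow: "\<And>\<epsilon>. 0 < \<epsilon> \<Longrightarrow> \<forall>\<^sub>F k in sequentially. exp (- \<epsilon> * real k) \<le> a k" and \<epsilon>: "0 < \<epsilon>"
  shows "\<forall>\<^sub>F n in sequentially. exp (- \<epsilon> * real n) \<le> slope d a 0 n"
proof -
  have B: "0 \<le> B" using a[of 0] noncontractingD(2)[OF nc, of 0] by linarith
  obtain \<eta> :: real where eta: "0 < \<eta>" "\<eta> \<le> 1" "(1 + \<eta>) ^ (d + 1) \<le> exp (\<epsilon> / 4)"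
    using exists_small_rate[of "exp (\<epsilon> / 4)" 2 "d + 1" 0] \<epsilon> by auto
  obtain C \<delta> where bound: "slope_bound d B \<eta> C \<delta>"
    using slope_lower_bound[OF d B eta(1,2)] by blast
  note C = slope_bound_pos[OF bound]
  define e where "e = \<epsilon> / (4 * real d)"
  have e: "0 < e" using \<epsilon> d by (simp add: e_def)
  obtain k0 where k0: "\<And>k. k0 \<le> k \<Longrightarrow> exp (- e * real k) \<le> a k"
    using slow[OF e] unfolding eventually_sequentially by blast
  define c0 where "c0 = Min (insert \<delta> (a ` {..<k0}))"
  have c0: "0 < c0" "c0 \<le> \<delta>" "\<And>j. j < k0 \<Longrightarrow> c0 \<le> a j"
    unfolding c0_def using a C by (auto simp: Min_gr_iff)
  define c1 where "c1 = C * c0 ^ d / \<delta>"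
  have c1: "0 < c1" unfolding c1_def using C c0 by simp
  have "\<forall>\<^sub>F n::nat in sequentially. exp (- (\<epsilon> / 2) * real n) \<le> c1"
    using order_tendstoD(2)[OF tendsto_exp_neg_linear[of "\<epsilon> / 2" 1] c1] \<epsilon> by (auto elim: eventually_mono)
  then show ?thesis
  proof eventually_elim
    case (elim n)
    let ?x = "exp (- (\<epsilon> / 4) * real n)" and ?y = "exp (- (\<epsilon> / 2) * real n)"
    define \<alpha> where "\<alpha> = c0 * exp (- e * real n)"
    have exp1: "exp (- e * real n) \<le> 1" using e by simp
    have al: "0 < \<alpha>" "\<alpha> \<le> c0" unfolding \<alpha>_def using c0 exp1 by (auto intro: mult_left_le)
    have le: "\<alpha> \<le> a j" if "j \<le> n" for j
    proof (cases "j < k0")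
      case True
      then show ?thesis using c0(3)[OF True] al by linarith
    next
      case False
      have "\<alpha> \<le> 1 * exp (- e * real n)" unfolding \<alpha>_def using c0 C by (intro mult_right_mono) auto
      also have "\<dots> \<le> exp (- e * real j)" using that e by simp
      also have "\<dots> \<le> a j" using False k0 by simp
      finally show ?thesis .
    qed
    have sl: "0 \<le> slope d a 0 n" using a by (intro slope_nonneg less_imp_le)
    have "C * \<alpha> ^ d \<le> (1 + \<eta>) ^ ((d + 1) * (n - 0)) * (min \<delta> (a 0) * slope d a 0 (n - 0)) * min \<delta> (a n) ^ (d - 1)"
      using al c0 le by (intro slope_boundD[OF bound nc]) auto
    also have "\<dots> \<le> exp (\<epsilon> / 4 * real n) * (\<delta> * slope d a 0 n) * 1"
    proof (intro mult_mono)
      have "(1 + \<eta>) ^ ((d + 1) * (n - 0)) \<le> exp (\<epsilon> / 4) ^ n"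
        unfolding power_mult using eta by (simp add: power_mono)
      also have "\<dots> = exp (\<epsilon> / 4 * real n)" by (simp add: exp_of_nat_mult[symmetric] mult.commute)
      finally show "(1 + \<eta>) ^ ((d + 1) * (n - 0)) \<le> exp (\<epsilon> / 4 * real n)" .
      show "min \<delta> (a n) ^ (d - 1) \<le> 1" using C a[of n] by (intro power_le_one) auto
    qed (use C sl a[of 0] a[of n] in auto)
    finally have "C * \<alpha> ^ d \<le> exp (\<epsilon> / 4 * real n) * (\<delta> * slope d a 0 n)" by simp
    also have "\<alpha> ^ d = c0 ^ d * ?x"
    proof -
      have "exp (- e * real n) ^ d = exp (real d * (- e * real n))" by (rule exp_of_nat_mult[symmetric])
      also have "real d * (- e * real n) = - (\<epsilon> / 4) * real n" using d by (simp add: e_def)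
      finally show ?thesis by (simp add: \<alpha>_def power_mult_distrib)
    qed
    finally have "?x * (C * (c0 ^ d * ?x))
        \<le> ?x * (exp (\<epsilon> / 4 * real n) * (\<delta> * slope d a 0 n))"
      by (intro mult_left_mono) auto
    also have "\<dots> = \<delta> * slope d a 0 n" by (simp flip: mult.assoc exp_add)
    also have "?x * (C * (c0 ^ d * ?x))
        = C * c0 ^ d * (?x * ?x)" by simp
    also have "?x * ?x = ?y"
      by (simp flip: exp_add)
    finally have "c1 * ?y \<le> slope d a 0 n"
      unfolding c1_def using C by (simp add: field_simps)
    moreover have "?y * ?y \<le> c1 * ?y"
      using elim by (intro mult_right_mono) auto
    moreover have "?y * ?y = exp (- \<epsilon> * real n)"
      by (simp flip: exp_add)
    ultimately show ?case by linarith
  qed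
qed

section \<open>Discs covered by the images of discs\<close>

lemma power_image_ball_general:
  fixes y :: complex
  assumes "0 < d" "0 \<le> r"
  shows "ball (y ^ d) (r ^ d) \<subseteq> (\<lambda>x. x ^ d) ` ball y r"
proof
  fix v assume "v \<in> ball (y ^ d) (r ^ d)"
  then have "norm (y ^ d - v) < r ^ d" by (simp add: dist_norm)
  then obtain x where "x ^ d = v" "norm (y - x) < r" using near_root assms by metis
  then show "v \<in> (\<lambda>x. x ^ d) ` ball y r" by (auto simp: dist_norm)
qed

text \<open>A disc of radius at most \<open>small_ratio d\<close> times the distance of its centre to the critical
  point is mapped almost linearly.\<close>

definition small_ratio :: "nat \<Rightarrow> real" where
  "small_ratio d = (1 / (4 * real d)) ^ d / real d"

lemma small_ratio:
  assumes "2 \<le> d"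
  shows "0 < small_ratio d" "8 * real d * small_ratio d \<le> 1"
proof -
  show "0 < small_ratio d" unfolding small_ratio_def using assms by simp
  have "(1 / (4 * real d)) ^ d \<le> (1 / (4 * real d)) ^ 1"
    using assms by (intro power_decreasing) auto
  also have "\<dots> \<le> 1 / 8" using assms by (simp add: field_simps)
  finally show "8 * real d * small_ratio d \<le> 1" unfolding small_ratio_def using assms by simp
qed

text \<open>The crude bound for a nearby root is bootstrapped: it puts the root into the region where
  the power map is almost linear, first with factor \<open>2/3\<close> and then with the factor claimed.\<close>

lemma power_image_ball_linear:
  fixes y :: complex
  assumes d: "2 \<le> d" and u: "0 \<le> u" "u \<le> small_ratio d" and r: "0 \<le> r" "r \<le> u * norm y" and y: "y \<noteq> 0"
  shows "ball (y ^ d) (r * (real d * norm y ^ (d - 1)) * (2 - (1 + 2 * u) ^ (d - 1))) \<subseteq> (\<lambda>x. x ^ d) ` ball y r"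
proof
  let ?l = "real d * norm y ^ (d - 1)" and ?P = "\<lambda>u. (1 + u) ^ (d - 1) :: real"
  fix v assume v: "v \<in> ball (y ^ d) (r * ?l * (2 - ?P (2 * u)))"
  have l: "0 < ?l" using d y by simp
  have du: "8 * real d * u \<le> 1"
  proof -
    have "8 * real d * u \<le> 8 * real d * small_ratio d" using u by (intro mult_left_mono) auto
    then show ?thesis using small_ratio(2)[OF d] by linarith
  qed
  have P: "?P (2 * u) \<le> 4 / 3" using u du d by (intro power_one_plus_le_four_thirds) auto
  have P1: "1 \<le> ?P (2 * u)" using u by (intro one_le_power) auto
  have vn: "norm (y ^ d - v) < r * ?l * (2 - ?P (2 * u))" using v by (simp add: dist_norm)
  also have "\<dots> \<le> r * ?l * 1" using P1 r l by (intro mult_left_mono) auto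
  finally have v1: "norm (y ^ d - v) < r * ?l" by simp
  also have "r * ?l \<le> (u * norm y) * ?l" using r l by (intro mult_right_mono) auto
  also have "\<dots> = real d * u * norm y ^ d" using d by (cases d) auto
  also have "\<dots> \<le> real d * small_ratio d * norm y ^ d" using u by (intro mult_right_mono mult_left_mono) auto
  \<comment> \<open>The value of \<open>small_ratio d\<close> is made for this identity: it puts the
    crude root within |y| / (4 d) of \<open>y\<close>, where the power map is almost linear.\<close>
  also have "\<dots> = (norm y / (4 * real d)) ^ d" using d by (simp add: small_ratio_def power_divide power_mult_distrib)
  finally obtain x where x: "x ^ d = v" "norm (y - x) < norm y / (4 * real d)"
    using near_root[of d y v "norm y / (4 * real d)"] d by auto
  have step: "norm (y - x) * ?l * (2 - ?P w) \<le> norm (y ^ d - v)"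
    if "0 \<le> w" "norm (y - x) \<le> w * norm y" for w
    using norm_power_diff_ge[of y y "norm (y - x)" x w d] that x(1) by (simp add: norm_minus_commute)
  have "norm (y - x) * ?l * (2 - ?P (1 / (4 * real d))) \<le> norm (y ^ d - v)"
    using x(2) d by (intro step) auto
  moreover have "?P (1 / (4 * real d)) \<le> 4 / 3" using d by (intro power_one_plus_le_four_thirds) auto
  then have "norm (y - x) * ?l * (2 / 3) \<le> norm (y - x) * ?l * (2 - ?P (1 / (4 * real d)))"
    using l by (intro mult_left_mono) auto
  ultimately have "norm (y - x) * ?l * (2 / 3) \<le> r * ?l" using v1 by linarith
  then have "?l * (norm (y - x) * (2 / 3)) \<le> ?l * r" by (simp add: mult_ac)
  then have "norm (y - x) * (2 / 3) \<le> r" using l by (simp only: mult_le_cancel_left_pos)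
  then have "norm (y - x) \<le> 2 * u * norm y" using r by linarith
  then have "norm (y - x) * ?l * (2 - ?P (2 * u)) \<le> norm (y ^ d - v)"
    using u by (intro step) auto
  with vn have "(?l * (2 - ?P (2 * u))) * norm (y - x) < (?l * (2 - ?P (2 * u))) * r"
    by (simp add: mult_ac)
  moreover have "0 < ?l * (2 - ?P (2 * u))" using l P by simp
  ultimately have "norm (y - x) < r" by (simp only: mult_less_cancel_left_pos)
  then show "v \<in> (\<lambda>x. x ^ d) ` ball y r" using x(1) by (auto simp: dist_norm)
qed

text \<open>Passing from \<open>T\<close> to \<open>T / q\<close> costs at most q^d in
  \<open>incr\<close>. A relatively small disc is then treated almost linearly; otherwise |y| is at
  most a constant times the radius \<open>r\<close>, and \<open>incr\<close> is at most a constant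
  times r^d, the radius that root extraction covers.\<close>

lemma image_step_general:
  fixes y :: complex
  assumes d: "2 \<le> d" and t: "0 < T" and lam: "1 \<le> q"
  shows "ball (y ^ d) (incr d (norm y) T / ((1 + 1 / small_ratio d) ^ d * q ^ d)) \<subseteq> (\<lambda>x. x ^ d) ` ball y (T / q)"
proof -
  define u where "u = small_ratio d"
  define r where "r = T / q"
  have u: "0 < u" "8 * real d * u \<le> 1" unfolding u_def using small_ratio[OF d] by auto
  have s: "0 < r" unfolding r_def using t lam by simp
  have "T = q * r" unfolding r_def using lam by simp
  then have up: "incr d (norm y) T \<le> q ^ d * incr d (norm y) r"
    using incr_scale_up[of "norm y" r q d] s lam d by simp
  have "real d * u \<le> 1" using u by linarith
  then have "u \<le> 1" using d u mult_right_mono[of 1 "real d" u] by linarith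
  then have big: "2 \<le> 1 + 1 / u" using u by simp
  have C: "2 \<le> (1 + 1 / u) ^ d"
  proof -
    have "(1 + 1 / u) ^ 1 \<le> (1 + 1 / u) ^ d"
    proof (rule power_increasing)
      show "1 \<le> 1 + 1 / u" using big by linarith
    qed (use d in simp)
    then show ?thesis using big by simp
  qed
  show ?thesis
  proof (cases "r \<le> u * norm y")
    case True
    then have y: "y \<noteq> 0" using s by auto
    let ?l = "real d * norm y ^ (d - 1)"
    have l: "0 < ?l" using d y by simp
    have P: "(1 + 2 * u) ^ (d - 1) \<le> 4 / 3" "(1 + u) ^ (d - 1) \<le> 4 / 3"
      using power_one_plus_le_four_thirds[OF d, of "2 * u"] power_one_plus_le_four_thirds[OF d, of u]
        u mult_nonneg_nonneg[of "real d" u] by linarith+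
    have "incr d (norm y) r \<le> (1 + u) ^ (d - 1) * ?l * r"
      using True s by (intro incr_le_linear_small) auto
    also have "\<dots> \<le> 4 / 3 * ?l * r" using P l s by (intro mult_right_mono) auto
    finally have "incr d (norm y) r \<le> 4 / 3 * ?l * r" .
    then have "q ^ d * incr d (norm y) r \<le> q ^ d * (4 / 3 * ?l * r)"
      using lam by (intro mult_left_mono) auto
    with up have "incr d (norm y) T \<le> q ^ d * (4 / 3 * ?l * r)" by linarith
    also have "\<dots> = q ^ d * 2 * (r * ?l * (2 / 3))" by simp
    also have "\<dots> \<le> q ^ d * (1 + 1 / u) ^ d * (r * ?l * (2 - (1 + 2 * u) ^ (d - 1)))"
      using C P lam s l by (intro mult_mono) auto
    finally have "incr d (norm y) T / ((1 + 1 / u) ^ d * q ^ d) \<le> r * ?l * (2 - (1 + 2 * u) ^ (d - 1))"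
      using lam C by (simp add: divide_le_eq mult_ac)
    then have "ball (y ^ d) (incr d (norm y) T / ((1 + 1 / u) ^ d * q ^ d))
        \<subseteq> ball (y ^ d) (r * ?l * (2 - (1 + 2 * u) ^ (d - 1)))" by (rule subset_ball)
    also have "\<dots> \<subseteq> (\<lambda>x. x ^ d) ` ball y r"
      using d u s True y by (intro power_image_ball_linear) (auto simp: u_def)
    finally show ?thesis by (simp add: u_def r_def)
  next
    case False
    then have ny: "norm y \<le> r / u" using u by (simp add: field_simps)
    have "incr d (norm y) r \<le> (norm y + r) ^ d" by (rule incr_le_power) simp
    also have "\<dots> \<le> ((1 + 1 / u) * r) ^ d"
      using ny s by (intro power_mono) (auto simp: algebra_simps)
    finally have "q ^ d * incr d (norm y) r \<le> q ^ d * ((1 + 1 / u) * r) ^ d"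
      using lam by (intro mult_left_mono) auto
    with up have "incr d (norm y) T \<le> q ^ d * ((1 + 1 / u) ^ d * r ^ d)"
      unfolding power_mult_distrib by linarith
    then have "incr d (norm y) T / ((1 + 1 / u) ^ d * q ^ d) \<le> r ^ d"
      using lam C by (simp add: divide_le_eq mult_ac)
    then have "ball (y ^ d) (incr d (norm y) T / ((1 + 1 / u) ^ d * q ^ d)) \<subseteq> ball (y ^ d) (r ^ d)"
      by (rule subset_ball)
    also have "\<dots> \<subseteq> (\<lambda>x. x ^ d) ` ball y r" using d s by (intro power_image_ball_general) auto
    finally show ?thesis by (simp add: u_def r_def)
  qed
qed

text \<open>A constant loss per step would be fatal, since the number of these steps is unbounded.
  The loss has to be 1 + O(u), so that it stays bounded in total when the relative sizes are
  summable.\<close>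

lemma image_step_linear:
  fixes y :: complex
  assumes d: "2 \<le> d" and t: "0 < T" "T \<le> u * norm y" and lam: "1 \<le> q" and u: "0 \<le> u" "u \<le> small_ratio d"
  shows "ball (y ^ d) (incr d (norm y) T / (exp (8 * real d * u) * q)) \<subseteq> (\<lambda>x. x ^ d) ` ball y (T / q)"
proof -
  let ?l = "real d * norm y ^ (d - 1)"
  have y: "y \<noteq> 0" using t by auto
  have l: "0 < ?l" using d y by simp
  have "8 * real d * u \<le> 8 * real d * small_ratio d" using u by (intro mult_left_mono) auto
  then have du: "8 * (real d * u) \<le> 1" using small_ratio(2)[OF d] by linarith
  define w where "w = real d * u"
  have w: "0 \<le> w" "8 * w \<le> 1" using du u by (auto simp: w_def)
  have dle: "real (d - 1) * u \<le> w" "real (d - 1) * (2 * u) \<le> 2 * w"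
    unfolding w_def using u by (auto intro!: mult_right_mono)
  have P1: "(1 + u) ^ (d - 1) \<le> 1 / (1 - w)"
  proof -
    have "(1 + u) ^ (d - 1) \<le> 1 / (1 - real (d - 1) * u)" using u dle w by (intro power_one_plus_le) auto
    also have "\<dots> \<le> 1 / (1 - w)" using dle w by (intro divide_left_mono) auto
    finally show ?thesis .
  qed
  have P2: "(1 + 2 * u) ^ (d - 1) \<le> 1 / (1 - 2 * w)"
  proof -
    have "(1 + 2 * u) ^ (d - 1) \<le> 1 / (1 - real (d - 1) * (2 * u))" using u dle w by (intro power_one_plus_le) auto
    also have "\<dots> \<le> 1 / (1 - 2 * w)" using dle w by (intro divide_left_mono) auto
    finally show ?thesis .
  qed
  \<comment> \<open>After 1 + 8 w replaces the exponential, clearing denominators leaves a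
    polynomial inequality that holds for w up to 1/8, the range provided by
    \<open>small_ratio\<close>.\<close>
  have "1 / (1 - w) \<le> exp (8 * w) * (2 - 1 / (1 - 2 * w))"
  proof -
    have "0 \<le> w * (5 - 36 * w + 32 * w\<^sup>2)"
    proof -
      have "0 \<le> 5 - 36 * w + 32 * w\<^sup>2" using w zero_le_power2[of w] by linarith
      then show ?thesis using w by simp
    qed
    then have "1 - 2 * w \<le> (1 + 8 * w) * (1 - 4 * w) * (1 - w)"
      by (simp add: algebra_simps power2_eq_square power3_eq_cube)
    then have "1 / (1 - w) \<le> (1 + 8 * w) * ((1 - 4 * w) / (1 - 2 * w))"
      using w by (simp add: field_simps)
    also have "(1 - 4 * w) / (1 - 2 * w) = 2 - 1 / (1 - 2 * w)" using w by (simp add: field_simps)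
    also have "(1 + 8 * w) * (2 - 1 / (1 - 2 * w)) \<le> exp (8 * w) * (2 - 1 / (1 - 2 * w))"
    proof (rule mult_right_mono)
      show "1 + 8 * w \<le> exp (8 * w)" by (rule exp_ge_add_one_self)
      show "0 \<le> 2 - 1 / (1 - 2 * w)" using w by (simp add: field_simps)
    qed
    finally show ?thesis .
  qed
  also have "\<dots> \<le> exp (8 * w) * (2 - (1 + 2 * u) ^ (d - 1))" using P2 by (intro mult_left_mono) auto
  finally have key: "(1 + u) ^ (d - 1) \<le> exp (8 * w) * (2 - (1 + 2 * u) ^ (d - 1))" using P1 by linarith
  have "incr d (norm y) T \<le> (1 + u) ^ (d - 1) * ?l * T"
    using t by (intro incr_le_linear_small) auto
  also have "\<dots> \<le> (exp (8 * w) * (2 - (1 + 2 * u) ^ (d - 1))) * ?l * T"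
    using key l t by (intro mult_right_mono) auto
  finally have "incr d (norm y) T / (exp (8 * w) * q) \<le> T / q * ?l * (2 - (1 + 2 * u) ^ (d - 1))"
    using lam by (simp add: field_simps)
  then have "ball (y ^ d) (incr d (norm y) T / (exp (8 * w) * q))
      \<subseteq> ball (y ^ d) (T / q * ?l * (2 - (1 + 2 * u) ^ (d - 1)))" by (rule subset_ball)
  also have "\<dots> \<subseteq> (\<lambda>x. x ^ d) ` ball y (T / q)"
  proof (rule power_image_ball_linear[OF d u _ _ y])
    have "T / q \<le> T" using t lam by (simp add: divide_le_eq_1 field_simps mult_le_cancel_right1)
    then show "T / q \<le> u * norm y" using t by linarith
  qed (use t lam in auto)
  finally show ?thesis by (simp add: w_def mult.assoc)
qed

text \<open>The displacement of the inner centre and the majorant of the inner disc add up within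
  the majorant of the outer disc: the inner orbit point has modulus at most the outer one plus the
  displacement, and \<open>incr_shift\<close> merges the two increments.\<close>

lemma orbit_dist_add_spread_le:
  assumes "dist x z \<le> r1" "0 \<le> r2"
  shows "dist (orbit d c x j) (orbit d c z j) + spread d (radii d c x) 0 j r2 \<le> spread d (radii d c z) 0 j (r1 + r2)"
proof (induction j)
  case (Suc j)
  let ?X = "dist (orbit d c x j) (orbit d c z j)" and ?R = "spread d (radii d c x) 0 j r2"
  have R: "0 \<le> ?R" using assms by (intro spread_nonneg) auto
  have "norm (orbit d c x j) \<le> radii d c z j + ?X"
    using norm_triangle_sub[of "orbit d c x j" "orbit d c z j"] by (simp add: dist_norm)
  then have "incr d (radii d c x j) ?R \<le> incr d (radii d c z j + ?X) ?R"
    using R by (intro incr_mono) auto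
  moreover have "dist (orbit d c x (Suc j)) (orbit d c z (Suc j)) \<le> incr d (radii d c z j) ?X"
    by (simp add: unicrit_dist_le)
  ultimately have "dist (orbit d c x (Suc j)) (orbit d c z (Suc j)) + spread d (radii d c x) 0 (Suc j) r2
      \<le> incr d (radii d c z j) (?X + ?R)" by (simp add: incr_shift)
  also have "\<dots> \<le> incr d (radii d c z j) (spread d (radii d c z) 0 j (r1 + r2))"
    using Suc R by (intro incr_mono) auto
  finally show ?case by simp
qed (use assms in auto)

lemma sum_exp_decay_le:
  fixes \<beta> :: real
  assumes "0 < \<beta>"
  shows "(\<Sum>i<n. exp (- \<beta> * real (n - i))) \<le> 1 / \<beta>"
proof (induction n)
  case (Suc n)
  have "(\<Sum>i<Suc n. exp (- \<beta> * real (Suc n - i))) = (\<Sum>i<n. exp (- \<beta> * real (Suc n - i))) + exp (- \<beta>)"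
    by simp
  also have "(\<Sum>i<n. exp (- \<beta> * real (Suc n - i))) = exp (- \<beta>) * (\<Sum>i<n. exp (- \<beta> * real (n - i)))"
    unfolding sum_distrib_left
  proof (intro sum.cong refl)
    fix i assume "i \<in> {..<n}"
    then have "real (Suc n - i) = real (n - i) + 1" by auto
    then show "exp (- \<beta> * real (Suc n - i)) = exp (- \<beta>) * exp (- \<beta> * real (n - i))"
      by (simp add: algebra_simps flip: exp_add)
  qed
  also have "\<dots> + exp (- \<beta>) \<le> exp (- \<beta>) * (1 / \<beta>) + exp (- \<beta>)"
    using Suc by (intro add_right_mono mult_left_mono) auto
  also have "\<dots> = exp (- \<beta>) * (1 + \<beta>) / \<beta>" using assms by (simp add: field_simps)
  also have "\<dots> \<le> exp (- \<beta>) * exp \<beta> / \<beta>"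
    using assms exp_ge_add_one_self[of \<beta>] by (intro divide_right_mono mult_left_mono) auto
  also have "\<dots> = 1 / \<beta>" by (simp flip: exp_add)
  finally show ?case .
qed (use assms in simp)

text \<open>The disc known to be covered at time \<open>j\<close> is the majorant disc divided by
  \<open>q j\<close>. Since \<open>T\<close> decays towards the past at rate 2 \<beta> while close
  visits are defined by rate \<beta>, the relative sizes at the other times are at most
  \<open>u j\<close>, which are summable; only a close visit raises \<open>q\<close> to the power
  \<open>d\<close>.\<close>

lemma image_contains_ball:
  fixes d n Nc :: nat and c z :: complex and t \<beta> \<delta> :: real
  defines "T \<equiv> \<lambda>j. spread d (radii d c z) 0 j t"
  defines "P \<equiv> (1 + 1 / small_ratio d) ^ d"
  assumes d: "2 \<le> d" and pos: "0 < t" "0 < \<beta>" "0 < \<delta>" "\<delta> \<le> small_ratio d"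
    and hyp: "\<And>j. j \<le> n \<Longrightarrow> T j \<le> \<delta> * exp (- (2 * \<beta>) * real (n - j))"
    and Nc: "card {j. j < n \<and> radii d c z j < exp (- \<beta> * real (n - j))} \<le> Nc"
  shows "ball (orbit d c z n) (T n / (P * exp (8 * real d * \<delta> / \<beta>)) ^ ((2 * d) ^ Nc))
    \<subseteq> (\<lambda>w. orbit d c w n) ` ball z (t / 2)"
proof -
  define u where "u j = \<delta> * exp (- \<beta> * real (n - j))" for j
  define L where "L j = exp (\<Sum>i<j. 8 * real d * u i)" for j
  define close where "close i \<longleftrightarrow> radii d c z i < exp (- \<beta> * real (n - i))" for i
  define M where "M j = card {i. i < j \<and> close i}" for j
  \<comment> \<open>The base \<open>2 * d\<close> instead of \<open>d\<close> absorbs the extra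
    factor \<open>P\<close> at each visit, by \<open>e * d + 1 \<le> 2 * d * e\<close>. At time 0
    the divisor is \<open>P\<close>, which is at least 2; this is the origin of
    \<open>t / 2\<close>.\<close>
  define q where "q j = (P * L j) ^ ((2 * d) ^ M j)" for j
  have u: "0 \<le> u j" "u j \<le> small_ratio d" for j
  proof -
    show "0 \<le> u j" using pos by (simp add: u_def)
    have "u j \<le> \<delta> * 1" unfolding u_def using pos by (intro mult_left_mono) auto
    then show "u j \<le> small_ratio d" using pos by simp
  qed
  have L1: "1 \<le> L j" for j unfolding L_def using u by (simp add: sum_nonneg)
  have sr: "0 < small_ratio d" "8 * real d * small_ratio d \<le> 1" using small_ratio[OF d] by auto
  have "1 * small_ratio d \<le> 8 * real d * small_ratio d" using sr d by (intro mult_right_mono) auto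
  then have "small_ratio d \<le> 1" using sr by linarith
  then have two: "2 \<le> 1 + 1 / small_ratio d" using sr by simp
  have P2: "2 \<le> P"
  proof -
    have "(1 + 1 / small_ratio d) ^ 1 \<le> P" unfolding P_def
    proof (rule power_increasing)
      show "1 \<le> 1 + 1 / small_ratio d" using two by linarith
    qed (use d in simp)
    then show ?thesis using two by simp
  qed
  have PL: "2 \<le> P * L j" for j
    using P2 L1[of j] mult_mono[of 2 P 1 "L j"] by simp
  have q1: "1 \<le> q j" for j unfolding q_def using PL[of j] by (intro one_le_power) linarith
  have tau: "0 < T j" for j unfolding T_def using pos d by (intro spread_pos) auto
  have step: "ball (orbit d c z (Suc j)) (T (Suc j) / q (Suc j)) \<subseteq> unicrit d c ` ball (orbit d c z j) (T j / q j)"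
    if j: "j < n" for j
  proof -
    let ?y = "orbit d c z j"
    let ?i = "incr d (norm ?y) (T j)"
    have tS: "T (Suc j) = ?i" by (simp add: T_def)
    have LS: "L (Suc j) = L j * exp (8 * real d * u j)" by (simp add: L_def exp_add)
    have "ball (?y ^ d) (?i / q (Suc j)) \<subseteq> (\<lambda>x. x ^ d) ` ball ?y (T j / q j)"
    proof (cases "close j")
      case True
      then have "{i. i < Suc j \<and> close i}
          = insert j {i. i < j \<and> close i}" by auto
      then have M: "M (Suc j) = Suc (M j)" by (simp add: M_def)
      define e where "e = (2 * d) ^ M j"
      have e: "1 \<le> e" unfolding e_def using d by simp
      then have "1 \<le> e * d" using d by (metis mult_le_mono nat_mult_1 one_le_numeral order_trans)
      then have ed: "Suc (e * d) \<le> 2 * d * e" by (simp add: mult_ac)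
      have "P * q j ^ d = P * (P * L j) ^ (e * d)" by (simp add: q_def e_def power_mult)
      also have "\<dots> \<le> (P * L j) * (P * L j) ^ (e * d)"
        using P2 L1[of j] PL[of j] by (intro mult_right_mono) (auto simp: mult_le_cancel_left1)
      also have "\<dots> = (P * L j) ^ Suc (e * d)" by simp
      also have "\<dots> \<le> (P * L j) ^ (2 * d * e)"
        using ed PL[of j] by (intro power_increasing) auto
      also have "\<dots> \<le> (P * L (Suc j)) ^ (2 * d * e)"
        unfolding LS using P2 L1[of j] u(1)[of j] by (intro power_mono mult_left_mono) (auto simp: mult_le_cancel_left1)
      also have "\<dots> = q (Suc j)" by (simp add: q_def M e_def)
      finally have "?i / q (Suc j) \<le> ?i / (P * q j ^ d)"
        using tau[of "Suc j"] P2 q1[of j] q1[of "Suc j"] unfolding tS by (intro divide_left_mono) auto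
      then have "ball (?y ^ d) (?i / q (Suc j)) \<subseteq> ball (?y ^ d) (?i / (P * q j ^ d))"
        by (rule subset_ball)
      also have "\<dots> \<subseteq> (\<lambda>x. x ^ d) ` ball ?y (T j / q j)"
        unfolding P_def using d tau q1 by (intro image_step_general) auto
      finally show ?thesis .
    next
      case False
      then have "{i. i < Suc j \<and> close i}
          = {i. i < j \<and> close i}" by (auto simp: less_Suc_eq)
      then have M: "M (Suc j) = M j" by (simp add: M_def)
      define e where "e = (2 * d) ^ M j"
      have e: "1 \<le> e" unfolding e_def using d by simp
      have "T j \<le> \<delta> * exp (- (2 * \<beta>) * real (n - j))" using hyp j by simp
      also have "\<dots> = u j * exp (- \<beta> * real (n - j))" by (simp add: u_def flip: exp_add)
      also have "\<dots> \<le> u j * norm ?y" using False u unfolding close_def by (intro mult_left_mono) auto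
      finally have small: "T j \<le> u j * norm ?y" .
      define s where "s = exp (8 * real d * u j)"
      have s: "1 \<le> s" unfolding s_def using u by simp
      have "s * q j \<le> s ^ e * q j"
        using s e q1[of j] power_increasing[of 1 e s] by (intro mult_right_mono) auto
      also have "\<dots> = q (Suc j)" by (simp add: q_def M LS e_def s_def power_mult_distrib mult_ac)
      finally have "?i / q (Suc j) \<le> ?i / (s * q j)"
        using tau[of "Suc j"] s q1[of j] q1[of "Suc j"] unfolding tS by (intro divide_left_mono) auto
      then have "ball (?y ^ d) (?i / q (Suc j)) \<subseteq> ball (?y ^ d) (?i / (s * q j))"
        by (rule subset_ball)
      also have "\<dots> \<subseteq> (\<lambda>x. x ^ d) ` ball ?y (T j / q j)"
        unfolding s_def using d tau q1 small u by (intro image_step_linear) auto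
      finally show ?thesis .
    qed
    then have inc: "ball (?y ^ d) (T (Suc j) / q (Suc j)) \<subseteq> (\<lambda>x. x ^ d) ` ball ?y (T j / q j)" by (simp add: tS)
    show ?thesis
    proof
      fix v assume "v \<in> ball (orbit d c z (Suc j)) (T (Suc j) / q (Suc j))"
      then have "v - c \<in> ball (?y ^ d) (T (Suc j) / q (Suc j))"
        by (simp add: unicrit_def dist_norm algebra_simps)
      then obtain x where "x \<in> ball ?y (T j / q j)" "v - c = x ^ d" using inc by blast
      then show "v \<in> unicrit d c ` ball ?y (T j / q j)"
        by (intro image_eqI[of _ _ x]) (auto simp: unicrit_def algebra_simps)
    qed
  qed
  have "ball (orbit d c z j) (T j / q j) \<subseteq> (\<lambda>w. orbit d c w j) ` ball z (t / 2)" if "j \<le> n" for j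
    using that
  proof (induction j)
    case 0
    have "2 ^ 1 \<le> q 0" using PL[of 0] by (simp add: q_def M_def)
    then have "t / q 0 \<le> t / 2" using pos by (intro divide_left_mono) auto
    then show ?case using subset_ball[of "t / q 0" "t / 2" z] by (simp add: T_def)
  next
    case (Suc j)
    have "ball (orbit d c z (Suc j)) (T (Suc j) / q (Suc j)) \<subseteq> unicrit d c ` ball (orbit d c z j) (T j / q j)"
      using Suc.prems by (intro step) simp
    also have "\<dots> \<subseteq> unicrit d c ` (\<lambda>w. orbit d c w j) ` ball z (t / 2)"
      using Suc by (intro image_mono) auto
    also have "\<dots> = (\<lambda>w. orbit d c w (Suc j)) ` ball z (t / 2)" by (simp add: image_image)
    finally show ?case .
  qed
  then have "ball (orbit d c z n) (T n / q n) \<subseteq> (\<lambda>w. orbit d c w n) ` ball z (t / 2)" by simp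
  moreover have "q n \<le> (P * exp (8 * real d * \<delta> / \<beta>)) ^ ((2 * d) ^ Nc)"
  proof -
    have "(\<Sum>i<n. 8 * real d * u i) = 8 * real d * \<delta> * (\<Sum>i<n. exp (- \<beta> * real (n - i)))"
      by (simp add: u_def sum_distrib_left mult_ac)
    also have "\<dots> \<le> 8 * real d * \<delta> * (1 / \<beta>)"
      using pos by (intro mult_left_mono sum_exp_decay_le) auto
    finally have "L n \<le> exp (8 * real d * \<delta> / \<beta>)" by (simp add: L_def)
    then have PLn: "P * L n \<le> P * exp (8 * real d * \<delta> / \<beta>)" using P2 by (intro mult_left_mono) auto
    have "q n \<le> (P * exp (8 * real d * \<delta> / \<beta>)) ^ ((2 * d) ^ M n)"
      unfolding q_def using PLn PL[of n] by (intro power_mono) auto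
    also have "\<dots> \<le> (P * exp (8 * real d * \<delta> / \<beta>)) ^ ((2 * d) ^ Nc)"
      using Nc d PLn PL[of n] unfolding M_def close_def by (intro power_increasing) auto
    finally show ?thesis .
  qed
  then have "T n / (P * exp (8 * real d * \<delta> / \<beta>)) ^ ((2 * d) ^ Nc) \<le> T n / q n"
    using tau[of n] q1[of n] by (intro divide_left_mono mult_pos_pos) auto
  ultimately show ?thesis using subset_ball by blast
qed

section \<open>Porosity from a positive upper exponent\<close>

lemma uniform_holes:
  fixes J :: "complex set"
  assumes J: "closed J" "interior J = {}" and e: "0 < e"
  obtains \<kappa> where "0 < \<kappa>" "\<And>w. w \<in> cball 0 B \<Longrightarrow> \<exists>y. ball y \<kappa> \<subseteq> ball w e - J"
proof -
  have "\<exists>y r. 0 < r \<and> ball y r \<subseteq> ball w (e / 2) - J" for w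
  proof -
    have "\<not> ball w (e / 2) \<subseteq> J"
      using J(2) e interior_maximal[of "ball w (e / 2)" J] by auto
    then obtain y where "y \<in> ball w (e / 2) - J" by blast
    moreover have "open (ball w (e / 2) - J)" using J by auto
    ultimately show ?thesis by (meson open_contains_ball)
  qed
  then obtain y r where yr: "\<And>w. 0 < r w" "\<And>w. ball (y w) (r w) \<subseteq> ball w (e / 2) - J" by metis
  have "cball (0::complex) B \<subseteq> (\<Union>w\<in>UNIV. ball w (e / 2))"
  proof
    fix x :: complex
    show "x \<in> (\<Union>w\<in>UNIV. ball w (e / 2))" using e by (intro UN_I[of x]) auto
  qed
  then obtain F :: "complex set" where F: "finite F" "cball 0 B \<subseteq> (\<Union>w\<in>F. ball w (e / 2))"
    by (rule compactE_image[OF compact_cball, rotated]) (auto intro: that)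
  define \<kappa> where "\<kappa> = Min (insert 1 (r ` F))"
  have k: "0 < \<kappa>" "\<And>w. w \<in> F \<Longrightarrow> \<kappa> \<le> r w" unfolding \<kappa>_def using F(1) yr by auto
  show thesis
  proof (rule that[OF k(1)])
    fix w :: complex assume "w \<in> cball 0 B"
    then obtain v where v: "v \<in> F" "dist v w < e / 2" using F(2) by (auto simp: subset_iff)
    have "ball (y v) \<kappa> \<subseteq> ball (y v) (r v)" using k v by (intro subset_ball) auto
    also have "\<dots> \<subseteq> ball v (e / 2) - J" by (rule yr)
    also have "\<dots> \<subseteq> ball w e - J"
    proof
      fix x assume "x \<in> ball v (e / 2) - J"
      then show "x \<in> ball w e - J"
        using v dist_triangle[of w x v] by (auto simp: dist_commute)
    qed
    finally show "\<exists>y. ball y \<kappa> \<subseteq> ball w e - J" by blast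
  qed
qed

text \<open>At a good time the iterate maps a small disc about \<open>z\<close> with bounded degree onto a disc of definite
  size, in which the complement of the Julia set has a hole of definite size. Pulling the hole back shows
  that the Julia set is porous at \<open>z\<close>.\<close>

lemma slope_upper_exponent:
  fixes d :: nat and c z :: complex
  assumes d: "2 \<le> d" and z: "z \<in> julia (unicrit d c)" and pos: "\<And>j. 0 < radii d c z j"
    and low: "\<forall>\<^sub>F n in sequentially. exp (- real n) \<le> slope d (radii d c z) 0 n"
    and dense: "\<And>\<kappa>. 0 < \<kappa> \<Longrightarrow> \<not> porous_at \<kappa> (julia (unicrit d c)) z"
    and \<epsilon>: "0 < \<epsilon>"
  shows "\<forall>\<^sub>F n in sequentially. slope d (radii d c z) 0 n \<le> exp (\<epsilon> * real n)"
proof (rule ccontr)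
  let ?a = "radii d c z" and ?J = "julia (unicrit d c)"
  define B where "B = 2 + norm c"
  assume "\<not> ?thesis"
  then have high: "\<exists>\<^sub>F n in sequentially. exp (\<epsilon> * real n) < slope d ?a 0 n"
    by (simp add: frequently_def not_less)
  have aB: "?a j \<le> B" for j using norm_orbit_julia_le[OF d z] by (simp add: B_def)
  have B1: "1 \<le> B" by (simp add: B_def)
  obtain Nc where Nc: "\<exists>\<^sub>F n in sequentially. good_time d ?a \<epsilon> Nc n"
    using that by (rule frequently_good_times[OF d pos aB B1 \<epsilon> low high])
  define \<beta> where "\<beta> = \<epsilon> / 4"
  define \<delta> where "\<delta> = small_ratio d"
  have \<beta>: "0 < \<beta>" and \<delta>: "0 < \<delta>" using \<epsilon> small_ratio[OF d] by (auto simp: \<beta>_def \<delta>_def)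
  define Q where "Q = ((1 + 1 / small_ratio d) ^ d * exp (8 * real d * \<delta> / \<beta>)) ^ ((2 * d) ^ Nc)"
  have Q: "0 < Q" unfolding Q_def using small_ratio[OF d]
    by (intro zero_less_power mult_pos_pos) (auto intro: add_pos_pos)
  have "0 < \<delta> / Q" using \<delta> Q by simp
  then obtain \<kappa>0 where k0: "0 < \<kappa>0" "\<And>w. w \<in> cball 0 B \<Longrightarrow> \<exists>y. ball y \<kappa>0 \<subseteq> ball w (\<delta> / Q) - ?J"
    using uniform_holes[OF closed_julia[OF d] interior_julia[OF d]] by metis
  \<comment> \<open>Chosen so that the disc of radius \<open>s * (t / 2)\<close> about the
    pulled-back centre, whose image has radius at most s \<delta>, lands inside the hole. It depends
    on neither \<open>n\<close> nor the scale, as porosity requires.\<close>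
  define s where "s = min 1 (\<kappa>0 / (2 * \<delta>))"
  have s: "0 < s" "s \<le> 1" unfolding s_def using k0 \<delta> by auto
  have "s * \<delta> \<le> \<kappa>0 / (2 * \<delta>) * \<delta>" unfolding s_def using \<delta> by (intro mult_right_mono) auto
  then have sd: "s * \<delta> < \<kappa>0" using \<delta> k0 by simp
  have "porous_at (s / 2) ?J z"
    unfolding porous_at_def
  proof (intro allI impI)
    fix e :: real assume e: "0 < e"
    have "\<forall>\<^sub>F n in sequentially. \<delta> * exp (- (2 * \<beta>) * real n) < e"
      using order_tendstoD(2)[OF tendsto_exp_neg_linear[of "2 * \<beta>" \<delta>] e] \<beta> by simp
    from frequently_ex[OF frequently_eventually_conj[OF Nc this]] obtain n where
      n: "\<delta> * exp (- (2 * \<beta>) * real n) < e"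
        "\<forall>k\<le>n. exp (\<epsilon> / 2 * real (n - k)) * slope d ?a 0 k \<le> slope d ?a 0 n"
        "card {j. j < n \<and> ?a j < exp (- \<beta> * real (n - j))} \<le> Nc"
      unfolding \<beta>_def good_time_def by blast
    have sl: "0 < slope d ?a s m" for s m using pos d by (intro ln_slope) auto
    \<comment> \<open>The scale at which the majorant disc has radius exactly \<delta> at time
      \<open>n\<close>. Backward expansion at a good time then makes all earlier discs exponentially
      small, including the one about \<open>z\<close>.\<close>
    have "\<exists>t. 0 \<le> t \<and> t \<le> \<delta> / slope d ?a 0 n \<and> spread d ?a 0 n t = \<delta>"
    proof (rule IVT')
      show "spread d ?a 0 n 0 \<le> \<delta>" using spread_zero[of d ?a 0 n] d \<delta> by simp
      show "\<delta> \<le> spread d ?a 0 n (\<delta> / slope d ?a 0 n)"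
        using spread_ge_slope[of ?a "\<delta> / slope d ?a 0 n" d 0 n] sl[of 0 n] \<delta> by simp
    qed (use sl[of 0 n] \<delta> in \<open>auto intro: continuous_on_spread\<close>)
    then obtain t where t: "0 \<le> t" "spread d ?a 0 n t = \<delta>" by blast
    have "t \<noteq> 0" using t(2) spread_zero[of d ?a 0 n] d \<delta> by auto
    with t have t0: "0 < t" by simp
    have hyp: "spread d ?a 0 j t \<le> \<delta> * exp (- (2 * \<beta>) * real (n - j))" if j: "j \<le> n" for j
    proof -
      have "exp (\<epsilon> / 2 * real (n - j)) * slope d ?a 0 j \<le> slope d ?a j (n - j) * slope d ?a 0 j"
        using n(2)[rule_format, OF j] slope_add[of d ?a 0 j "n - j"] j by (simp add: mult.commute)
      then have "exp (\<epsilon> / 2 * real (n - j)) \<le> slope d ?a j (n - j)" using sl[of 0 j] by simp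
      moreover have nn: "0 \<le> spread d ?a 0 j t" using t by (intro spread_nonneg) auto
      ultimately have "exp (\<epsilon> / 2 * real (n - j)) * spread d ?a 0 j t \<le> slope d ?a j (n - j) * spread d ?a 0 j t"
        by (intro mult_right_mono)
      also have "\<dots> \<le> spread d ?a j (n - j) (spread d ?a 0 j t)"
        using nn by (intro spread_ge_slope) auto
      also have "\<dots> = \<delta>" using spread_add[of d ?a 0 j "n - j" t] j t(2) by simp
      finally have "exp (- (2 * \<beta>) * real (n - j)) * (exp (\<epsilon> / 2 * real (n - j)) * spread d ?a 0 j t)
          \<le> exp (- (2 * \<beta>) * real (n - j)) * \<delta>" by (intro mult_left_mono) auto
      moreover have "exp (- (2 * \<beta>) * real (n - j)) * exp (\<epsilon> / 2 * real (n - j)) = 1"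
        by (simp add: \<beta>_def flip: exp_add)
      ultimately have "1 * spread d ?a 0 j t \<le> exp (- (2 * \<beta>) * real (n - j)) * \<delta>"
        by (metis mult.assoc)
      then show ?thesis by (simp add: mult.commute)
    qed
    have te: "t < e" using hyp[of 0] n(1) by simp
    have "ball (orbit d c z n) (\<delta> / Q) \<subseteq> (\<lambda>w. orbit d c w n) ` ball z (t / 2)"
      using image_contains_ball[OF d t0 \<beta> \<delta> _ hyp n(3)] t(2) by (simp add: Q_def \<delta>_def)
    moreover obtain y where y: "ball y \<kappa>0 \<subseteq> ball (orbit d c z n) (\<delta> / Q) - ?J"
      using k0(2)[of "orbit d c z n"] aB[of n] by auto
    moreover have "y \<in> ball y \<kappa>0" using k0 by simp
    ultimately obtain x where x: "x \<in> ball z (t / 2)" "orbit d c x n = y" by blast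
    have "ball x (s / 2 * t) \<inter> ?J = {}"
    proof (rule ccontr)
      assume "\<not> ?thesis"
      then obtain w where w: "dist x w < s / 2 * t" "w \<in> ?J" by auto
      have "dist (orbit d c w n) y \<le> spread d (radii d c x) 0 n (s * (t / 2))"
        using orbit_dist_le[where u = w and d = d and c = c and z = x and s = 0 and r = "s * (t / 2)" and m = n] w x by (simp add: dist_commute)
      also have "\<dots> \<le> s * spread d (radii d c x) 0 n (t / 2)"
        using s t0 by (intro spread_scale_down) auto
      also have "\<dots> \<le> s * \<delta>"
      proof (rule mult_left_mono)
        have "dist (orbit d c x n) (orbit d c z n) + spread d (radii d c x) 0 n (t / 2)
            \<le> spread d ?a 0 n (t / 2 + t / 2)"
          using x t0 by (intro orbit_dist_add_spread_le) (auto simp: dist_commute)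
        also have "\<dots> = \<delta>" using t by simp
        finally show "spread d (radii d c x) 0 n (t / 2) \<le> \<delta>"
          using zero_le_dist[of "orbit d c x n" "orbit d c z n"] by linarith
      qed (use s in simp)
      also have "\<dots> < \<kappa>0" by (rule sd)
      finally have "orbit d c w n \<in> ball y \<kappa>0" by (simp add: dist_commute)
      then have "orbit d c w n \<notin> ?J" using y by blast
      then show False using orbit_in_julia[OF d w(2)] by blast
    qed
    moreover have "dist z x < t" using x t0 by simp
    ultimately show "\<exists>t w. 0 < t \<and> t < e \<and> dist z w < t \<and> ball w (s / 2 * t) \<inter> ?J = {}"
      using t0 te by blast
  qed
  then show False using dense[of "s / 2"] s by simp
qed

text \<open>Discards the countably many points whose orbit hits the critical point, so that all
  radii are positive and the logarithms are genuine.\<close>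

lemma finite_orbit_preimage: "2 \<le> d \<Longrightarrow> finite {z. orbit d c z k = w}"
proof (induction k arbitrary: w)
  case (Suc k)
  obtain xs where xs: "\<And>u. u ^ d - (w - c) = (\<Prod>x\<leftarrow>xs. u - x)"
    using power_minus_const_factorization[of d "w - c"] Suc.prems by auto
  have "{z. orbit d c z (Suc k) = w} \<subseteq> (\<Union>v\<in>set xs. {z. orbit d c z k = v})"
  proof
    fix z assume "z \<in> {z. orbit d c z (Suc k) = w}"
    then have "orbit d c z k ^ d - (w - c) = 0" by (simp add: unicrit_def algebra_simps)
    then have "orbit d c z k \<in> set xs" unfolding xs by (auto simp: prod_list_zero_iff)
    then show "z \<in> (\<Union>v\<in>set xs. {z. orbit d c z k = v})" by blast
  qed
  moreover have "finite (\<Union>v\<in>set xs. {z. orbit d c z k = v})" using Suc by auto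
  ultimately show ?case by (rule finite_subset)
qed auto

lemma norm_deriv_orbit: "norm (deriv (unicrit d c ^^ n) z) = slope d (radii d c z) 0 n"
proof -
  have "((unicrit d c ^^ n) has_field_derivative (\<Prod>i<n. of_nat d * orbit d c z i ^ (d - 1))) (at z)"
  proof (induction n)
    case 0
    show ?case by (simp add: id_def)
  next
    case (Suc n)
    have "(unicrit d c has_field_derivative of_nat d * orbit d c z n ^ (d - 1)) (at (orbit d c z n))"
      unfolding unicrit_def by (auto intro!: derivative_eq_intros)
    from DERIV_chain[OF this Suc] show ?case by (simp add: mult.commute o_def)
  qed
  then have "deriv (unicrit d c ^^ n) z = (\<Prod>i<n. of_nat d * orbit d c z i ^ (d - 1))"
    by (rule DERIV_imp_deriv)
  then show ?thesis by (simp add: slope_def prod_norm[symmetric] norm_mult norm_power)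
qed

theorem theorem1p4:
  fixes d :: nat and c :: complex
  assumes "d \<ge> 2"
    and "emeasure lborel (julia (unicrit d c)) > 0"
  shows "AE z in lborel. z \<in> julia (unicrit d c) \<longrightarrow>
           (\<lambda>n. ln (norm (deriv (unicrit d c ^^ n) z)) / real n) \<longlonglongrightarrow> 0"
proof -
  let ?J = "julia (unicrit d c)"
  note d = assms(1)
  have "AE z in lborel. \<forall>m. z \<in> ?J \<longrightarrow> \<not> porous_at (1 / real (Suc m)) ?J z"
    unfolding AE_all_countable using closed_julia[OF d] by (auto intro!: porous_null)
  moreover have "AE z in lborel. \<forall>k. orbit d c z k \<noteq> 0"
    unfolding AE_all_countable
  proof
    fix k
    have "{z. orbit d c z k = 0} \<in> null_sets lborel"
      using finite_orbit_preimage[OF d] by (rule finite_imp_null_set_lborel)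
    then show "AE z in lborel. orbit d c z k \<noteq> 0" by (rule AE_I') auto
  qed
  ultimately show ?thesis
    using slow_recurrence[OF d, of c]
  proof eventually_elim
    case (elim z)
    show ?case
    proof
      assume z: "z \<in> ?J"
      let ?a = "radii d c z"
      have pos: "0 < ?a j" for j using elim by simp
      have slow: "\<forall>\<^sub>F k in sequentially. exp (- \<epsilon> * real k) \<le> ?a k" if "0 < \<epsilon>" for \<epsilon>
        using elim z that by blast
      have low: "\<forall>\<^sub>F n in sequentially. exp (- \<epsilon> * real n) \<le> slope d ?a 0 n" if "0 < \<epsilon>" for \<epsilon>
        using slope_lower_exponent[OF d noncontracting_julia[OF d z] pos slow that] .
      \<comment> \<open>The null sets were removed only for the ratios 1 / (m + 1). Shrinking the
        holes passes from any \<kappa> to a smaller ratio of this form.\<close>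
      have dense: "\<not> porous_at \<kappa> ?J z" if k: "0 < \<kappa>" for \<kappa>
      proof
        assume por: "porous_at \<kappa> ?J z"
        obtain m where m: "1 / real (Suc m) < \<kappa>" using nat_approx_posE[OF k] by blast
        have "porous_at (1 / real (Suc m)) ?J z"
          unfolding porous_at_def
        proof (intro allI impI)
          fix e :: real assume "0 < e"
          then obtain t w where tw: "0 < t" "t < e" "dist z w < t" "ball w (\<kappa> * t) \<inter> ?J = {}"
            using por unfolding porous_at_def by blast
          have "ball w (1 / real (Suc m) * t) \<subseteq> ball w (\<kappa> * t)"
            using m tw by (intro subset_ball mult_right_mono) auto
          then show "\<exists>t w. 0 < t \<and> t < e \<and> dist z w < t \<and> ball w (1 / real (Suc m) * t) \<inter> ?J = {}"
            using tw by blast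
        qed
        then show False using elim z by blast
      qed
      have low1: "\<forall>\<^sub>F n in sequentially. exp (- real n) \<le> slope d ?a 0 n" using low[of 1] by simp
      show "(\<lambda>n. ln (norm (deriv (unicrit d c ^^ n) z)) / real n) \<longlonglongrightarrow> 0"
        unfolding norm_deriv_orbit
      proof (rule tendstoI)
        fix e :: real assume e: "0 < e"
        then have e2: "0 < e / 2" by simp
        have up: "\<forall>\<^sub>F n in sequentially. slope d ?a 0 n \<le> exp (e / 2 * real n)"
          by (rule slope_upper_exponent[OF d z pos low1 _ e2]) (rule dense)
        show "\<forall>\<^sub>F n in sequentially. dist (ln (slope d ?a 0 n) / real n) 0 < e"
          using low[OF e2] up eventually_gt_at_top[of 0]
        proof eventually_elim
          case (elim n)
          have sl: "0 < slope d ?a 0 n" using pos d by (intro ln_slope) auto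
          have "- (e / 2) * real n \<le> ln (slope d ?a 0 n)" using elim(1) sl by (simp add: ln_ge_iff)
          moreover have "ln (slope d ?a 0 n) \<le> e / 2 * real n"
            using elim(2) sl by (metis ln_exp ln_le_cancel_iff exp_gt_zero)
          ultimately have "\<bar>ln (slope d ?a 0 n)\<bar> \<le> e / 2 * real n" by linarith
          then have "\<bar>ln (slope d ?a 0 n)\<bar> / real n \<le> e / 2" using elim(3) by (simp add: divide_le_eq)
          also have "e / 2 < e" using e by simp
          finally show ?case by (simp add: dist_real_def)
        qed
      qed
    qed
  qed
qed


end
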